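(* Let $K$ be a field and $A=\bigoplus_{n\in\mathbb Z}A_n$ a unital $\mathbb Z$-graded $K$-algebra. Suppose that $A$ contains a unit $t$ of degree $1$, and put $\alpha(a)=tat^{-1}$ for $a\in A_0$. Then the following statements hold: (1) $A=A_0[t,t^{-1};\alpha]$ is a skew Laurent polynomial ring, and $A$ is strongly graded. (2) $-\otimes_{A_0}A_1\cong\alpha^{*}$ as functors $\mathsf{Mod}\text{-}A_0\to\mathsf{Mod}\text{-}A_0$, and therefore $\operatorname{proj} A\simeq(\mathsf{Mod}\text{-}A_0,A_0,\alpha^{*})$. (3) For every graded automorphism $\sigma$ of $A$, with $\sigma_0=\sigma|_{A_0}$, the element $t$ is a unit of the Zhang twist $A^\sigma$, and $$A^\sigma\cong A_0[u,u^{-1};\alpha\circ\sigma_0],\qquad \operatorname{proj} A^\sigma\simeq\big(\mathsf{Mod}\text{-}A_0,\ A_0,\ (\alpha\circ\sigma_0)^{*}\big).$$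
   Context: All modules are right modules. For a ring $R$ with automorphism $\gamma$, $R[t,t^{-1};\gamma]$ denotes the skew Laurent polynomial ring, in which every element is uniquely a finite sum $\sum_n a_nt^n$ with $a_n\in R$, and $ta=\gamma(a)t$ for $a\in R$. For a right $R$-module $N$, $\gamma^*N$ is $N$ with the action $n\cdot b=n\,\gamma(b)$. $A$ is strongly graded if $A_nA_m=A_{n+m}$ for all $n,m\in\mathbb Z$. The Zhang twist $A^\sigma$ has the same underlying graded space as $A$ and multiplication $a\star b=a\,\sigma^m(b)$ for $a\in A_m$, $b\in A$. $\mathsf{Gr}\text{-}A$ is the category of $\mathbb Z$-graded right $A$-modules with degree-preserving homomorphisms, $M(1)_n=M_{n+1}$. Put $I_A=A\big(\bigoplus_{n\ne0}A_n\big)A$. A full subcategory of a Grothendieck category is localizing if closed under subobjects, quotients, extensions and arbitrary direct sums. $\mathrm{Tors}_I(A)$ is the smallest localizing subcategory of $\mathsf{Gr}\text{-}A$ containing every graded $M$ with $MI_A=0$; $\mathsf{QGr}_I\text{-}A=\mathsf{Gr}\text{-}A/\mathrm{Tors}_I(A)$ (Gabriel quotient) with quotient functor $\pi$; and $\operatorname{proj}A=(\mathsf{QGr}_I\text{-}A,\pi(A_A),s)$ with $s$ the autoequivalence induced by $M\mapsto M(1)$. Two triples $(\mathcal C,\mathcal O,s)$, $(\mathcal C',\mathcal O',s')$ are equivalent ($\simeq$) if there is an equivalence $G\colon\mathcal C\to\mathcal C'$ with $G(\mathcal O)\cong\mathcal O'$ and a natural isomorphism $G\circ s\cong s'\circ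 G$. *)

theory Defs
  imports "HOL-Algebra.Module" "HOL-Algebra.QuotRing" "HOL-Algebra.Ideal_Product"
    "HOL-Algebra.Free_Abelian_Groups"
begin

section \<open>Categories, functors, triples\<close>

text \<open>
  Morphisms do not carry their source and target, so composition takes the three objects as
  arguments: \<open>Cmp C X Y Z g f\<close> is \<open>g \<circ> f\<close> for \<open>f : X \<rightarrow> Y\<close> and \<open>g : Y \<rightarrow> Z\<close>.
  Likewise \<open>farr F X Y f\<close> is the image of \<open>f : X \<rightarrow> Y\<close> under the functor \<open>F\<close>.
\<close>

record ('o, 'h) cat =
  Obj :: "'o set"
  Hom :: "'o \<Rightarrow> 'o \<Rightarrow> 'h set"
  Idn :: "'o \<Rightarrow> 'h"
  Cmp :: "'o \<Rightarrow> 'o \<Rightarrow> 'o \<Rightarrow> 'h \<Rightarrow> 'h \<Rightarrow> 'h"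

definition category :: "('o, 'h) cat \<Rightarrow> bool" where
  "category C \<longleftrightarrow>
     (\<forall>X\<in>Obj C. Idn C X \<in> Hom C X X) \<and>
     (\<forall>X\<in>Obj C. \<forall>Y\<in>Obj C. \<forall>Z\<in>Obj C. \<forall>f\<in>Hom C X Y. \<forall>g\<in>Hom C Y Z.
        Cmp C X Y Z g f \<in> Hom C X Z) \<and>
     (\<forall>X\<in>Obj C. \<forall>Y\<in>Obj C. \<forall>f\<in>Hom C X Y.
        Cmp C X Y Y (Idn C Y) f = f \<and> Cmp C X X Y f (Idn C X) = f) \<and>
     (\<forall>W\<in>Obj C. \<forall>X\<in>Obj C. \<forall>Y\<in>Obj C. \<forall>Z\<in>Obj C.
        \<forall>f\<in>Hom C W X. \<forall>g\<in>Hom C X Y. \<forall>h\<in>Hom C Y Z.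
        Cmp C W X Z (Cmp C X Y Z h g) f = Cmp C W Y Z h (Cmp C W X Y g f))"

definition iso_arrow :: "('o, 'h) cat \<Rightarrow> 'o \<Rightarrow> 'o \<Rightarrow> 'h \<Rightarrow> bool" where
  "iso_arrow C X Y f \<longleftrightarrow> f \<in> Hom C X Y \<and>
     (\<exists>g\<in>Hom C Y X. Cmp C X Y X g f = Idn C X \<and> Cmp C Y X Y f g = Idn C Y)"

definition isomorphic_objs :: "('o, 'h) cat \<Rightarrow> 'o \<Rightarrow> 'o \<Rightarrow> bool" where
  "isomorphic_objs C X Y \<longleftrightarrow> (\<exists>f. iso_arrow C X Y f)"

record ('o, 'h, 'p, 'k) cfunctor =
  fobj :: "'o \<Rightarrow> 'p"
  farr :: "'o \<Rightarrow> 'o \<Rightarrow> 'h \<Rightarrow> 'k"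

definition is_functor ::
    "('o, 'h) cat \<Rightarrow> ('p, 'k) cat \<Rightarrow> ('o, 'h, 'p, 'k) cfunctor \<Rightarrow> bool" where
  "is_functor C D F \<longleftrightarrow> category C \<and> category D \<and>
     (\<forall>X\<in>Obj C. fobj F X \<in> Obj D) \<and>
     (\<forall>X\<in>Obj C. \<forall>Y\<in>Obj C. \<forall>f\<in>Hom C X Y. farr F X Y f \<in> Hom D (fobj F X) (fobj F Y)) \<and>
     (\<forall>X\<in>Obj C. farr F X X (Idn C X) = Idn D (fobj F X)) \<and>
     (\<forall>X\<in>Obj C. \<forall>Y\<in>Obj C. \<forall>Z\<in>Obj C. \<forall>f\<in>Hom C X Y. \<forall>g\<in>Hom C Y Z.
        farr F X Z (Cmp C X Y Z g f) =
          Cmp D (fobj F X) (fobj F Y) (fobj F Z) (farr F Y Z g) (farr F X Y f))"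

definition id_functor :: "('o, 'h, 'o, 'h) cfunctor" where
  "id_functor = \<lparr>fobj = (\<lambda>X. X), farr = (\<lambda>X Y f. f)\<rparr>"

definition comp_functor ::
    "('p, 'k, 'q, 'l) cfunctor \<Rightarrow> ('o, 'h, 'p, 'k) cfunctor \<Rightarrow> ('o, 'h, 'q, 'l) cfunctor"
    (infixl \<open>\<circ>F\<close> 55) where
  "G \<circ>F F = \<lparr>fobj = (\<lambda>X. fobj G (fobj F X)),
              farr = (\<lambda>X Y f. farr G (fobj F X) (fobj F Y) (farr F X Y f))\<rparr>"

definition naturally_isomorphic ::
    "('o, 'h) cat \<Rightarrow> ('p, 'k) cat \<Rightarrow> ('o, 'h, 'p, 'k) cfunctor \<Rightarrow> ('o, 'h, 'p, 'k) cfunctor \<Rightarrow> bool"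
    where
  "naturally_isomorphic C D F G \<longleftrightarrow> is_functor C D F \<and> is_functor C D G \<and>
     (\<exists>\<eta>. (\<forall>X\<in>Obj C. iso_arrow D (fobj F X) (fobj G X) (\<eta> X)) \<and>
          (\<forall>X\<in>Obj C. \<forall>Y\<in>Obj C. \<forall>f\<in>Hom C X Y.
             Cmp D (fobj F X) (fobj F Y) (fobj G Y) (\<eta> Y) (farr F X Y f) =
             Cmp D (fobj F X) (fobj G X) (fobj G Y) (farr G X Y f) (\<eta> X)))"

definition cat_equivalence ::
    "('o, 'h) cat \<Rightarrow> ('p, 'k) cat \<Rightarrow> ('o, 'h, 'p, 'k) cfunctor \<Rightarrow> bool" where
  "cat_equivalence C D G \<longleftrightarrow> is_functor C D G \<and>
     (\<exists>H. is_functor D C H \<and>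
          naturally_isomorphic C C (H \<circ>F G) id_functor \<and>
          naturally_isomorphic D D (G \<circ>F H) id_functor)"

type_synonym ('o, 'h) cat_triple = "('o, 'h) cat \<times> 'o \<times> ('o, 'h, 'o, 'h) cfunctor"

definition is_triple :: "('o, 'h) cat_triple \<Rightarrow> bool" where
  "is_triple = (\<lambda>(C, P, s). category C \<and> P \<in> Obj C \<and> cat_equivalence C C s)"

definition triple_equiv :: "('o, 'h) cat_triple \<Rightarrow> ('p, 'k) cat_triple \<Rightarrow> bool"
    (infix \<open>\<simeq>\<^sub>t\<close> 50) where
  "T \<simeq>\<^sub>t T' \<longleftrightarrow> is_triple T \<and> is_triple T' \<and>
     (case T of (C, P, s) \<Rightarrow> case T' of (C', P', s') \<Rightarrow>
        \<exists>G. cat_equivalence C C' G \<and> isomorphic_objs C' (fobj G P) P' \<and>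
            naturally_isomorphic C C' (G \<circ>F s) (s' \<circ>F G))"

section \<open>Localization of a category at a class of morphisms\<close>

text \<open>
  \<open>W X Y\<close> is the set of morphisms \<open>X \<rightarrow> Y\<close> to be inverted; it is meant to admit a calculus of
  right fractions.  A roof \<open>(X, s, f)\<close> from \<open>M\<close> to \<open>N\<close> is a diagram \<open>M \<leftarrow> X \<rightarrow> N\<close> with
  \<open>s : X \<rightarrow> M\<close> in \<open>W\<close>, standing for \<open>f \<circ> s\<^sup>-\<^sup>1\<close>.  Morphisms of the localization are equivalence
  classes of roofs.
\<close>

definition roofs ::
    "('o, 'h) cat \<Rightarrow> ('o \<Rightarrow> 'o \<Rightarrow> 'h set) \<Rightarrow> 'o \<Rightarrow> 'o \<Rightarrow> ('o \<times> 'h \<times> 'h) set" where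
  "roofs C W M N = {(X, s, f). X \<in> Obj C \<and> s \<in> W X M \<and> f \<in> Hom C X N}"

definition roof_class ::
    "('o, 'h) cat \<Rightarrow> ('o \<Rightarrow> 'o \<Rightarrow> 'h set) \<Rightarrow> 'o \<Rightarrow> 'o \<Rightarrow> 'o \<times> 'h \<times> 'h \<Rightarrow> ('o \<times> 'h \<times> 'h) set"
    where
  "roof_class C W M N = (\<lambda>(X, s, f). {(Y, t, g) \<in> roofs C W M N.
     \<exists>Z\<in>Obj C. \<exists>u\<in>Hom C Z X. \<exists>v\<in>Hom C Z Y.
       Cmp C Z X M s u = Cmp C Z Y M t v \<and> Cmp C Z X M s u \<in> W Z M \<and>
       Cmp C Z X N f u = Cmp C Z Y N g v})"

text \<open>
  The composite of the classes of \<open>(X, s, f) : L \<rightarrow> M\<close> and \<open>(Y, t, g) : M \<rightarrow> N\<close> is the class of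
  \<open>(Z, s \<circ> u, g \<circ> v)\<close> for any commutative square \<open>f \<circ> u = t \<circ> v\<close> with \<open>u : Z \<rightarrow> X\<close> in \<open>W\<close>; the
  union over all choices avoids selecting one.
\<close>

definition localization ::
    "('o, 'h) cat \<Rightarrow> ('o \<Rightarrow> 'o \<Rightarrow> 'h set) \<Rightarrow> ('o, ('o \<times> 'h \<times> 'h) set) cat" where
  "localization C W =
     \<lparr>Obj = Obj C,
      Hom = (\<lambda>M N. roof_class C W M N ` roofs C W M N),
      Idn = (\<lambda>M. roof_class C W M M (M, Idn C M, Idn C M)),
      Cmp = (\<lambda>L M N \<psi> \<phi>.
        \<Union>{roof_class C W L N (Z, Cmp C Z X L s u, Cmp C Z Y N g v) | X s f Y t g Z u v.
            (X, s, f) \<in> \<phi> \<and> (Y, t, g) \<in> \<psi> \<and> Z \<in> Obj C \<and> u \<in> W Z X \<and> v \<in> Hom C Z Y \<and>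
            Cmp C Z X M f u = Cmp C Z Y M t v})\<rparr>"

definition localization_functor ::
    "('o, 'h) cat \<Rightarrow> ('o \<Rightarrow> 'o \<Rightarrow> 'h set) \<Rightarrow> ('o, 'h, 'o, ('o \<times> 'h \<times> 'h) set) cfunctor" where
  "localization_functor C W =
     \<lparr>fobj = (\<lambda>M. M), farr = (\<lambda>M N f. roof_class C W M N (M, Idn C M, f))\<rparr>"

definition induced_functor ::
    "('o, 'h) cat \<Rightarrow> ('o \<Rightarrow> 'o \<Rightarrow> 'h set) \<Rightarrow> ('o, 'h, 'o, 'h) cfunctor \<Rightarrow>
     ('o, ('o \<times> 'h \<times> 'h) set, 'o, ('o \<times> 'h \<times> 'h) set) cfunctor" where
  "induced_functor C W S =
     \<lparr>fobj = fobj S,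
      farr = (\<lambda>M N \<phi>. \<Union>(X, s, f)\<in>\<phi>.
        roof_class C W (fobj S M) (fobj S N) (fobj S X, farr S X M s, farr S X N f))\<rparr>"

section \<open>Internal direct sums\<close>

definition fin_families ::
    "('b, 'z) ring_scheme \<Rightarrow> 'i set \<Rightarrow> ('i \<Rightarrow> 'b set) \<Rightarrow> ('i \<Rightarrow> 'b) set" where
  "fin_families G I D = {c. (\<forall>i\<in>I. c i \<in> D i) \<and> (\<forall>i. i \<notin> I \<longrightarrow> c i = \<zero>\<^bsub>G\<^esub>) \<and>
                            finite {i. c i \<noteq> \<zero>\<^bsub>G\<^esub>}}"

definition fin_sum :: "('b, 'z) ring_scheme \<Rightarrow> ('i \<Rightarrow> 'b) \<Rightarrow> 'b" where
  "fin_sum G c = (\<Oplus>\<^bsub>G\<^esub>i\<in>{i. c i \<noteq> \<zero>\<^bsub>G\<^esub>}. c i)"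

definition internal_direct_sum ::
    "('b, 'z) ring_scheme \<Rightarrow> 'i set \<Rightarrow> ('i \<Rightarrow> 'b set) \<Rightarrow> bool" where
  "internal_direct_sum G I D \<longleftrightarrow> (\<forall>i\<in>I. additive_subgroup (D i) G) \<and>
     bij_betw (fin_sum G) (fin_families G I D) (carrier G)"

definition components :: "('b, 'z) ring_scheme \<Rightarrow> (int \<Rightarrow> 'b set) \<Rightarrow> 'b \<Rightarrow> int \<Rightarrow> 'b" where
  "components G D x = inv_into (fin_families G UNIV D) (fin_sum G) x"

section \<open>Graded algebras, skew Laurent polynomials, Zhang twists\<close>

text \<open>The library locale \<open>algebra\<close> is restricted to commutative algebras.\<close>

definition assoc_algebra :: "('k, 'y) ring_scheme \<Rightarrow> ('k, 'a, 'z) module_scheme \<Rightarrow> bool" where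
  "assoc_algebra K A \<longleftrightarrow> field K \<and> ring A \<and> module K A \<and>
     (\<forall>k\<in>carrier K. \<forall>x\<in>carrier A. \<forall>y\<in>carrier A.
        (k \<odot>\<^bsub>A\<^esub> x) \<otimes>\<^bsub>A\<^esub> y = k \<odot>\<^bsub>A\<^esub> (x \<otimes>\<^bsub>A\<^esub> y) \<and>
        x \<otimes>\<^bsub>A\<^esub> (k \<odot>\<^bsub>A\<^esub> y) = k \<odot>\<^bsub>A\<^esub> (x \<otimes>\<^bsub>A\<^esub> y))"

definition graded_algebra ::
    "('k, 'y) ring_scheme \<Rightarrow> ('k, 'a, 'z) module_scheme \<Rightarrow> (int \<Rightarrow> 'a set) \<Rightarrow> bool" where
  "graded_algebra K A \<A> \<longleftrightarrow> assoc_algebra K A \<and> internal_direct_sum A UNIV \<A> \<and>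
     (\<forall>n. \<forall>k\<in>carrier K. \<forall>x\<in>\<A> n. k \<odot>\<^bsub>A\<^esub> x \<in> \<A> n) \<and>
     (\<forall>n m. \<forall>x\<in>\<A> n. \<forall>y\<in>\<A> m. x \<otimes>\<^bsub>A\<^esub> y \<in> \<A> (n + m))"

definition algebra_iso ::
    "('k, 'y) ring_scheme \<Rightarrow> ('k, 'a, 'z) module_scheme \<Rightarrow> ('k, 'b, 'w) module_scheme \<Rightarrow>
     ('a \<Rightarrow> 'b) \<Rightarrow> bool" where
  "algebra_iso K A B \<phi> \<longleftrightarrow> \<phi> \<in> ring_iso A B \<and>
     (\<forall>k\<in>carrier K. \<forall>x\<in>carrier A. \<phi> (k \<odot>\<^bsub>A\<^esub> x) = k \<odot>\<^bsub>B\<^esub> \<phi> x)"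

definition graded_algebra_iso ::
    "('k, 'y) ring_scheme \<Rightarrow> ('k, 'a, 'z) module_scheme \<Rightarrow> (int \<Rightarrow> 'a set) \<Rightarrow>
     ('k, 'b, 'w) module_scheme \<Rightarrow> (int \<Rightarrow> 'b set) \<Rightarrow> ('a \<Rightarrow> 'b) \<Rightarrow> bool" where
  "graded_algebra_iso K A \<A> B \<B> \<phi> \<longleftrightarrow> algebra_iso K A B \<phi> \<and> (\<forall>n. \<phi> ` \<A> n = \<B> n)"

definition degree_zero ::
    "('k, 'a) module \<Rightarrow> (int \<Rightarrow> 'a set) \<Rightarrow> ('k, 'a) module" where
  "degree_zero A \<A> = A\<lparr>carrier := \<A> 0\<rparr>"

text \<open>
  \<open>I \<cdot>\<^bsub>A\<^esub> J\<close> is the set of finite sums of products \<open>i \<otimes> j\<close>, also for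
  additive subgroups \<open>I\<close>, \<open>J\<close> that are not ideals.
\<close>

definition strongly_graded :: "('k, 'a) module \<Rightarrow> (int \<Rightarrow> 'a set) \<Rightarrow> bool" where
  "strongly_graded A \<A> \<longleftrightarrow> (\<forall>n m. \<A> n \<cdot>\<^bsub>A\<^esub> \<A> m = \<A> (n + m))"

text \<open>Integer powers of a self-map that is bijective on \<open>S\<close>.\<close>

definition aut_power :: "'a set \<Rightarrow> ('a \<Rightarrow> 'a) \<Rightarrow> int \<Rightarrow> 'a \<Rightarrow> 'a" where
  "aut_power S \<gamma> n = (if 0 \<le> n then \<gamma> ^^ nat n else (inv_into S \<gamma>) ^^ nat (- n))"

text \<open>
  \<open>R[u, u\<^sup>-\<^sup>1; \<gamma>]\<close>: the finitely supported family \<open>f\<close> stands for the sum of the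
  \<open>f n u\<^sup>n\<close>, and \<open>u a = \<gamma>(a) u\<close> gives \<open>(a u\<^sup>i) (b u\<^sup>j) = a \<gamma>\<^sup>i(b) u\<^sup>i\<^sup>+\<^sup>j\<close>.
\<close>

definition skew_laurent ::
    "('k, 'r) module \<Rightarrow> ('r \<Rightarrow> 'r) \<Rightarrow> ('k, int \<Rightarrow> 'r) module" where
  "skew_laurent R \<gamma> =
     \<lparr>carrier = {f. (\<forall>n. f n \<in> carrier R) \<and> finite {n. f n \<noteq> \<zero>\<^bsub>R\<^esub>}},
      monoid.mult = (\<lambda>f g n.
        \<Oplus>\<^bsub>R\<^esub>i\<in>{i. f i \<noteq> \<zero>\<^bsub>R\<^esub>}. f i \<otimes>\<^bsub>R\<^esub> aut_power (carrier R) \<gamma> i (g (n - i))),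
      one = (\<lambda>n. if n = 0 then \<one>\<^bsub>R\<^esub> else \<zero>\<^bsub>R\<^esub>),
      ring.zero = (\<lambda>n. \<zero>\<^bsub>R\<^esub>),
      add = (\<lambda>f g n. f n \<oplus>\<^bsub>R\<^esub> g n),
      smult = (\<lambda>k f n. k \<odot>\<^bsub>R\<^esub> f n)\<rparr>"

definition skew_laurent_grading ::
    "('k, 'r) module \<Rightarrow> int \<Rightarrow> (int \<Rightarrow> 'r) set" where
  "skew_laurent_grading R n = {f. f n \<in> carrier R \<and> (\<forall>m. m \<noteq> n \<longrightarrow> f m = \<zero>\<^bsub>R\<^esub>)}"

definition laurent_eval :: "('k, 'a) module \<Rightarrow> 'a \<Rightarrow> (int \<Rightarrow> 'a) \<Rightarrow> 'a" where
  "laurent_eval A t f = (\<Oplus>\<^bsub>A\<^esub>n\<in>{n. f n \<noteq> \<zero>\<^bsub>A\<^esub>}. f n \<otimes>\<^bsub>A\<^esub> t [^]\<^bsub>A\<^esub> n)"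

definition zhang_twist ::
    "('k, 'a) module \<Rightarrow> (int \<Rightarrow> 'a set) \<Rightarrow> ('a \<Rightarrow> 'a) \<Rightarrow> ('k, 'a) module" where
  "zhang_twist A \<A> \<sigma> = A\<lparr>monoid.mult := (\<lambda>a b.
     \<Oplus>\<^bsub>A\<^esub>m\<in>{m. components A \<A> a m \<noteq> \<zero>\<^bsub>A\<^esub>}.
       components A \<A> a m \<otimes>\<^bsub>A\<^esub> aut_power (carrier A) \<sigma> m b)\<rparr>"

section \<open>Right modules\<close>

text \<open>
  Only the additive part of the underlying ring record is used; its fields \<open>mult\<close> and \<open>one\<close>
  are irrelevant.  The carriers of the modules forming a category are subsets of one type
  \<open>'m\<close>, which plays the role of the universe of small sets.
\<close>

record ('r, 'm) rmod = "'m ring" +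
  ract :: "'m \<Rightarrow> 'r \<Rightarrow> 'm"

definition right_module :: "('r, 'y) ring_scheme \<Rightarrow> ('r, 'm, 'z) rmod_scheme \<Rightarrow> bool" where
  "right_module R M \<longleftrightarrow> ring R \<and> abelian_group M \<and>
     (\<forall>x\<in>carrier M. \<forall>a\<in>carrier R. ract M x a \<in> carrier M) \<and>
     (\<forall>x\<in>carrier M. \<forall>y\<in>carrier M. \<forall>a\<in>carrier R.
        ract M (x \<oplus>\<^bsub>M\<^esub> y) a = ract M x a \<oplus>\<^bsub>M\<^esub> ract M y a) \<and>
     (\<forall>x\<in>carrier M. \<forall>a\<in>carrier R. \<forall>b\<in>carrier R.
        ract M x (a \<oplus>\<^bsub>R\<^esub> b) = ract M x a \<oplus>\<^bsub>M\<^esub> ract M x b \<and>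
        ract M x (a \<otimes>\<^bsub>R\<^esub> b) = ract M (ract M x a) b) \<and>
     (\<forall>x\<in>carrier M. ract M x \<one>\<^bsub>R\<^esub> = x)"

definition rmod_hom ::
    "('r, 'y) ring_scheme \<Rightarrow> ('r, 'm, 'z) rmod_scheme \<Rightarrow> ('r, 'n, 'w) rmod_scheme \<Rightarrow> ('m \<Rightarrow> 'n) set"
    where
  "rmod_hom R M N = {f \<in> carrier M \<rightarrow>\<^sub>E carrier N.
     (\<forall>x\<in>carrier M. \<forall>y\<in>carrier M. f (x \<oplus>\<^bsub>M\<^esub> y) = f x \<oplus>\<^bsub>N\<^esub> f y) \<and>
     (\<forall>x\<in>carrier M. \<forall>a\<in>carrier R. f (ract M x a) = ract N (f x) a)}"

definition Mod_cat :: "('r, 'y) ring_scheme \<Rightarrow> (('r, 'm) rmod, 'm \<Rightarrow> 'm) cat" where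
  "Mod_cat R = \<lparr>Obj = {M. right_module R M},
                Hom = rmod_hom R,
                Idn = (\<lambda>M. restrict (\<lambda>x. x) (carrier M)),
                Cmp = (\<lambda>L M N g f. compose (carrier L) g f)\<rparr>"

text \<open>The functor \<open>\<gamma>\<^sup>*\<close>.\<close>

definition pullback_functor ::
    "('r \<Rightarrow> 'r) \<Rightarrow> (('r, 'm) rmod, 'm \<Rightarrow> 'm, ('r, 'm) rmod, 'm \<Rightarrow> 'm) cfunctor" where
  "pullback_functor \<gamma> =
     \<lparr>fobj = (\<lambda>N. N\<lparr>ract := (\<lambda>x b. ract N x (\<gamma> b))\<rparr>), farr = (\<lambda>M N f. f)\<rparr>"

text \<open>Meaningful when \<open>j\<close> is injective on the carrier.\<close>

definition transport_rmod :: "('n \<Rightarrow> 'm) \<Rightarrow> ('r, 'n, 'z) rmod_scheme \<Rightarrow> ('r, 'm) rmod" where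
  "transport_rmod j M = (let i = inv_into (carrier M) j in
     \<lparr>carrier = j ` carrier M, monoid.mult = undefined, one = undefined,
      ring.zero = j \<zero>\<^bsub>M\<^esub>, add = (\<lambda>x y. j (i x \<oplus>\<^bsub>M\<^esub> i y)),
      ract = (\<lambda>x a. j (ract M (i x) a))\<rparr>)"

definition regular_rmod :: "('r, 'y) ring_scheme \<Rightarrow> ('r, 'r) rmod" where
  "regular_rmod R = \<lparr>carrier = carrier R, monoid.mult = monoid.mult R, one = one R,
                     ring.zero = ring.zero R, add = add R, ract = monoid.mult R\<rparr>"

section \<open>Tensor products\<close>

record ('l, 'r, 'b) bimod = "('r, 'b) rmod" +
  lact :: "'l \<Rightarrow> 'b \<Rightarrow> 'b"

definition tensor_relations ::
    "('r, 'y) ring_scheme \<Rightarrow> ('r, 'm) rmod \<Rightarrow> ('r, 's, 'b) bimod \<Rightarrow> ('m \<times> 'b \<Rightarrow>\<^sub>0 int) set" where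
  "tensor_relations R N B =
     {frag_of (x \<oplus>\<^bsub>N\<^esub> y, b) - frag_of (x, b) - frag_of (y, b) | x y b.
        x \<in> carrier N \<and> y \<in> carrier N \<and> b \<in> carrier B} \<union>
     {frag_of (x, b \<oplus>\<^bsub>B\<^esub> c) - frag_of (x, b) - frag_of (x, c) | x b c.
        x \<in> carrier N \<and> b \<in> carrier B \<and> c \<in> carrier B} \<union>
     {frag_of (ract N x r, b) - frag_of (x, lact B r b) | x r b.
        x \<in> carrier N \<and> r \<in> carrier R \<and> b \<in> carrier B}"

definition tensor_subgroup ::
    "('r, 'y) ring_scheme \<Rightarrow> ('r, 'm) rmod \<Rightarrow> ('r, 's, 'b) bimod \<Rightarrow> ('m \<times> 'b \<Rightarrow>\<^sub>0 int) set" where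
  "tensor_subgroup R N B =
     generate (free_Abelian_group (carrier N \<times> carrier B)) (tensor_relations R N B)"

definition tensor_class ::
    "('r, 'y) ring_scheme \<Rightarrow> ('r, 'm) rmod \<Rightarrow> ('r, 's, 'b) bimod \<Rightarrow>
     ('m \<times> 'b \<Rightarrow>\<^sub>0 int) \<Rightarrow> ('m \<times> 'b \<Rightarrow>\<^sub>0 int) set" where
  "tensor_class R N B c =
     tensor_subgroup R N B #>\<^bsub>free_Abelian_group (carrier N \<times> carrier B)\<^esub> c"

text \<open>
  In \<open>ract\<close> below and in \<open>tensor_map\<close>, the map \<open>x \<otimes> b \<mapsto> x \<otimes> (b s)\<close>, respectively
  \<open>x \<otimes> b \<mapsto> f x \<otimes> b\<close>, is applied to every representative of a class.
\<close>

definition tensor ::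
    "('r, 'y) ring_scheme \<Rightarrow> ('r, 'm) rmod \<Rightarrow> ('r, 's, 'b) bimod \<Rightarrow>
     ('s, ('m \<times> 'b \<Rightarrow>\<^sub>0 int) set) rmod" where
  "tensor R N B =
     (let Q = free_Abelian_group (carrier N \<times> carrier B) Mod tensor_subgroup R N B in
      \<lparr>carrier = carrier Q, monoid.mult = undefined, one = undefined, ring.zero = one Q,
       add = monoid.mult Q,
       ract = (\<lambda>X s. \<Union>c\<in>X. tensor_class R N B
                 (frag_extend (\<lambda>(x, b). frag_of (x, ract B b s)) c))\<rparr>)"

definition tensor_map ::
    "('r, 'y) ring_scheme \<Rightarrow> ('r, 'm) rmod \<Rightarrow> ('r, 's, 'b) bimod \<Rightarrow> ('m \<Rightarrow> 'm) \<Rightarrow>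
     ('m \<times> 'b \<Rightarrow>\<^sub>0 int) set \<Rightarrow> ('m \<times> 'b \<Rightarrow>\<^sub>0 int) set" where
  "tensor_map R N' B f X =
     (\<Union>c\<in>X. tensor_class R N' B (frag_extend (\<lambda>(x, b). frag_of (f x, b)) c))"

text \<open>
  The module \<open>tensor R N B\<close> does not live on the universe \<open>'m\<close>; it is moved there along a
  chosen injection, so that \<open>- \<otimes>\<^sub>R B\<close> is a functor from \<open>Mod_cat R\<close> to \<open>Mod_cat S\<close> over
  the same universe.
\<close>

definition chosen_injection :: "('r, 'n) rmod \<Rightarrow> 'n \<Rightarrow> 'm" where
  "chosen_injection M = (SOME j. inj_on j (carrier M))"

definition tensor_functor ::
    "('r, 'y) ring_scheme \<Rightarrow> ('r, 's, 'b) bimod \<Rightarrow>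
     (('r, 'm) rmod, 'm \<Rightarrow> 'm, ('s, 'm) rmod, 'm \<Rightarrow> 'm) cfunctor" where
  "tensor_functor R B =
     \<lparr>fobj = (\<lambda>N. transport_rmod (chosen_injection (tensor R N B)) (tensor R N B)),
      farr = (\<lambda>N N' f.
        let T = tensor R N B; j = chosen_injection T; j' = chosen_injection (tensor R N' B)
        in restrict (\<lambda>x. j' (tensor_map R N' B f (inv_into (carrier T) j x))) (j ` carrier T))\<rparr>"

definition component_bimod ::
    "('k, 'a) module \<Rightarrow> (int \<Rightarrow> 'a set) \<Rightarrow> int \<Rightarrow> ('a, 'a, 'a) bimod" where
  "component_bimod A \<A> n =
     \<lparr>carrier = \<A> n, monoid.mult = monoid.mult A, one = one A, ring.zero = ring.zero A, add = add A,
      ract = monoid.mult A, lact = monoid.mult A\<rparr>"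

section \<open>Graded modules and the noncommutative projective scheme\<close>

record ('r, 'm) gmod = "('r, 'm) rmod" +
  grade :: "int \<Rightarrow> 'm set"

definition graded_module ::
    "('k, 'a) module \<Rightarrow> (int \<Rightarrow> 'a set) \<Rightarrow> ('a, 'm) gmod \<Rightarrow> bool" where
  "graded_module A \<A> M \<longleftrightarrow> right_module A M \<and> internal_direct_sum M UNIV (grade M) \<and>
     (\<forall>n m. \<forall>x\<in>grade M n. \<forall>a\<in>\<A> m. ract M x a \<in> grade M (n + m))"

definition gmod_hom ::
    "('k, 'a) module \<Rightarrow> ('a, 'm) gmod \<Rightarrow> ('a, 'm) gmod \<Rightarrow> ('m \<Rightarrow> 'm) set" where
  "gmod_hom A M N = {f \<in> rmod_hom A M N. \<forall>n. f ` grade M n \<subseteq> grade N n}"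

definition Gr :: "('k, 'a) module \<Rightarrow> (int \<Rightarrow> 'a set) \<Rightarrow> (('a, 'm) gmod, 'm \<Rightarrow> 'm) cat" where
  "Gr A \<A> = \<lparr>Obj = {M. graded_module A \<A> M},
             Hom = gmod_hom A,
             Idn = (\<lambda>M. restrict (\<lambda>x. x) (carrier M)),
             Cmp = (\<lambda>L M N g f. compose (carrier L) g f)\<rparr>"

definition shift_functor ::
    "(('a, 'm) gmod, 'm \<Rightarrow> 'm, ('a, 'm) gmod, 'm \<Rightarrow> 'm) cfunctor" where
  "shift_functor = \<lparr>fobj = (\<lambda>M. M\<lparr>grade := (\<lambda>n. grade M (n + 1))\<rparr>), farr = (\<lambda>M N f. f)\<rparr>"

definition transport_gmod :: "('n \<Rightarrow> 'm) \<Rightarrow> ('r, 'n) gmod \<Rightarrow> ('r, 'm) gmod" where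
  "transport_gmod j M =
     rmod.extend (transport_rmod j M) \<lparr>grade = (\<lambda>n. j ` grade M n)\<rparr>"

definition regular_gmod :: "('k, 'a) module \<Rightarrow> (int \<Rightarrow> 'a set) \<Rightarrow> ('a, 'a) gmod" where
  "regular_gmod A \<A> = rmod.extend (regular_rmod A) \<lparr>grade = \<A>\<rparr>"

definition short_exact ::
    "('k, 'a) module \<Rightarrow> ('a, 'm) gmod \<Rightarrow> ('m \<Rightarrow> 'm) \<Rightarrow> ('a, 'm) gmod \<Rightarrow> ('m \<Rightarrow> 'm) \<Rightarrow>
     ('a, 'm) gmod \<Rightarrow> bool" where
  "short_exact A L f M g N \<longleftrightarrow> f \<in> gmod_hom A L M \<and> g \<in> gmod_hom A M N \<and>
     inj_on f (carrier L) \<and> g ` carrier M = carrier N \<and>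
     f ` carrier L = {x \<in> carrier M. g x = \<zero>\<^bsub>N\<^esub>}"

text \<open>
  A module on the universe \<open>'m\<close> has at most as many nonzero direct summands as \<open>'m\<close> has
  elements, so index sets in \<open>'m\<close> account for all direct sums that exist in \<open>Gr A \<A>\<close>.
\<close>

definition localizing ::
    "('k, 'a) module \<Rightarrow> (int \<Rightarrow> 'a set) \<Rightarrow> ('a, 'm) gmod set \<Rightarrow> bool" where
  "localizing A \<A> T \<longleftrightarrow> T \<subseteq> {M. graded_module A \<A> M} \<and>
     (\<forall>M\<in>T. \<forall>N. graded_module A \<A> N \<longrightarrow>
        (\<exists>f\<in>gmod_hom A N M. inj_on f (carrier N)) \<longrightarrow> N \<in> T) \<and>
     (\<forall>M\<in>T. \<forall>N. graded_module A \<A> N \<longrightarrow>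
        (\<exists>f\<in>gmod_hom A M N. f ` carrier M = carrier N) \<longrightarrow> N \<in> T) \<and>
     (\<forall>L\<in>T. \<forall>N\<in>T. \<forall>M. graded_module A \<A> M \<longrightarrow>
        (\<exists>f g. short_exact A L f M g N) \<longrightarrow> M \<in> T) \<and>
     (\<forall>(I :: 'm set) N j M. graded_module A \<A> M \<longrightarrow>
        (\<forall>i\<in>I. N i \<in> T \<and> j i \<in> gmod_hom A (N i) M \<and> inj_on (j i) (carrier (N i))) \<longrightarrow>
        internal_direct_sum M I (\<lambda>i. j i ` carrier (N i)) \<longrightarrow> M \<in> T)"

text \<open>The ideal \<open>I\<^sub>A\<close>; the middle factor is the subgroup of sums of elements of nonzero degree.\<close>

definition irrelevant_ideal :: "('k, 'a) module \<Rightarrow> (int \<Rightarrow> 'a set) \<Rightarrow> 'a set" where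
  "irrelevant_ideal A \<A> =
     carrier A \<cdot>\<^bsub>A\<^esub> (fin_sum A ` fin_families A (- {0}) \<A>) \<cdot>\<^bsub>A\<^esub> carrier A"

definition Tors :: "('k, 'a) module \<Rightarrow> (int \<Rightarrow> 'a set) \<Rightarrow> ('a, 'm) gmod set" where
  "Tors A \<A> = \<Inter>{T. localizing A \<A> T \<and>
     {M. graded_module A \<A> M \<and>
         (\<forall>x\<in>carrier M. \<forall>a\<in>irrelevant_ideal A \<A>. ract M x a = \<zero>\<^bsub>M\<^esub>)} \<subseteq> T}"

text \<open>
  The Gabriel quotient by a localizing subcategory is the localization at the morphisms
  whose kernel and cokernel lie in the subcategory.
\<close>

definition torsion_isos ::
    "('k, 'a) module \<Rightarrow> (int \<Rightarrow> 'a set) \<Rightarrow> ('a, 'm) gmod \<Rightarrow> ('a, 'm) gmod \<Rightarrow> ('m \<Rightarrow> 'm) set" where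
  "torsion_isos A \<A> M N = {f \<in> gmod_hom A M N.
     (\<exists>L\<in>Tors A \<A>. \<exists>i\<in>gmod_hom A L M.
        inj_on i (carrier L) \<and> i ` carrier L = {x \<in> carrier M. f x = \<zero>\<^bsub>N\<^esub>}) \<and>
     (\<exists>Q\<in>Tors A \<A>. \<exists>p\<in>gmod_hom A N Q.
        p ` carrier N = carrier Q \<and> {y \<in> carrier N. p y = \<zero>\<^bsub>Q\<^esub>} = f ` carrier M)}"

definition QGr ::
    "('k, 'a) module \<Rightarrow> (int \<Rightarrow> 'a set) \<Rightarrow>
     (('a, 'm) gmod, (('a, 'm) gmod \<times> ('m \<Rightarrow> 'm) \<times> ('m \<Rightarrow> 'm)) set) cat" where
  "QGr A \<A> = localization (Gr A \<A>) (torsion_isos A \<A>)"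

text \<open>
  The argument \<open>\<iota>\<close>, injective on the carrier of \<open>A\<close>, places \<open>A\<close> in the universe \<open>'m\<close>.
  If \<open>A\<close> is nonzero and has a unit of degree 1, then \<open>'m\<close> is therefore infinite.
\<close>

definition proj ::
    "('a \<Rightarrow> 'm) \<Rightarrow> ('k, 'a) module \<Rightarrow> (int \<Rightarrow> 'a set) \<Rightarrow>
     (('a, 'm) gmod, (('a, 'm) gmod \<times> ('m \<Rightarrow> 'm) \<times> ('m \<Rightarrow> 'm)) set) cat_triple" where
  "proj \<iota> A \<A> =
     (QGr A \<A>,
      fobj (localization_functor (Gr A \<A>) (torsion_isos A \<A>))
        (transport_gmod \<iota> (regular_gmod A \<A>)),
      induced_functor (Gr A \<A>) (torsion_isos A \<A>) shift_functor)"

definition Mod_triple ::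
    "('a \<Rightarrow> 'm) \<Rightarrow> ('k, 'a) module \<Rightarrow> ('a \<Rightarrow> 'a) \<Rightarrow> (('a, 'm) rmod, 'm \<Rightarrow> 'm) cat_triple" where
  "Mod_triple \<iota> R \<gamma> = (Mod_cat R, transport_rmod \<iota> (regular_rmod R), pullback_functor \<gamma>)"

end

theory Submission
  imports Defs
begin

text \<open>
  A unit \<open>t\<close> of degree 1 has its inverse in degree \<open>- 1\<close>, so all powers of \<open>t\<close> are homogeneous units and
  \<open>A\<^sub>n = A\<^sub>0 t\<^sup>n\<close>.  Everything about \<open>A\<close> is therefore decided in degree zero together with the conjugation
  \<open>\<alpha>(a) = t a t\<^sup>-\<^sup>1\<close>.  Every element is uniquely a finite sum of terms \<open>a\<^sub>n t\<^sup>n\<close> with \<open>a\<^sub>n \<in> A\<^sub>0\<close>, and these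
  terms multiply as in \<open>A\<^sub>0[t, t\<^sup>-\<^sup>1; \<alpha>]\<close> (\<open>laurent_iso\<close>); the factorization \<open>x = (x t\<^sup>-\<^sup>m) t\<^sup>m\<close> shows that
  \<open>A\<close> is strongly graded.

  In \<open>N \<otimes> A\<^sub>1\<close> the relation \<open>x \<otimes> b = x (b t\<^sup>-\<^sup>1) \<otimes> t\<close> holds, so every tensor is \<open>x \<otimes> t\<close> for some \<open>x\<close>, and \<open>a \<in> A\<^sub>0\<close>
  takes it to \<open>x \<alpha>(a) \<otimes> t\<close>.  The element \<open>x\<close> is unique because \<open>x \<otimes> b \<mapsto> x (b t\<^sup>-\<^sup>1)\<close> respects the relations;
  in the presentation of the tensor product by a free abelian group, both together say that the subgroup
  of relations is the kernel of that map (\<open>T_iff\<close>).  This gives \<open>- \<otimes> A\<^sub>1 \<cong> \<alpha>\<^sup>*\<close> (\<open>tensor_functor_iso\<close>).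

  The ideal \<open>I\<^sub>A\<close> contains \<open>1 = 1 t t\<^sup>-\<^sup>1\<close>.  Hence only zero modules are annihilated by it, the torsion
  subcategory consists of zero modules (\<open>Tors_eq\<close>), and the Gabriel quotient inverts only isomorphisms.
  Such a localization is equivalent to the original category, compatibly with induced endofunctors
  (\<open>triple_equiv_localization\<close>), so that \<open>proj A\<close> amounts to the graded modules with the object \<open>A\<close> and the
  shift.  Passing to the component of degree zero compares this triple with the modules over \<open>A\<^sub>0\<close>
  (\<open>zero_part_equivalence\<close>).  It is fully faithful since \<open>M\<^sub>n = M\<^sub>0 t\<^sup>n\<close> forces and permits the extension
  \<open>x \<mapsto> f(x t\<^sup>-\<^sup>n) t\<^sup>n\<close> of a homomorphism \<open>f\<close> from degree zero.  It is essentially surjective since \<open>N\<close> is the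
  component of degree zero of the module of \<open>A\<^sub>0\<close>-linear maps \<open>A \<rightarrow> N\<close> that vanish on almost all \<open>A\<^sub>n\<close>.
  Such a map is determined by its values at the powers of \<open>t\<close>, so the module fits into the universe of \<open>N\<close>.
  The shift corresponds to \<open>\<alpha>\<^sup>*\<close> because \<open>x \<mapsto> x t\<close> identifies \<open>M\<^sub>0\<close> with \<open>M\<^sub>1\<close> and
  \<open>(x \<alpha>(a)) t = (x t) a\<close> (\<open>zero_part_shift\<close>).

  A Zhang twist has the same components and the same ring in degree zero, and \<open>t\<close> remains a unit of
  degree 1, but now \<open>t \<star> a = t \<sigma>(a) = \<alpha>(\<sigma>(a)) \<star> t\<close>.  The statements about the twist are thus the
  previous ones with \<open>\<alpha> \<circ> \<sigma>\<^sub>0\<close> in place of \<open>\<alpha>\<close> (\<open>unit_degree_one_twist\<close>).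
\<close>

section \<open>Equivalences of categories\<close>

locale cat_ctx =
  fixes C :: "('o, 'h) cat"
  assumes category: "category C"
begin

lemma idn_hom [simp, intro]: "X \<in> Obj C \<Longrightarrow> Idn C X \<in> Hom C X X"
  using category by (simp add: category_def)

lemma cmp_hom [simp, intro]:
  "\<lbrakk>X \<in> Obj C; Y \<in> Obj C; Z \<in> Obj C; f \<in> Hom C X Y; g \<in> Hom C Y Z\<rbrakk> \<Longrightarrow> Cmp C X Y Z g f \<in> Hom C X Z"
  using category unfolding category_def by blast

lemma idn_left [simp]:
  "\<lbrakk>X \<in> Obj C; Y \<in> Obj C; f \<in> Hom C X Y\<rbrakk> \<Longrightarrow> Cmp C X Y Y (Idn C Y) f = f"
  using category by (simp add: category_def)

lemma idn_right [simp]: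
  "\<lbrakk>X \<in> Obj C; Y \<in> Obj C; f \<in> Hom C X Y\<rbrakk> \<Longrightarrow> Cmp C X X Y f (Idn C X) = f"
  using category by (simp add: category_def)

lemma cmp_assoc:
  "\<lbrakk>W \<in> Obj C; X \<in> Obj C; Y \<in> Obj C; Z \<in> Obj C; f \<in> Hom C W X; g \<in> Hom C X Y; h \<in> Hom C Y Z\<rbrakk>
   \<Longrightarrow> Cmp C W X Z (Cmp C X Y Z h g) f = Cmp C W Y Z h (Cmp C W X Y g f)"
  using category unfolding category_def by blast

definition inverse_arrow :: "'o \<Rightarrow> 'o \<Rightarrow> 'h \<Rightarrow> 'h" where
  "inverse_arrow X Y f =
     (SOME g. g \<in> Hom C Y X \<and> Cmp C X Y X g f = Idn C X \<and> Cmp C Y X Y f g = Idn C Y)"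

lemma inverse_arrow:
  assumes "iso_arrow C X Y f"
  shows "inverse_arrow X Y f \<in> Hom C Y X"
    and "Cmp C X Y X (inverse_arrow X Y f) f = Idn C X"
    and "Cmp C Y X Y f (inverse_arrow X Y f) = Idn C Y"
    and "iso_arrow C Y X (inverse_arrow X Y f)"
proof -
  have "\<exists>g. g \<in> Hom C Y X \<and> Cmp C X Y X g f = Idn C X \<and> Cmp C Y X Y f g = Idn C Y"
    using assms unfolding iso_arrow_def by blast
  from someI_ex[OF this]
  show 1: "inverse_arrow X Y f \<in> Hom C Y X"
    and 2: "Cmp C X Y X (inverse_arrow X Y f) f = Idn C X"
    and 3: "Cmp C Y X Y f (inverse_arrow X Y f) = Idn C Y"
    unfolding inverse_arrow_def by blast+
  show "iso_arrow C Y X (inverse_arrow X Y f)"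
    using 1 2 3 assms unfolding iso_arrow_def by blast
qed

lemma iso_arrow_hom: "iso_arrow C X Y f \<Longrightarrow> f \<in> Hom C X Y"
  by (simp add: iso_arrow_def)

lemma iso_arrow_idn: "X \<in> Obj C \<Longrightarrow> iso_arrow C X X (Idn C X)"
  unfolding iso_arrow_def by (auto intro!: bexI[of _ "Idn C X"])

lemma inverse_arrow_cancel_left:
  assumes "X \<in> Obj C" "Y \<in> Obj C" "Z \<in> Obj C" "iso_arrow C X Y f" "g \<in> Hom C Z X"
  shows "Cmp C Z Y X (inverse_arrow X Y f) (Cmp C Z X Y f g) = g"
  using assms inverse_arrow[OF assms(4)] iso_arrow_hom[OF assms(4)]
  by (simp add: cmp_assoc[symmetric])

lemma inverse_arrow_cancel_right:
  assumes "X \<in> Obj C" "Y \<in> Obj C" "Z \<in> Obj C" "iso_arrow C X Y f" "g \<in> Hom C Z Y"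
  shows "Cmp C Z X Y f (Cmp C Z Y X (inverse_arrow X Y f) g) = g"
  using assms inverse_arrow[OF assms(4)] iso_arrow_hom[OF assms(4)]
  by (simp add: cmp_assoc[symmetric])

lemma iso_arrow_cmp:
  assumes "X \<in> Obj C" "Y \<in> Obj C" "Z \<in> Obj C" "iso_arrow C X Y f" "iso_arrow C Y Z g"
  shows "iso_arrow C X Z (Cmp C X Y Z g f)"
proof -
  let ?f = "inverse_arrow X Y f" and ?g = "inverse_arrow Y Z g"
  note f = inverse_arrow[OF assms(4)] iso_arrow_hom[OF assms(4)]
  note g = inverse_arrow[OF assms(5)] iso_arrow_hom[OF assms(5)]
  have "Cmp C X Z X (Cmp C Z Y X ?f ?g) (Cmp C X Y Z g f) = Idn C X"
    "Cmp C Z X Z (Cmp C X Y Z g f) (Cmp C Z Y X ?f ?g) = Idn C Z"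
    using assms f g inverse_arrow_cancel_left[OF assms(2,3,1,5) f(5)]
      inverse_arrow_cancel_right[OF assms(1,2,3,4) g(1)]
    by (simp_all add: cmp_assoc)
  then show ?thesis
    unfolding iso_arrow_def using assms f g by blast
qed

end

lemma functor_categories:
  assumes "is_functor C D F" shows "cat_ctx C" "cat_ctx D"
  using assms by (auto simp: is_functor_def cat_ctx_def)

lemma functor_obj: "is_functor C D F \<Longrightarrow> X \<in> Obj C \<Longrightarrow> fobj F X \<in> Obj D"
  by (simp add: is_functor_def)

lemma functor_hom:
  "\<lbrakk>is_functor C D F; X \<in> Obj C; Y \<in> Obj C; f \<in> Hom C X Y\<rbrakk> \<Longrightarrow>
     farr F X Y f \<in> Hom D (fobj F X) (fobj F Y)"
  by (simp add: is_functor_def)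

lemma functor_idn: "is_functor C D F \<Longrightarrow> X \<in> Obj C \<Longrightarrow> farr F X X (Idn C X) = Idn D (fobj F X)"
  by (simp add: is_functor_def)

lemma functor_cmp:
  "\<lbrakk>is_functor C D F; X \<in> Obj C; Y \<in> Obj C; Z \<in> Obj C; f \<in> Hom C X Y; g \<in> Hom C Y Z\<rbrakk> \<Longrightarrow>
     farr F X Z (Cmp C X Y Z g f) =
       Cmp D (fobj F X) (fobj F Y) (fobj F Z) (farr F Y Z g) (farr F X Y f)"
  unfolding is_functor_def by blast

lemma functor_iso_arrow:
  assumes "is_functor C D F" "X \<in> Obj C" "Y \<in> Obj C" "iso_arrow C X Y f"
  shows "iso_arrow D (fobj F X) (fobj F Y) (farr F X Y f)"
  using assms unfolding iso_arrow_def
  by (metis functor_cmp functor_hom functor_idn)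

lemma functor_id_functor: "category C \<Longrightarrow> is_functor C C id_functor"
  by (simp add: is_functor_def id_functor_def)

lemma functor_comp_functor:
  assumes "is_functor C D F" "is_functor D E G"
  shows "is_functor C E (G \<circ>F F)"
  using assms unfolding is_functor_def comp_functor_def by simp

definition fully_faithful_essentially_surjective ::
    "('o, 'h) cat \<Rightarrow> ('p, 'k) cat \<Rightarrow> ('o, 'h, 'p, 'k) cfunctor \<Rightarrow> bool" where
  "fully_faithful_essentially_surjective C D F \<longleftrightarrow> is_functor C D F \<and>
     (\<forall>X\<in>Obj C. \<forall>Y\<in>Obj C. bij_betw (farr F X Y) (Hom C X Y) (Hom D (fobj F X) (fobj F Y))) \<and>
     (\<forall>Y\<in>Obj D. \<exists>X\<in>Obj C. isomorphic_objs D (fobj F X) Y)"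

lemma ffes_functor: "fully_faithful_essentially_surjective C D F \<Longrightarrow> is_functor C D F"
  by (simp add: fully_faithful_essentially_surjective_def)

text \<open>
  The quasi-inverse sends \<open>Y\<close> to a chosen object \<open>h Y\<close> with an isomorphism \<open>e Y : G (h Y) \<rightarrow> Y\<close>, and
  \<open>g : Y \<rightarrow> Z\<close> to the unique arrow lying over \<open>(e Z)\<^sup>-\<^sup>1 \<circ> g \<circ> e Y\<close>.  The family \<open>e\<close> is then one of the
  two natural isomorphisms, and the arrows lying over \<open>e (G X)\<close> form the other.
\<close>

theorem cat_equivalence_if_fully_faithful_essentially_surjective:
  assumes "fully_faithful_essentially_surjective C D G"
  shows "cat_equivalence C D G"
proof -
  note G = ffes_functor[OF assms]
  interpret C: cat_ctx C by (rule functor_categories[OF G])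
  interpret D: cat_ctx D by (rule functor_categories[OF G])
  note obj = functor_obj[OF G] and hom = functor_hom[OF G] and idn = functor_idn[OF G]
    and cmp = functor_cmp[OF G]
  have bij: "bij_betw (farr G X Y) (Hom C X Y) (Hom D (fobj G X) (fobj G Y))"
    if "X \<in> Obj C" "Y \<in> Obj C" for X Y
    using assms that by (simp add: fully_faithful_essentially_surjective_def)
  have faithful: "f = g" if "X \<in> Obj C" "Y \<in> Obj C" "f \<in> Hom C X Y" "g \<in> Hom C X Y"
    "farr G X Y f = farr G X Y g" for X Y f g
    using bij[OF that(1,2)] that by (meson bij_betw_imp_inj_on inj_onD)
  have "\<forall>Y\<in>Obj D. \<exists>X. X \<in> Obj C \<and> (\<exists>e. iso_arrow D (fobj G X) Y e)"
    using assms unfolding fully_faithful_essentially_surjective_def isomorphic_objs_def by blast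
  then obtain h where h: "\<And>Y. Y \<in> Obj D \<Longrightarrow> h Y \<in> Obj C \<and> (\<exists>e. iso_arrow D (fobj G (h Y)) Y e)"
    by metis
  then obtain e where e: "\<And>Y. Y \<in> Obj D \<Longrightarrow> iso_arrow D (fobj G (h Y)) Y (e Y)"
    by metis
  have hO [simp]: "h Y \<in> Obj C" if "Y \<in> Obj D" for Y using h that by blast
  define i where "i Y = D.inverse_arrow (fobj G (h Y)) Y (e Y)" for Y
  have eH [simp]: "e Y \<in> Hom D (fobj G (h Y)) Y" if "Y \<in> Obj D" for Y
    using e[OF that] by (simp add: iso_arrow_def)
  have iH [simp]: "i Y \<in> Hom D Y (fobj G (h Y))"
    and ie: "Cmp D (fobj G (h Y)) Y (fobj G (h Y)) (i Y) (e Y) = Idn D (fobj G (h Y))"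
    and ei: "Cmp D Y (fobj G (h Y)) Y (e Y) (i Y) = Idn D Y"
    and ie': "\<And>Z f. Z \<in> Obj D \<Longrightarrow> f \<in> Hom D Z (fobj G (h Y)) \<Longrightarrow>
        Cmp D Z Y (fobj G (h Y)) (i Y) (Cmp D Z (fobj G (h Y)) Y (e Y) f) = f"
    and ei': "\<And>Z f. Z \<in> Obj D \<Longrightarrow> f \<in> Hom D Z Y \<Longrightarrow>
        Cmp D Z (fobj G (h Y)) Y (e Y) (Cmp D Z Y (fobj G (h Y)) (i Y) f) = f"
    if "Y \<in> Obj D" for Y
    using D.inverse_arrow[OF e[OF that]] D.inverse_arrow_cancel_left[OF _ _ _ e[OF that]]
      D.inverse_arrow_cancel_right[OF _ _ _ e[OF that]] that obj
    unfolding i_def by auto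
  have oh [simp]: "fobj G (h Y) \<in> Obj D" if "Y \<in> Obj D" for Y using that obj by simp
  define lift where "lift X Y = inv_into (Hom C X Y) (farr G X Y)" for X Y
  have lift: "lift X Y g \<in> Hom C X Y" "farr G X Y (lift X Y g) = g"
    if "X \<in> Obj C" "Y \<in> Obj C" "g \<in> Hom D (fobj G X) (fobj G Y)" for X Y g
    using bij[OF that(1,2)] that(3) unfolding lift_def
    by (metis bij_betw_def inv_into_into, metis bij_betw_def f_inv_into_f)
  define conj where "conj Y Z g = Cmp D (fobj G (h Y)) Z (fobj G (h Z)) (i Z)
      (Cmp D (fobj G (h Y)) Y Z g (e Y))" for Y Z g
  have conj: "conj Y Z g \<in> Hom D (fobj G (h Y)) (fobj G (h Z))"
    if "Y \<in> Obj D" "Z \<in> Obj D" "g \<in> Hom D Y Z" for Y Z g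
    using that unfolding conj_def by simp
  define H where "H = \<lparr>fobj = h, farr = (\<lambda>Y Z g. lift (h Y) (h Z) (conj Y Z g))\<rparr>"
  have Hl: "farr H Y Z g \<in> Hom C (h Y) (h Z)" "farr G (h Y) (h Z) (farr H Y Z g) = conj Y Z g"
    if "Y \<in> Obj D" "Z \<in> Obj D" "g \<in> Hom D Y Z" for Y Z g
    using that lift conj by (simp_all add: H_def)
  have fH: "fobj H = h" by (simp add: H_def)
  have H: "is_functor D C H"
    unfolding is_functor_def fH
  proof (intro conjI ballI)
    show "category D" "category C" by (rule D.category, rule C.category)
    show "h X \<in> Obj C" if "X \<in> Obj D" for X using that by simp
    show "farr H X Y f \<in> Hom C (h X) (h Y)" if "X \<in> Obj D" "Y \<in> Obj D" "f \<in> Hom D X Y" for X Y f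
      using Hl that by blast
    show "farr H X X (Idn D X) = Idn C (h X)" if "X \<in> Obj D" for X
      by (rule faithful[of "h X" "h X"]) (use that Hl[OF that that] ie in \<open>simp_all add: idn conj_def\<close>)
    show "farr H X Z (Cmp D X Y Z g f) = Cmp C (h X) (h Y) (h Z) (farr H Y Z g) (farr H X Y f)"
      if "X \<in> Obj D" "Y \<in> Obj D" "Z \<in> Obj D" "f \<in> Hom D X Y" "g \<in> Hom D Y Z" for X Y Z f g
      by (rule faithful[of "h X" "h Z"])
        (use that Hl ei' in \<open>simp_all add: cmp conj_def D.cmp_assoc\<close>)
  qed
  have "naturally_isomorphic D D (G \<circ>F H) id_functor"
    unfolding naturally_isomorphic_def
  proof (intro conjI exI[of _ e] ballI)
    show "is_functor D D (G \<circ>F H)" "is_functor D D id_functor"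
      using functor_comp_functor[OF H G] functor_id_functor[OF D.category] .
    show "iso_arrow D (fobj (G \<circ>F H) X) (fobj id_functor X) (e X)" if "X \<in> Obj D" for X
      using e[OF that] by (simp add: comp_functor_def id_functor_def fH)
    show "Cmp D (fobj (G \<circ>F H) X) (fobj (G \<circ>F H) Y) (fobj id_functor Y) (e Y) (farr (G \<circ>F H) X Y f) =
          Cmp D (fobj (G \<circ>F H) X) (fobj id_functor X) (fobj id_functor Y) (farr id_functor X Y f) (e X)"
      if "X \<in> Obj D" "Y \<in> Obj D" "f \<in> Hom D X Y" for X Y f
      using that Hl[OF that] ei'[of Y]
      by (simp add: comp_functor_def id_functor_def fH conj_def)
  qed
  moreover have "naturally_isomorphic C C (H \<circ>F G) id_functor"
    unfolding naturally_isomorphic_def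
  proof (intro conjI exI[of _ "\<lambda>X. lift (h (fobj G X)) X (e (fobj G X))"] ballI)
    show "is_functor C C (H \<circ>F G)" "is_functor C C id_functor"
      using functor_comp_functor[OF G H] functor_id_functor[OF C.category] .
    fix X assume X: "X \<in> Obj C"
    let ?Y = "fobj G X"
    let ?u = "lift (h ?Y) X (e ?Y)" and ?v = "lift X (h ?Y) (i ?Y)"
    have Y: "?Y \<in> Obj D" using X obj by simp
    have u: "?u \<in> Hom C (h ?Y) X" "farr G (h ?Y) X ?u = e ?Y" using lift X Y by simp_all
    have v: "?v \<in> Hom C X (h ?Y)" "farr G X (h ?Y) ?v = i ?Y" using lift X Y by simp_all
    have "Cmp C (h ?Y) X (h ?Y) ?v ?u = Idn C (h ?Y)"
      by (rule faithful[of "h ?Y" "h ?Y"]) (use X Y u v in \<open>simp_all add: cmp idn ie\<close>)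
    moreover have "Cmp C X (h ?Y) X ?u ?v = Idn C X"
      by (rule faithful[of X X]) (use X Y u v in \<open>simp_all add: cmp idn ei\<close>)
    ultimately show "iso_arrow C (fobj (H \<circ>F G) X) (fobj id_functor X) ?u"
      using u v by (auto simp: iso_arrow_def comp_functor_def id_functor_def fH)
  next
    fix X Y f assume XY: "X \<in> Obj C" "Y \<in> Obj C" and f: "f \<in> Hom C X Y"
    let ?X = "fobj G X" and ?Y = "fobj G Y"
    have O: "?X \<in> Obj D" "?Y \<in> Obj D" using XY obj by simp_all
    have F: "farr G X Y f \<in> Hom D ?X ?Y" using hom XY f by simp
    note l = lift[OF _ XY(1), of "h ?X" "e ?X"] lift[OF _ XY(2), of "h ?Y" "e ?Y"]
    have "Cmp C (h ?X) (h ?Y) Y (lift (h ?Y) Y (e ?Y)) (farr H ?X ?Y (farr G X Y f)) =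
          Cmp C (h ?X) X Y f (lift (h ?X) X (e ?X))"
      by (rule faithful[of "h ?X" Y])
        (use XY O F f l Hl[OF O F] ei'[of ?Y] in \<open>simp_all add: cmp conj_def\<close>)
    then show "Cmp C (fobj (H \<circ>F G) X) (fobj (H \<circ>F G) Y) (fobj id_functor Y)
          (lift (h ?Y) Y (e ?Y)) (farr (H \<circ>F G) X Y f) =
        Cmp C (fobj (H \<circ>F G) X) (fobj id_functor X) (fobj id_functor Y) (farr id_functor X Y f)
          (lift (h ?X) X (e ?X))"
      by (simp add: comp_functor_def id_functor_def fH)
  qed
  ultimately show ?thesis
    using G H unfolding cat_equivalence_def by blast
qed

lemma fully_faithful_essentially_surjective_comp:
  assumes F: "fully_faithful_essentially_surjective C D F"
    and G: "fully_faithful_essentially_surjective D E G"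
  shows "fully_faithful_essentially_surjective C E (G \<circ>F F)"
proof -
  note fF = ffes_functor[OF F] and fG = ffes_functor[OF G]
  interpret E: cat_ctx E by (rule functor_categories[OF fG])
  show ?thesis
    unfolding fully_faithful_essentially_surjective_def
  proof (intro conjI ballI)
    show "is_functor C E (G \<circ>F F)" by (rule functor_comp_functor[OF fF fG])
    fix X Y assume XY: "X \<in> Obj C" "Y \<in> Obj C"
    have "bij_betw (farr G (fobj F X) (fobj F Y) \<circ> farr F X Y) (Hom C X Y)
        (Hom E (fobj G (fobj F X)) (fobj G (fobj F Y)))"
      using F G XY functor_obj[OF fF]
      by (intro bij_betw_trans) (auto simp: fully_faithful_essentially_surjective_def)
    then show "bij_betw (farr (G \<circ>F F) X Y) (Hom C X Y) (Hom E (fobj (G \<circ>F F) X) (fobj (G \<circ>F F) Y))"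
      by (simp add: comp_functor_def comp_def)
  next
    fix Z assume Z: "Z \<in> Obj E"
    obtain Y g where Y: "Y \<in> Obj D" "iso_arrow E (fobj G Y) Z g"
      using G Z by (auto simp: fully_faithful_essentially_surjective_def isomorphic_objs_def)
    obtain X f where X: "X \<in> Obj C" "iso_arrow D (fobj F X) Y f"
      using F Y by (auto simp: fully_faithful_essentially_surjective_def isomorphic_objs_def)
    have "iso_arrow E (fobj G (fobj F X)) (fobj G Y) (farr G (fobj F X) Y f)"
      using functor_iso_arrow[OF fG _ _ X(2)] functor_obj[OF fF] X Y by simp
    from E.iso_arrow_cmp[OF _ _ _ this Y(2)]
    show "\<exists>X\<in>Obj C. isomorphic_objs E (fobj (G \<circ>F F) X) Z"
      using X Y Z functor_obj[OF fF] functor_obj[OF fG]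
      by (auto simp: comp_functor_def isomorphic_objs_def)
  qed
qed

text \<open>
  Functoriality of \<open>G\<close> is part of the conclusion: its action on arrows is that of \<open>F\<close> conjugated by \<open>\<theta>\<close>.
\<close>

lemma naturally_isomorphic_by_transport:
  assumes F: "is_functor C D F"
    and obj: "\<And>X. X \<in> Obj C \<Longrightarrow> fobj G X \<in> Obj D"
    and hom: "\<And>X Y f. \<lbrakk>X \<in> Obj C; Y \<in> Obj C; f \<in> Hom C X Y\<rbrakk> \<Longrightarrow> farr G X Y f \<in> Hom D (fobj G X) (fobj G Y)"
    and iso: "\<And>X. X \<in> Obj C \<Longrightarrow> iso_arrow D (fobj F X) (fobj G X) (\<theta> X)"
    and nat: "\<And>X Y f. \<lbrakk>X \<in> Obj C; Y \<in> Obj C; f \<in> Hom C X Y\<rbrakk> \<Longrightarrow>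
       Cmp D (fobj F X) (fobj G X) (fobj G Y) (farr G X Y f) (\<theta> X) =
       Cmp D (fobj F X) (fobj F Y) (fobj G Y) (\<theta> Y) (farr F X Y f)"
  shows "naturally_isomorphic C D G F"
proof -
  interpret C: cat_ctx C by (rule functor_categories[OF F])
  interpret D: cat_ctx D by (rule functor_categories[OF F])
  note Fo = functor_obj[OF F] and Fh = functor_hom[OF F]
  define \<eta> where "\<eta> X = D.inverse_arrow (fobj F X) (fobj G X) (\<theta> X)" for X
  have th: "\<theta> X \<in> Hom D (fobj F X) (fobj G X)" if "X \<in> Obj C" for X
    using iso[OF that] by (rule D.iso_arrow_hom)
  have eta: "\<eta> X \<in> Hom D (fobj G X) (fobj F X)" "iso_arrow D (fobj G X) (fobj F X) (\<eta> X)"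
    "Cmp D (fobj F X) (fobj G X) (fobj F X) (\<eta> X) (\<theta> X) = Idn D (fobj F X)"
    "Cmp D (fobj G X) (fobj F X) (fobj G X) (\<theta> X) (\<eta> X) = Idn D (fobj G X)"
    if "X \<in> Obj C" for X
    unfolding \<eta>_def using D.inverse_arrow[OF iso[OF that]] by blast+
  have farr: "farr G X Y f = Cmp D (fobj G X) (fobj F Y) (fobj G Y) (\<theta> Y)
      (Cmp D (fobj G X) (fobj F X) (fobj F Y) (farr F X Y f) (\<eta> X))"
    if "X \<in> Obj C" "Y \<in> Obj C" "f \<in> Hom C X Y" for X Y f
  proof -
    have "farr G X Y f = Cmp D (fobj G X) (fobj F X) (fobj G Y)
        (Cmp D (fobj F X) (fobj G X) (fobj G Y) (farr G X Y f) (\<theta> X)) (\<eta> X)"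
      using that obj Fo hom th eta by (simp add: D.cmp_assoc)
    then show ?thesis
      using that obj Fo Fh hom th eta by (simp add: nat D.cmp_assoc)
  qed
  have cancel: "Cmp D Z (fobj G X) (fobj F X) (\<eta> X) (Cmp D Z (fobj F X) (fobj G X) (\<theta> X) g) = g"
    if "X \<in> Obj C" "Z \<in> Obj D" "g \<in> Hom D Z (fobj F X)" for X Z g
    unfolding \<eta>_def using that obj Fo by (intro D.inverse_arrow_cancel_left iso) auto
  have G: "is_functor C D G"
    unfolding is_functor_def
  proof (intro conjI ballI)
    show "category C" "category D" by (rule C.category, rule D.category)
    show "fobj G X \<in> Obj D" if "X \<in> Obj C" for X using obj that .
    show "farr G X Y f \<in> Hom D (fobj G X) (fobj G Y)"
      if "X \<in> Obj C" "Y \<in> Obj C" "f \<in> Hom C X Y" for X Y f using hom that .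
    show "farr G X X (Idn C X) = Idn D (fobj G X)" if "X \<in> Obj C" for X
      using that obj Fo th eta by (simp add: farr functor_idn[OF F])
    show "farr G X Z (Cmp C X Y Z g f) =
          Cmp D (fobj G X) (fobj G Y) (fobj G Z) (farr G Y Z g) (farr G X Y f)"
      if "X \<in> Obj C" "Y \<in> Obj C" "Z \<in> Obj C" "f \<in> Hom C X Y" "g \<in> Hom C Y Z" for X Y Z f g
      using that obj Fo Fh th eta by (simp add: farr functor_cmp[OF F] D.cmp_assoc cancel)
  qed
  show ?thesis
    unfolding naturally_isomorphic_def
  proof (intro conjI F G exI[of _ \<eta>] ballI)
    show "iso_arrow D (fobj G X) (fobj F X) (\<eta> X)" if "X \<in> Obj C" for X
      using eta that by blast
    show "Cmp D (fobj G X) (fobj G Y) (fobj F Y) (\<eta> Y) (farr G X Y f) =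
          Cmp D (fobj G X) (fobj F X) (fobj F Y) (farr F X Y f) (\<eta> X)"
      if "X \<in> Obj C" "Y \<in> Obj C" "f \<in> Hom C X Y" for X Y f
      using that obj Fo Fh eta by (simp add: farr cancel)
  qed
qed

section \<open>Localization at the isomorphisms\<close>

text \<open>
  If the inverted morphisms are exactly the isomorphisms, the roof \<open>(X, s, f)\<close> stands for a morphism
  that already exists, namely \<open>f \<circ> s\<^sup>-\<^sup>1\<close>.  The localization is therefore the original category with
  each morphism replaced by the set of all roofs that stand for it.
\<close>

locale iso_localization = cat_ctx C for C :: "('o, 'h) cat" +
  fixes W :: "'o \<Rightarrow> 'o \<Rightarrow> 'h set"
  assumes W_iff: "\<lbrakk>X \<in> Obj C; Y \<in> Obj C\<rbrakk> \<Longrightarrow> f \<in> W X Y \<longleftrightarrow> iso_arrow C X Y f"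
begin

definition roof_value :: "'o \<Rightarrow> 'o \<Rightarrow> 'o \<times> 'h \<times> 'h \<Rightarrow> 'h" where
  "roof_value M N = (\<lambda>(X, s, f). Cmp C M X N f (inverse_arrow X M s))"

definition loc_arrow :: "'o \<Rightarrow> 'o \<Rightarrow> 'h \<Rightarrow> ('o \<times> 'h \<times> 'h) set" where
  "loc_arrow M N h = {r \<in> roofs C W M N. roof_value M N r = h}"

lemma in_roofs:
  assumes "M \<in> Obj C"
  shows "(X, s, f) \<in> roofs C W M N \<longleftrightarrow> X \<in> Obj C \<and> iso_arrow C X M s \<and> f \<in> Hom C X N"
  using assms by (auto simp: roofs_def W_iff)

lemma roof_value_hom:
  assumes "M \<in> Obj C" "N \<in> Obj C" "r \<in> roofs C W M N"
  shows "roof_value M N r \<in> Hom C M N"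
proof -
  obtain X s f where r: "r = (X, s, f)" by (cases r)
  show ?thesis
    using assms inverse_arrow(1)[of X M s] unfolding r roof_value_def by (auto simp: in_roofs)
qed

lemma roof_value_cancel:
  assumes "M \<in> Obj C" "N \<in> Obj C" "(X, s, f) \<in> roofs C W M N"
  shows "Cmp C X M N (roof_value M N (X, s, f)) s = f"
  using assms inverse_arrow[of X M s] iso_arrow_hom[of X M s]
  by (simp add: roof_value_def in_roofs cmp_assoc)

lemma roof_value_eqI:
  assumes "M \<in> Obj C" "N \<in> Obj C" "(X, s, f) \<in> roofs C W M N" "h \<in> Hom C M N" "Cmp C X M N h s = f"
  shows "roof_value M N (X, s, f) = h"
  using assms inverse_arrow[of X M s] iso_arrow_hom[of X M s]
  by (auto simp: roof_value_def in_roofs cmp_assoc)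

text \<open>
  If \<open>Z\<close> refines two equivalent roofs, then \<open>Z\<close> maps to \<open>M\<close> by an isomorphism, which can be
  cancelled.  Conversely, two roofs with the same value are both refined by \<open>M\<close> itself.
\<close>

lemma roof_class_eq:
  assumes M: "M \<in> Obj C" and N: "N \<in> Obj C" and r: "r \<in> roofs C W M N"
  shows "roof_class C W M N r = loc_arrow M N (roof_value M N r)"
proof -
  obtain X s f where r': "r = (X, s, f)" by (cases r)
  have X: "X \<in> Obj C" "iso_arrow C X M s" "f \<in> Hom C X N"
    using r M by (auto simp: r' in_roofs)
  have "(\<exists>Z\<in>Obj C. \<exists>u\<in>Hom C Z X. \<exists>v\<in>Hom C Z Y.
       Cmp C Z X M s u = Cmp C Z Y M t v \<and> Cmp C Z X M s u \<in> W Z M \<and>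
       Cmp C Z X N f u = Cmp C Z Y N g v) \<longleftrightarrow> roof_value M N (Y, t, g) = roof_value M N (X, s, f)"
    (is "?L \<longleftrightarrow> ?R") if q: "(Y, t, g) \<in> roofs C W M N" for Y t g
  proof -
    have Y: "Y \<in> Obj C" "iso_arrow C Y M t" "g \<in> Hom C Y N"
      using q M by (auto simp: in_roofs)
    note inv = inverse_arrow[OF X(2)] iso_arrow_hom[OF X(2)] inverse_arrow[OF Y(2)] iso_arrow_hom[OF Y(2)]
    let ?x = "roof_value M N (X, s, f)" and ?y = "roof_value M N (Y, t, g)"
    have xy: "?x \<in> Hom C M N" "?y \<in> Hom C M N"
      using roof_value_hom M N q r r' by blast+
    have fx: "f = Cmp C X M N ?x s" and gy: "g = Cmp C Y M N ?y t"
      using roof_value_cancel M N q r r' by metis+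
    show ?thesis
    proof
      assume ?L
      then obtain Z u v where Z: "Z \<in> Obj C" "u \<in> Hom C Z X" "v \<in> Hom C Z Y"
        and eq: "Cmp C Z X M s u = Cmp C Z Y M t v" and w: "iso_arrow C Z M (Cmp C Z X M s u)"
        and fg: "Cmp C Z X N f u = Cmp C Z Y N g v"
        using W_iff M by blast
      let ?w = "Cmp C Z X M s u"
      note w' = inverse_arrow[OF w] iso_arrow_hom[OF w]
      have "Cmp C Z M N ?x ?w = Cmp C Z X N f u"
        using X M N Z xy inv by (subst fx) (simp add: cmp_assoc)
      also have "\<dots> = Cmp C Z M N ?y ?w"
        unfolding eq fg using Y M N Z xy inv by (subst gy) (simp add: cmp_assoc)
      finally have "Cmp C M Z N (Cmp C Z M N ?x ?w) (inverse_arrow Z M ?w) =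
          Cmp C M Z N (Cmp C Z M N ?y ?w) (inverse_arrow Z M ?w)" by simp
      then show ?R
        using M N Z xy w' by (simp add: cmp_assoc del: cmp_hom) (simp add: cmp_assoc)?
    next
      assume ?R
      show ?L
      proof (intro bexI conjI)
        show "M \<in> Obj C" "inverse_arrow X M s \<in> Hom C M X" "inverse_arrow Y M t \<in> Hom C M Y"
          using M inv by blast+
        show "Cmp C M X M s (inverse_arrow X M s) = Cmp C M Y M t (inverse_arrow Y M t)"
          using inv by simp
        show "Cmp C M X M s (inverse_arrow X M s) \<in> W M M"
          using inv M by (simp add: W_iff iso_arrow_idn)
        show "Cmp C M X N f (inverse_arrow X M s) = Cmp C M Y N g (inverse_arrow Y M t)"
          using \<open>?R\<close> by (simp add: roof_value_def)
      qed
    qed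
  qed
  note eq = this
  show ?thesis
  proof (rule Set.set_eqI)
    fix q :: "'o \<times> 'h \<times> 'h"
    obtain Y t g where q: "q = (Y, t, g)" by (cases q)
    show "q \<in> roof_class C W M N r \<longleftrightarrow> q \<in> loc_arrow M N (roof_value M N r)"
      using eq[of Y t g] unfolding roof_class_def loc_arrow_def r' q mem_Collect_eq prod.case by blast
  qed
qed

lemma identity_roof:
  assumes "M \<in> Obj C" "N \<in> Obj C" "h \<in> Hom C M N"
  shows "(M, Idn C M, h) \<in> loc_arrow M N h"
proof -
  have "(M, Idn C M, h) \<in> roofs C W M N"
    using assms by (simp add: in_roofs iso_arrow_idn)
  then show ?thesis
    using assms by (simp add: loc_arrow_def roof_value_eqI)
qed

lemma roof_class_identity:
  assumes "M \<in> Obj C" "N \<in> Obj C" "h \<in> Hom C M N"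
  shows "roof_class C W M N (M, Idn C M, h) = loc_arrow M N h"
  using identity_roof[OF assms] roof_class_eq[OF assms(1,2)] by (simp add: loc_arrow_def)

lemma Obj_localization [simp]: "Obj (localization C W) = Obj C"
  by (simp add: localization_def)

lemma Hom_localization:
  assumes "M \<in> Obj C" "N \<in> Obj C"
  shows "Hom (localization C W) M N = loc_arrow M N ` Hom C M N"
proof -
  have "roof_class C W M N ` roofs C W M N = loc_arrow M N ` Hom C M N"
  proof (intro equalityI image_subsetI)
    show "roof_class C W M N r \<in> loc_arrow M N ` Hom C M N" if "r \<in> roofs C W M N" for r
      using assms that roof_class_eq roof_value_hom by auto
    show "loc_arrow M N h \<in> roof_class C W M N ` roofs C W M N" if "h \<in> Hom C M N" for h
      using roof_class_identity[OF assms that] identity_roof[OF assms that]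
      by (metis (no_types, lifting) image_eqI loc_arrow_def mem_Collect_eq)
  qed
  then show ?thesis by (simp add: localization_def)
qed

lemma loc_arrow_inj:
  assumes "M \<in> Obj C" "N \<in> Obj C"
  shows "inj_on (loc_arrow M N) (Hom C M N)"
proof (rule inj_onI)
  fix h k assume "h \<in> Hom C M N" "k \<in> Hom C M N" "loc_arrow M N h = loc_arrow M N k"
  then have "(M, Idn C M, h) \<in> loc_arrow M N h" "(M, Idn C M, h) \<in> loc_arrow M N k"
    using identity_roof assms by metis+
  then show "h = k" by (simp add: loc_arrow_def)
qed

lemma Idn_localization:
  "M \<in> Obj C \<Longrightarrow> Idn (localization C W) M = loc_arrow M M (Idn C M)"
  by (simp add: localization_def roof_class_identity)

text \<open>
  Every square completing two roofs yields a roof with the same value, so the union that defines the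
  composite is taken over copies of a single class; the roofs over identities show that the union is
  not empty.
\<close>

lemma Cmp_localization:
  assumes O: "L \<in> Obj C" "M \<in> Obj C" "N \<in> Obj C" and h: "h \<in> Hom C L M" and k: "k \<in> Hom C M N"
  shows "Cmp (localization C W) L M N (loc_arrow M N k) (loc_arrow L M h) =
         loc_arrow L N (Cmp C L M N k h)"
proof -
  let ?S = "{roof_class C W L N (Z, Cmp C Z X L s u, Cmp C Z Y N g v) | X s f Y t g Z u v.
            (X, s, f) \<in> loc_arrow L M h \<and> (Y, t, g) \<in> loc_arrow M N k \<and> Z \<in> Obj C \<and>
            u \<in> W Z X \<and> v \<in> Hom C Z Y \<and> Cmp C Z X M f u = Cmp C Z Y M t v}"
  have 1: "roof_class C W L N (Z, Cmp C Z X L s u, Cmp C Z Y N g v) = loc_arrow L N (Cmp C L M N k h)"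
    if a: "(X, s, f) \<in> loc_arrow L M h" "(Y, t, g) \<in> loc_arrow M N k" "Z \<in> Obj C"
      "u \<in> W Z X" "v \<in> Hom C Z Y" "Cmp C Z X M f u = Cmp C Z Y M t v" for X s f Y t g Z u v
  proof -
    have X: "(X, s, f) \<in> roofs C W L M" "X \<in> Obj C" "iso_arrow C X L s" "f \<in> Hom C X M"
      and f: "f = Cmp C X L M h s"
      using a(1) O roof_value_cancel[of L M X s f] by (auto simp: loc_arrow_def in_roofs)
    have Y: "(Y, t, g) \<in> roofs C W M N" "Y \<in> Obj C" "iso_arrow C Y M t" "g \<in> Hom C Y N"
      and g: "g = Cmp C Y M N k t"
      using a(2) O roof_value_cancel[of M N Y t g] by (auto simp: loc_arrow_def in_roofs)
    have u: "iso_arrow C Z X u" using a X W_iff by blast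
    note H = iso_arrow_hom[OF X(3)] iso_arrow_hom[OF Y(3)] iso_arrow_hom[OF u]
    have r: "(Z, Cmp C Z X L s u, Cmp C Z Y N g v) \<in> roofs C W L N"
      using O X Y a iso_arrow_cmp[OF _ _ _ u X(3)] by (simp add: in_roofs)
    have "Cmp C Z L N (Cmp C L M N k h) (Cmp C Z X L s u) = Cmp C Z M N k (Cmp C Z X M f u)"
      unfolding f using O X Y a H h k by (simp add: cmp_assoc)
    also have "\<dots> = Cmp C Z Y N g v"
      unfolding a(6) g using O X Y a H h k by (simp add: cmp_assoc)
    finally have "roof_value L N (Z, Cmp C Z X L s u, Cmp C Z Y N g v) = Cmp C L M N k h"
      using roof_value_eqI[OF _ _ r] O h k by simp
    then show ?thesis using roof_class_eq[OF _ _ r] O by simp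
  qed
  have 2: "roof_class C W L N (L, Cmp C L L L (Idn C L) (Idn C L), Cmp C L M N k h) \<in> ?S"
    unfolding mem_Collect_eq
    by (rule exI[of _ L], rule exI[of _ "Idn C L"], rule exI[of _ h], rule exI[of _ M],
        rule exI[of _ "Idn C M"], rule exI[of _ k], rule exI[of _ L], rule exI[of _ "Idn C L"],
        rule exI[of _ h])
      (use identity_roof[OF O(1,2) h] identity_roof[OF O(2,3) k] O h k in
        \<open>simp add: W_iff iso_arrow_idn\<close>)
  have "?S = {loc_arrow L N (Cmp C L M N k h)}"
  proof (rule equalityI)
    show "?S \<subseteq> {loc_arrow L N (Cmp C L M N k h)}" using 1 by blast
    show "{loc_arrow L N (Cmp C L M N k h)} \<subseteq> ?S" using 1 2 by blast
  qed
  then show ?thesis by (simp add: localization_def)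
qed

lemma category_localization: "category (localization C W)"
  unfolding category_def
  by (auto simp: Hom_localization Idn_localization Cmp_localization cmp_assoc)

sublocale loc: cat_ctx "localization C W"
  by (simp add: cat_ctx_def category_localization)

lemma loc_arrow_iso:
  assumes "M \<in> Obj C" "N \<in> Obj C" "iso_arrow C M N f"
  shows "iso_arrow (localization C W) M N (loc_arrow M N f)"
proof -
  obtain g where g: "f \<in> Hom C M N" "g \<in> Hom C N M" "Cmp C M N M g f = Idn C M" "Cmp C N M N f g = Idn C N"
    using assms(3) unfolding iso_arrow_def by blast
  then show ?thesis
    using assms(1,2) unfolding iso_arrow_def
    by (auto simp: Hom_localization Idn_localization Cmp_localization intro!: bexI[of _ g])
qed

text \<open>
  The localization functor is bijective on objects and on morphisms; this is its inverse.
\<close>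

definition delocalize :: "('o, ('o \<times> 'h \<times> 'h) set, 'o, 'h) cfunctor" where
  "delocalize = \<lparr>fobj = (\<lambda>M. M), farr = (\<lambda>M N. inv_into (Hom C M N) (loc_arrow M N))\<rparr>"

lemma fobj_delocalize [simp]: "fobj delocalize M = M"
  by (simp add: delocalize_def)

lemma farr_delocalize:
  "\<lbrakk>M \<in> Obj C; N \<in> Obj C; h \<in> Hom C M N\<rbrakk> \<Longrightarrow> farr delocalize M N (loc_arrow M N h) = h"
  by (simp add: delocalize_def inv_into_f_f loc_arrow_inj)

lemma delocalize: "fully_faithful_essentially_surjective (localization C W) C delocalize"
  unfolding fully_faithful_essentially_surjective_def is_functor_def
proof (intro conjI ballI)
  show "category (localization C W)" "category C" by (rule category_localization, rule category)
  fix X assume X: "X \<in> Obj (localization C W)"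
  then show "fobj delocalize X \<in> Obj C" by simp
  show "farr delocalize X X (Idn (localization C W) X) = Idn C (fobj delocalize X)"
    using X by (simp add: Idn_localization farr_delocalize)
  fix Y assume Y: "Y \<in> Obj (localization C W)"
  show "bij_betw (farr delocalize X Y) (Hom (localization C W) X Y) (Hom C (fobj delocalize X) (fobj delocalize Y))"
    using X Y loc_arrow_inj[of X Y] by (simp add: delocalize_def Hom_localization inj_on_imp_bij_betw bij_betw_inv_into)
  fix f assume f: "f \<in> Hom (localization C W) X Y"
  then show "farr delocalize X Y f \<in> Hom C (fobj delocalize X) (fobj delocalize Y)"
    using X Y by (auto simp: Hom_localization farr_delocalize)
  fix Z g assume Z: "Z \<in> Obj (localization C W)" "g \<in> Hom (localization C W) Y Z"
  show "farr delocalize X Z (Cmp (localization C W) X Y Z g f) =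
       Cmp C (fobj delocalize X) (fobj delocalize Y) (fobj delocalize Z)
        (farr delocalize Y Z g) (farr delocalize X Y f)"
    using X Y Z f by (auto simp: Hom_localization farr_delocalize Cmp_localization)
next
  fix Y assume "Y \<in> Obj C"
  then show "\<exists>X\<in>Obj (localization C W). isomorphic_objs C (fobj delocalize X) Y"
    using iso_arrow_idn[of Y] by (auto simp: isomorphic_objs_def)
qed

text \<open>
  A roof \<open>(X, s, f)\<close> with value \<open>h\<close> satisfies \<open>f = h \<circ> s\<close>, and applying \<open>S\<close> preserves this equation.
\<close>

lemma farr_induced_functor:
  assumes S: "is_functor C C S" and O: "M \<in> Obj C" "N \<in> Obj C" and h: "h \<in> Hom C M N"
  shows "farr (induced_functor C W S) M N (loc_arrow M N h) =
         loc_arrow (fobj S M) (fobj S N) (farr S M N h)"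
proof -
  have "roof_class C W (fobj S M) (fobj S N) (fobj S X, farr S X M s, farr S X N f) =
      loc_arrow (fobj S M) (fobj S N) (farr S M N h)" if a: "(X, s, f) \<in> loc_arrow M N h" for X s f
  proof -
    have X: "X \<in> Obj C" "iso_arrow C X M s" "f \<in> Hom C X N" "f = Cmp C X M N h s"
      using a O roof_value_cancel[of M N X s f] by (auto simp: loc_arrow_def in_roofs)
    have r: "(fobj S X, farr S X M s, farr S X N f) \<in> roofs C W (fobj S M) (fobj S N)"
      using X O by (simp add: in_roofs functor_obj[OF S] functor_hom[OF S] functor_iso_arrow[OF S])
    have "farr S X N f = Cmp C (fobj S X) (fobj S M) (fobj S N) (farr S M N h) (farr S X M s)"
      unfolding X(4) using X(1,2) O h iso_arrow_hom by (simp add: functor_cmp[OF S])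
    then have "roof_value (fobj S M) (fobj S N) (fobj S X, farr S X M s, farr S X N f) = farr S M N h"
      using r O h by (intro roof_value_eqI) (simp_all add: functor_obj[OF S] functor_hom[OF S])
    then show ?thesis
      using roof_class_eq[OF _ _ r] O by (simp add: functor_obj[OF S])
  qed
  moreover have "loc_arrow M N h \<noteq> {}" using identity_roof[OF O h] by blast
  ultimately show ?thesis
    by (auto simp: induced_functor_def)
qed

lemma fobj_induced_functor [simp]: "fobj (induced_functor C W S) M = fobj S M"
  by (simp add: induced_functor_def)

lemma induced_functor:
  assumes "fully_faithful_essentially_surjective C C S"
  shows "fully_faithful_essentially_surjective (localization C W) (localization C W) (induced_functor C W S)"
proof -
  note S = ffes_functor[OF assms]
  note farr = farr_induced_functor[OF S]
  show ?thesis
    unfolding fully_faithful_essentially_surjective_def is_functor_def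
  proof (intro conjI ballI; (rule category_localization)?; unfold Obj_localization fobj_induced_functor)
    fix X assume X: "X \<in> Obj C"
    then show SX: "fobj S X \<in> Obj C" by (rule functor_obj[OF S])
    show "farr (induced_functor C W S) X X (Idn (localization C W) X) = Idn (localization C W) (fobj S X)"
      using X SX by (simp add: Idn_localization farr functor_idn[OF S])
    fix Y assume Y: "Y \<in> Obj C"
    then have SY: "fobj S Y \<in> Obj C" by (rule functor_obj[OF S])
    have b: "bij_betw (farr S X Y) (Hom C X Y) (Hom C (fobj S X) (fobj S Y))"
      using assms X Y by (simp add: fully_faithful_essentially_surjective_def)
    have "bij_betw (\<lambda>h. loc_arrow (fobj S X) (fobj S Y) (farr S X Y h)) (Hom C X Y)
        (Hom (localization C W) (fobj S X) (fobj S Y))"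
      using bij_betw_trans[OF b inj_on_imp_bij_betw[OF loc_arrow_inj[OF SX SY]]]
      by (simp add: comp_def Hom_localization SX SY)
    then have "bij_betw (farr (induced_functor C W S) X Y \<circ> loc_arrow X Y) (Hom C X Y)
        (Hom (localization C W) (fobj S X) (fobj S Y))"
      by (rule bij_betw_cong[THEN iffD1, rotated]) (simp add: farr X Y)
    then show "bij_betw (farr (induced_functor C W S) X Y) (Hom (localization C W) X Y)
        (Hom (localization C W) (fobj S X) (fobj S Y))"
      using inj_on_imp_bij_betw[OF loc_arrow_inj[OF X Y]] bij_betw_comp_iff
      by (fastforce simp: Hom_localization X Y)
    fix f assume f: "f \<in> Hom (localization C W) X Y"
    then show "farr (induced_functor C W S) X Y f \<in> Hom (localization C W) (fobj S X) (fobj S Y)"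
      using X Y SX SY by (auto simp: Hom_localization farr functor_hom[OF S])
    fix Z g assume Z: "Z \<in> Obj C" and g: "g \<in> Hom (localization C W) Y Z"
    then show "farr (induced_functor C W S) X Z (Cmp (localization C W) X Y Z g f) =
       Cmp (localization C W) (fobj S X) (fobj S Y) (fobj S Z)
        (farr (induced_functor C W S) Y Z g) (farr (induced_functor C W S) X Y f)"
      using X Y f SX SY functor_obj[OF S Z]
      by (auto simp: Hom_localization farr Cmp_localization functor_hom[OF S] functor_cmp[OF S])
  next
    fix Y assume Y: "Y \<in> Obj C"
    then obtain X f where X: "X \<in> Obj C" "iso_arrow C (fobj S X) Y f"
      using assms unfolding fully_faithful_essentially_surjective_def isomorphic_objs_def by blast
    then show "\<exists>X\<in>Obj C. isomorphic_objs (localization C W) (fobj S X) Y"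
      using loc_arrow_iso[OF _ Y X(2)] functor_obj[OF S] unfolding isomorphic_objs_def by blast
  qed
qed

text \<open>
  Inverting only isomorphisms does not affect a triple, so an equivalence of \<open>C\<close> with \<open>D\<close> that is
  compatible with the distinguished objects and endofunctors also compares the localized triple.
\<close>

theorem triple_equiv_localization:
  assumes S: "fully_faithful_essentially_surjective C C S"
    and F: "fully_faithful_essentially_surjective C D F"
    and S': "fully_faithful_essentially_surjective D D S'"
    and P: "P \<in> Obj C" and P': "P' \<in> Obj D" and iso: "isomorphic_objs D (fobj F P) P'"
    and nat: "naturally_isomorphic C D (F \<circ>F S) (S' \<circ>F F)"
  shows "(localization C W, P, induced_functor C W S) \<simeq>\<^sub>t (D, P', S')"
proof -
  note fF = ffes_functor[OF F] and fS = ffes_functor[OF S] and fS' = ffes_functor[OF S']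
  let ?L = "localization C W" and ?G = "F \<circ>F delocalize" and ?S = "induced_functor C W S"
  have G: "fully_faithful_essentially_surjective ?L D ?G"
    by (rule fully_faithful_essentially_surjective_comp[OF delocalize F])
  note fG = ffes_functor[OF G] and fL = ffes_functor[OF induced_functor[OF S]]
  have D: "category D" using functor_categories(2)[OF fF] by (simp add: cat_ctx_def)
  from nat obtain \<eta> where
    eta: "\<And>X. X \<in> Obj C \<Longrightarrow> iso_arrow D (fobj F (fobj S X)) (fobj S' (fobj F X)) (\<eta> X)"
    and eta_nat: "\<And>X Y f. X \<in> Obj C \<Longrightarrow> Y \<in> Obj C \<Longrightarrow> f \<in> Hom C X Y \<Longrightarrow>
      Cmp D (fobj F (fobj S X)) (fobj F (fobj S Y)) (fobj S' (fobj F Y)) (\<eta> Y)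
        (farr F (fobj S X) (fobj S Y) (farr S X Y f)) =
      Cmp D (fobj F (fobj S X)) (fobj S' (fobj F X)) (fobj S' (fobj F Y))
        (farr S' (fobj F X) (fobj F Y) (farr F X Y f)) (\<eta> X)"
    unfolding naturally_isomorphic_def comp_functor_def by (simp, blast)
  have "naturally_isomorphic ?L D (?G \<circ>F ?S) (S' \<circ>F ?G)"
    unfolding naturally_isomorphic_def
  proof (intro conjI exI[of _ \<eta>] ballI)
    show "is_functor ?L D (?G \<circ>F ?S)" "is_functor ?L D (S' \<circ>F ?G)"
      using functor_comp_functor fL fG fS' by blast+
    fix X assume X: "X \<in> Obj ?L"
    then show "iso_arrow D (fobj (?G \<circ>F ?S) X) (fobj (S' \<circ>F ?G) X) (\<eta> X)"
      using eta by (simp add: comp_functor_def)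
    fix Y f assume Y: "Y \<in> Obj ?L" and f: "f \<in> Hom ?L X Y"
    obtain h where h: "h \<in> Hom C X Y" "f = loc_arrow X Y h"
      using X Y f by (auto simp: Hom_localization)
    show "Cmp D (fobj (?G \<circ>F ?S) X) (fobj (?G \<circ>F ?S) Y) (fobj (S' \<circ>F ?G) Y) (\<eta> Y) (farr (?G \<circ>F ?S) X Y f) =
          Cmp D (fobj (?G \<circ>F ?S) X) (fobj (S' \<circ>F ?G) X) (fobj (S' \<circ>F ?G) Y) (farr (S' \<circ>F ?G) X Y f) (\<eta> X)"
      using X Y eta_nat[of X Y h] h
      by (simp add: comp_functor_def farr_delocalize farr_induced_functor[OF fS]
          functor_obj[OF fS] functor_hom[OF fS])
  qed
  moreover have "isomorphic_objs D (fobj ?G P) P'"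
    using iso by (simp add: comp_functor_def)
  moreover have "cat_equivalence ?L D ?G" "cat_equivalence ?L ?L ?S" "cat_equivalence D D S'"
    using G induced_functor[OF S] S' cat_equivalence_if_fully_faithful_essentially_surjective by blast+
  ultimately show ?thesis
    using P P' category_localization D
    by (auto simp: triple_equiv_def is_triple_def)
qed

end

section \<open>Internal direct sums\<close>

text \<open>
  The set \<open>S\<close> may be smaller than the carrier of \<open>G\<close>, so that maps given only on one component of a
  direct sum are covered.
\<close>

definition additive_on :: "'x set \<Rightarrow> ('x, 'z) ring_scheme \<Rightarrow> ('y, 'w) ring_scheme \<Rightarrow> ('x \<Rightarrow> 'y) \<Rightarrow> bool" where
  "additive_on S G H f \<longleftrightarrow> f ` S \<subseteq> carrier H \<and>
     (\<forall>x\<in>S. \<forall>y\<in>S. f (x \<oplus>\<^bsub>G\<^esub> y) = f x \<oplus>\<^bsub>H\<^esub> f y)"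

lemma additive_onI:
  assumes "\<And>x. x \<in> S \<Longrightarrow> f x \<in> carrier H"
    and "\<And>x y. x \<in> S \<Longrightarrow> y \<in> S \<Longrightarrow> f (x \<oplus>\<^bsub>G\<^esub> y) = f x \<oplus>\<^bsub>H\<^esub> f y"
  shows "additive_on S G H f"
  using assms by (auto simp: additive_on_def)

lemma additive_on_closed: "additive_on S G H f \<Longrightarrow> x \<in> S \<Longrightarrow> f x \<in> carrier H"
  by (auto simp: additive_on_def)

lemma additive_on_add:
  "additive_on S G H f \<Longrightarrow> x \<in> S \<Longrightarrow> y \<in> S \<Longrightarrow> f (x \<oplus>\<^bsub>G\<^esub> y) = f x \<oplus>\<^bsub>H\<^esub> f y"
  by (auto simp: additive_on_def)

lemma additive_on_zero:
  assumes "abelian_group G" "abelian_group H" "additive_on S G H f" "\<zero>\<^bsub>G\<^esub> \<in> S"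
  shows "f \<zero>\<^bsub>G\<^esub> = \<zero>\<^bsub>H\<^esub>"
proof -
  interpret G: abelian_group G by fact
  interpret H: abelian_group H by fact
  have "f \<zero>\<^bsub>G\<^esub> \<oplus>\<^bsub>H\<^esub> f \<zero>\<^bsub>G\<^esub> = f \<zero>\<^bsub>G\<^esub>"
    using additive_on_add[OF assms(3,4,4)] by simp
  then show ?thesis
    using additive_on_closed[OF assms(3,4)] by (metis H.add.r_cancel_one')
qed

lemma additive_on_finsum:
  assumes "abelian_group G" "abelian_group H" "additive_on (carrier G) G H f" "finite I"
    "c \<in> I \<rightarrow> carrier G"
  shows "f (finsum G c I) = finsum H (\<lambda>i. f (c i)) I"
proof -
  interpret G: abelian_group G by fact
  interpret H: abelian_group H by fact
  show ?thesis
    using assms(4,5)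
  proof (induction I rule: finite_induct)
    case empty
    then show ?case using additive_on_zero[OF assms(1-3)] by simp
  next
    case (insert i I)
    moreover from insert have "(\<lambda>i. f (c i)) \<in> I \<rightarrow> carrier H"
      using additive_on_closed[OF assms(3)] by auto
    ultimately show ?case
      using additive_on_closed[OF assms(3)] additive_on_add[OF assms(3)] by (simp add: Pi_def)
  qed
qed

lemma (in abelian_monoid) finsum_support:
  assumes "finite S" "{i \<in> I. c i \<noteq> \<zero>} \<subseteq> S" "S \<subseteq> I" "c \<in> I \<rightarrow> carrier G"
  shows "finsum G c {i \<in> I. c i \<noteq> \<zero>} = finsum G c S"
  using assms by (intro add.finprod_mono_neutral_cong_left) auto

lemma (in abelian_monoid) fin_sum_eq_finsum:
  assumes "finite S" "{i. c i \<noteq> \<zero>} \<subseteq> S" "\<And>i. c i \<in> carrier G"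
  shows "fin_sum G c = finsum G c S"
  unfolding fin_sum_def using finsum_support[of S UNIV c] assms by simp

lemma (in abelian_monoid) fin_sum_single:
  assumes "x \<in> carrier G"
  shows "fin_sum G (\<lambda>i. if i = n then x else \<zero>) = x"
proof -
  have "fin_sum G (\<lambda>i. if i = n then x else \<zero>) = finsum G (\<lambda>i. if i = n then x else \<zero>) {n}"
    using assms by (intro fin_sum_eq_finsum) auto
  then show ?thesis using assms by simp
qed

text \<open>
  The projections \<open>p\<close> supply the inverse of the summation map.
\<close>

lemma internal_direct_sumI:
  assumes "abelian_group G"
    and sub: "\<And>n. additive_subgroup (D n) G"
    and add: "\<And>n. additive_on (carrier G) G G (p n)"
    and mem: "\<And>n x. x \<in> carrier G \<Longrightarrow> p n x \<in> D n"
    and id: "\<And>n x. x \<in> D n \<Longrightarrow> p n x = x"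
    and zero: "\<And>n m x. x \<in> D n \<Longrightarrow> m \<noteq> n \<Longrightarrow> p m x = \<zero>\<^bsub>G\<^esub>"
    and fin: "\<And>x. x \<in> carrier G \<Longrightarrow> finite {n. p n x \<noteq> \<zero>\<^bsub>G\<^esub>}"
    and sum: "\<And>x. x \<in> carrier G \<Longrightarrow> fin_sum G (\<lambda>n. p n x) = x"
  shows "internal_direct_sum G UNIV D"
proof -
  interpret G: abelian_group G by fact
  have D: "x \<in> carrier G" if "x \<in> D n" for x n
    using sub[of n] that by (meson additive_subgroup.a_Hcarr)
  have fs: "fin_sum G c \<in> carrier G" "p n (fin_sum G c) = c n"
    if c: "c \<in> fin_families G UNIV D" for c n
  proof -
    have fin: "finite {n. c n \<noteq> \<zero>\<^bsub>G\<^esub>}" and cD: "\<And>n. c n \<in> D n"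
      using c by (auto simp: fin_families_def)
    \<comment> \<open>The index \<open>n\<close> is added to cover the case \<open>c n = \<zero>\<close>.\<close>
    let ?S = "insert n {n. c n \<noteq> \<zero>\<^bsub>G\<^esub>}"
    have s: "fin_sum G c = finsum G c ?S"
      using fin D[OF cD] by (intro G.fin_sum_eq_finsum) auto
    then show "fin_sum G c \<in> carrier G" using D[OF cD] by simp
    have "p n (fin_sum G c) = finsum G (\<lambda>i. p n (c i)) ?S"
      unfolding s by (rule additive_on_finsum) (use assms(1) add fin D[OF cD] in auto)
    also have "\<dots> = finsum G (\<lambda>i. if n = i then c i else \<zero>\<^bsub>G\<^esub>) ?S"
      using D[OF cD] id[OF cD] zero[OF cD] by (intro G.finsum_cong') auto
    also have "\<dots> = c n"
      using fin D[OF cD] by (subst G.finsum_singleton) auto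
    finally show "p n (fin_sum G c) = c n" .
  qed
  have "bij_betw (fin_sum G) (fin_families G UNIV D) (carrier G)"
    by (rule bij_betw_byWitness[where f' = "\<lambda>x n. p n x"])
      (use fs sum mem fin in \<open>auto simp: fin_families_def\<close>)
  then show ?thesis using sub by (simp add: internal_direct_sum_def)
qed

locale direct_sum = abelian_group G for G (structure) +
  fixes D :: "int \<Rightarrow> 'a set"
  assumes direct_sum: "internal_direct_sum G UNIV D"
begin

abbreviation cmp :: "'a \<Rightarrow> int \<Rightarrow> 'a" where "cmp \<equiv> components G D"

lemma component_subgroup: "additive_subgroup (D n) G"
  using direct_sum by (simp add: internal_direct_sum_def)

lemma D_carrier: "x \<in> D n \<Longrightarrow> x \<in> carrier G"
  using component_subgroup by (meson additive_subgroup.a_Hcarr)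

lemma D_zero [simp, intro]: "\<zero> \<in> D n"
  using component_subgroup by (meson additive_subgroup.zero_closed)

lemma D_add: "x \<in> D n \<Longrightarrow> y \<in> D n \<Longrightarrow> x \<oplus> y \<in> D n"
  using component_subgroup by (meson additive_subgroup.a_closed)

lemma D_neg: "x \<in> D n \<Longrightarrow> \<ominus> x \<in> D n"
  using component_subgroup abelian_group_axioms
  by (simp add: a_inv_def additive_subgroup.a_subgroup subgroup.m_inv_closed)

lemma components_families: "x \<in> carrier G \<Longrightarrow> cmp x \<in> fin_families G UNIV D"
  using direct_sum unfolding components_def internal_direct_sum_def
  by (metis bij_betw_imp_surj_on inv_into_into)

lemma fin_sum_components: "x \<in> carrier G \<Longrightarrow> fin_sum G (cmp x) = x"
  using direct_sum unfolding components_def internal_direct_sum_def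
  by (metis bij_betw_imp_surj_on f_inv_into_f)

lemma components_fin_sum: "c \<in> fin_families G UNIV D \<Longrightarrow> cmp (fin_sum G c) = c"
  using direct_sum unfolding components_def internal_direct_sum_def
  by (metis bij_betw_imp_inj_on inv_into_f_f)

lemma component_mem: "x \<in> carrier G \<Longrightarrow> cmp x n \<in> D n"
  using components_families by (auto simp: fin_families_def)

lemma component_carrier [simp]: "x \<in> carrier G \<Longrightarrow> cmp x n \<in> carrier G"
  using component_mem D_carrier by blast

lemma finite_support: "x \<in> carrier G \<Longrightarrow> finite {n. cmp x n \<noteq> \<zero>}"
  using components_families by (auto simp: fin_families_def)

lemma component_expansion:
  assumes "x \<in> carrier G" "finite S" "{n. cmp x n \<noteq> \<zero>} \<subseteq> S"
  shows "finsum G (cmp x) S = x"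
  using fin_sum_eq_finsum[OF assms(2,3)] fin_sum_components[OF assms(1)] assms(1) by simp

lemma components_homogeneous:
  assumes "x \<in> D n"
  shows "cmp x = (\<lambda>i. if i = n then x else \<zero>)"
proof -
  have "(\<lambda>i. if i = n then x else \<zero>) \<in> fin_families G UNIV D"
    using assms by (auto simp: fin_families_def)
  from components_fin_sum[OF this] show ?thesis
    using fin_sum_single[OF D_carrier[OF assms], of n] by simp
qed

lemma components_add:
  assumes "x \<in> carrier G" "y \<in> carrier G"
  shows "cmp (x \<oplus> y) n = cmp x n \<oplus> cmp y n"
proof -
  let ?c = "\<lambda>n. cmp x n \<oplus> cmp y n"
  let ?S = "{n. cmp x n \<noteq> \<zero>} \<union> {n. cmp y n \<noteq> \<zero>}"
  have fin: "finite ?S" using assms finite_support by simp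
  have sub: "{n. ?c n \<noteq> \<zero>} \<subseteq> ?S" using assms by auto
  have fam: "?c \<in> fin_families G UNIV D"
    using assms finite_subset[OF sub fin] component_mem D_add by (simp add: fin_families_def)
  have "fin_sum G ?c = finsum G ?c ?S"
    using fin sub assms by (intro fin_sum_eq_finsum) auto
  also have "\<dots> = finsum G (cmp x) ?S \<oplus> finsum G (cmp y) ?S"
    using assms by (intro finsum_addf) auto
  also have "\<dots> = x \<oplus> y"
    using component_expansion[OF _ fin] assms by auto
  finally show ?thesis using components_fin_sum[OF fam] by simp
qed

lemma homogeneous_induct [consumes 1, case_names zero homogeneous add]:
  assumes x: "x \<in> carrier G"
    and zero: "P \<zero>"
    and hom: "\<And>n x. x \<in> D n \<Longrightarrow> P x"
    and add: "\<And>x y. \<lbrakk>x \<in> carrier G; y \<in> carrier G; P x; P y\<rbrakk> \<Longrightarrow> P (x \<oplus> y)"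
  shows "P x"
proof -
  have "P (finsum G (cmp x) S)" if "finite S" for S
    using that
  proof (induction S rule: finite_induct)
    case empty
    then show ?case using zero by simp
  next
    case (insert n S)
    then show ?case
      using x add[OF component_carrier[OF x] finsum_closed hom[OF component_mem[OF x]], of "cmp x" S n]
      by simp
  qed
  from this[OF finite_support[OF x]] show ?thesis
    using component_expansion[OF x finite_support[OF x]] by simp
qed

lemma additive_eqI:
  assumes "abelian_group H" "additive_on (carrier G) G H f" "additive_on (carrier G) G H g"
    and "\<And>n x. x \<in> D n \<Longrightarrow> f x = g x" and "x \<in> carrier G"
  shows "f x = g x"
  using assms(5)
proof (induction x rule: homogeneous_induct)
  case zero
  show ?case
    using additive_on_zero[OF abelian_group_axioms assms(1) assms(2)]
      additive_on_zero[OF abelian_group_axioms assms(1) assms(3)] by simp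
qed (use assms(2-4) in \<open>auto simp: additive_on_add\<close>)

definition glue :: "('c, 'w) ring_scheme \<Rightarrow> (int \<Rightarrow> 'a \<Rightarrow> 'c) \<Rightarrow> 'a \<Rightarrow> 'c" where
  "glue H f x = (\<Oplus>\<^bsub>H\<^esub>n\<in>{n. cmp x n \<noteq> \<zero>}. f n (cmp x n))"

text \<open>
  The universal property of a direct sum.  Both the product of a Zhang twist and the extension of a
  homomorphism from the component of degree zero are obtained by gluing.
\<close>

lemma
  assumes H: "abelian_group H" and f: "\<And>n. additive_on (D n) G H (f n)"
  shows glue_additive: "additive_on (carrier G) G H (glue H f)"
    and glue_homogeneous: "x \<in> D n \<Longrightarrow> glue H f x = f n x"
proof -
  interpret H: abelian_group H by fact
  have fc: "f n (cmp x n) \<in> carrier H" if "x \<in> carrier G" for x n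
    using additive_on_closed[OF f component_mem[OF that]] .
  have f0: "f n \<zero> = \<zero>\<^bsub>H\<^esub>" for n
    using additive_on_zero[OF abelian_group_axioms H f] by blast
  have big: "glue H f x = (\<Oplus>\<^bsub>H\<^esub>n\<in>S. f n (cmp x n))"
    if "x \<in> carrier G" "finite S" "{n. cmp x n \<noteq> \<zero>} \<subseteq> S" for x S
    unfolding glue_def using that fc f0 by (intro H.add.finprod_mono_neutral_cong_left) auto
  show "additive_on (carrier G) G H (glue H f)"
  proof (rule additive_onI)
    fix x y assume xy: "x \<in> carrier G" "y \<in> carrier G"
    show "glue H f x \<in> carrier H" unfolding glue_def using fc xy by auto
    let ?S = "{n. cmp x n \<noteq> \<zero>} \<union> {n. cmp y n \<noteq> \<zero>}"
    have fin: "finite ?S" using xy finite_support by simp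
    have "glue H f (x \<oplus> y) = (\<Oplus>\<^bsub>H\<^esub>n\<in>?S. f n (cmp (x \<oplus> y) n))"
      using xy fin by (intro big) (auto simp: components_add)
    also have "\<dots> = (\<Oplus>\<^bsub>H\<^esub>n\<in>?S. f n (cmp x n) \<oplus>\<^bsub>H\<^esub> f n (cmp y n))"
      using xy fc component_mem
      by (intro H.finsum_cong') (auto simp: components_add additive_on_add[OF f])
    also have "\<dots> = (\<Oplus>\<^bsub>H\<^esub>n\<in>?S. f n (cmp x n)) \<oplus>\<^bsub>H\<^esub> (\<Oplus>\<^bsub>H\<^esub>n\<in>?S. f n (cmp y n))"
      using fc xy by (intro H.finsum_addf) auto
    also have "\<dots> = glue H f x \<oplus>\<^bsub>H\<^esub> glue H f y"
      using big[OF _ fin] xy by auto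
    finally show "glue H f (x \<oplus> y) = glue H f x \<oplus>\<^bsub>H\<^esub> glue H f y" .
  qed
  show "glue H f x = f n x" if x: "x \<in> D n"
  proof -
    have "glue H f x = (\<Oplus>\<^bsub>H\<^esub>n\<in>{n}. f n (cmp x n))"
      using D_carrier[OF x] by (rule big) (auto simp: components_homogeneous[OF x])
    then show ?thesis
      using fc[OF D_carrier[OF x], of n] by (simp add: components_homogeneous[OF x])
  qed
qed

lemma D_disjoint:
  assumes "x \<in> D n" "x \<in> D m" "n \<noteq> m" shows "x = \<zero>"
  using components_homogeneous[OF assms(1)] components_homogeneous[OF assms(2)] assms(3)
  by (metis (full_types))

end

section \<open>Right modules\<close>

lemma abelian_group_cong:
  assumes "carrier G = carrier H" "add G = add H" "\<zero>\<^bsub>G\<^esub> = \<zero>\<^bsub>H\<^esub>"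
  shows "abelian_group G \<longleftrightarrow> abelian_group H"
  using assms by (simp add: abelian_group_def abelian_group_axioms_def abelian_monoid_def
      comm_monoid_def monoid_def comm_monoid_axioms_def comm_group_def group_def group_axioms_def Units_def)

locale rmodule = ring R + M: abelian_group M
  for R :: "('r, 'y) ring_scheme" (structure) and M :: "('r, 'm, 'z) rmod_scheme" +
  assumes ract_closed [simp]: "\<lbrakk>x \<in> carrier M; a \<in> carrier R\<rbrakk> \<Longrightarrow> ract M x a \<in> carrier M"
    and ract_add_left: "\<lbrakk>x \<in> carrier M; y \<in> carrier M; a \<in> carrier R\<rbrakk> \<Longrightarrow>
      ract M (x \<oplus>\<^bsub>M\<^esub> y) a = ract M x a \<oplus>\<^bsub>M\<^esub> ract M y a"
    and ract_add_right: "\<lbrakk>x \<in> carrier M; a \<in> carrier R; b \<in> carrier R\<rbrakk> \<Longrightarrow>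
      ract M x (a \<oplus> b) = ract M x a \<oplus>\<^bsub>M\<^esub> ract M x b"
    and ract_mult: "\<lbrakk>x \<in> carrier M; a \<in> carrier R; b \<in> carrier R\<rbrakk> \<Longrightarrow>
      ract M x (a \<otimes> b) = ract M (ract M x a) b"
    and ract_one [simp]: "x \<in> carrier M \<Longrightarrow> ract M x \<one> = x"
begin

lemma ract_additive_left: "a \<in> carrier R \<Longrightarrow> additive_on (carrier M) M M (\<lambda>x. ract M x a)"
  by (rule additive_onI) (simp_all add: ract_add_left)

lemma ract_additive_right: "x \<in> carrier M \<Longrightarrow> additive_on (carrier R) R M (ract M x)"
  by (rule additive_onI) (simp_all add: ract_add_right)

lemma ract_zero_left [simp]: "a \<in> carrier R \<Longrightarrow> ract M \<zero>\<^bsub>M\<^esub> a = \<zero>\<^bsub>M\<^esub>"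
  using additive_on_zero[OF M.abelian_group_axioms M.abelian_group_axioms ract_additive_left] by simp

lemma ract_zero_right [simp]: "x \<in> carrier M \<Longrightarrow> ract M x \<zero> = \<zero>\<^bsub>M\<^esub>"
  using additive_on_zero[OF abelian_group_axioms M.abelian_group_axioms ract_additive_right] by simp

end

lemma right_module_iff_rmodule: "right_module R M \<longleftrightarrow> rmodule R M"
proof
  assume "right_module R M"
  then interpret ring R + M: abelian_group M by (auto simp: right_module_def)
  show "rmodule R M"
    by unfold_locales (use \<open>right_module R M\<close> in \<open>auto simp: right_module_def\<close>)
next
  assume "rmodule R M"
  then interpret rmodule R M .
  show "right_module R M"
    unfolding right_module_def
    using ring_axioms M.abelian_group_axioms ract_add_left ract_add_right ract_mult by simp
qed

lemma rmod_hom_iff: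
  "f \<in> rmod_hom R M N \<longleftrightarrow> f \<in> extensional (carrier M) \<and> additive_on (carrier M) M N f \<and>
     (\<forall>x\<in>carrier M. \<forall>a\<in>carrier R. f (ract M x a) = ract N (f x) a)"
  by (auto simp: rmod_hom_def additive_on_def PiE_def)

lemma rmod_homD:
  assumes "f \<in> rmod_hom R M N"
  shows "f \<in> extensional (carrier M)" "additive_on (carrier M) M N f"
    "x \<in> carrier M \<Longrightarrow> f x \<in> carrier N"
    "x \<in> carrier M \<Longrightarrow> y \<in> carrier M \<Longrightarrow> f (x \<oplus>\<^bsub>M\<^esub> y) = f x \<oplus>\<^bsub>N\<^esub> f y"
    "x \<in> carrier M \<Longrightarrow> a \<in> carrier R \<Longrightarrow> f (ract M x a) = ract N (f x) a"
  using assms by (auto simp: rmod_hom_iff additive_on_def)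

lemma rmod_hom_zero:
  assumes "right_module R M" "right_module R N" "f \<in> rmod_hom R M N"
  shows "f \<zero>\<^bsub>M\<^esub> = \<zero>\<^bsub>N\<^esub>"
proof -
  interpret M: rmodule R M using assms by (simp add: right_module_iff_rmodule)
  interpret N: rmodule R N using assms by (simp add: right_module_iff_rmodule)
  show ?thesis
    using additive_on_zero[OF M.M.abelian_group_axioms N.M.abelian_group_axioms rmod_homD(2)[OF assms(3)]]
    by simp
qed

lemma rmod_hom_restrict_id:
  assumes "right_module R M" "carrier M = carrier N" "add M = add N"
    "\<And>x a. x \<in> carrier M \<Longrightarrow> a \<in> carrier R \<Longrightarrow> ract M x a = ract N x a"
  shows "restrict (\<lambda>x. x) (carrier M) \<in> rmod_hom R M N"
proof -
  interpret M: rmodule R M using assms by (simp add: right_module_iff_rmodule)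
  show ?thesis
    using assms(2-4) M.M.a_closed M.ract_closed by (auto simp: rmod_hom_iff additive_on_def)
qed

lemma rmod_hom_compose:
  assumes "right_module R L" "f \<in> rmod_hom R L M" "g \<in> rmod_hom R M N"
  shows "compose (carrier L) g f \<in> rmod_hom R L N"
proof -
  interpret L: rmodule R L using assms by (simp add: right_module_iff_rmodule)
  show ?thesis
    using rmod_homD[OF assms(2)] rmod_homD[OF assms(3)]
    by (auto simp: rmod_hom_iff additive_on_def compose_def)
qed

lemma rmod_hom_inverse:
  assumes "right_module R M" "f \<in> rmod_hom R M N" "bij_betw f (carrier M) (carrier N)"
  shows "restrict (inv_into (carrier M) f) (carrier N) \<in> rmod_hom R N M"
proof -
  interpret M: rmodule R M using assms by (simp add: right_module_iff_rmodule)
  let ?g = "inv_into (carrier M) f"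
  have g: "?g y \<in> carrier M" "f (?g y) = y" if "y \<in> carrier N" for y
    using assms(3) that by (auto simp: bij_betw_def inv_into_into f_inv_into_f)
  have gf: "?g (f x) = x" if "x \<in> carrier M" for x
    using assms(3) that by (auto simp: bij_betw_def)
  note f = rmod_homD[OF assms(2)]
  have "y \<oplus>\<^bsub>N\<^esub> z = f (?g y \<oplus>\<^bsub>M\<^esub> ?g z)" if "y \<in> carrier N" "z \<in> carrier N" for y z
    using g that f by simp
  moreover have "ract N y a = f (ract M (?g y) a)" if "y \<in> carrier N" "a \<in> carrier R" for y a
    using g that f by simp
  ultimately show ?thesis
    using g gf f(3) by (auto simp: rmod_hom_iff additive_on_def)
qed

lemma Obj_Mod_cat [simp]: "M \<in> Obj (Mod_cat R) \<longleftrightarrow> right_module R M"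
  by (simp add: Mod_cat_def)

lemma Hom_Mod_cat [simp]: "Hom (Mod_cat R) = rmod_hom R"
  by (simp add: Mod_cat_def)

lemma Idn_Mod_cat [simp]: "Idn (Mod_cat R) M = restrict (\<lambda>x. x) (carrier M)"
  by (simp add: Mod_cat_def)

lemma Cmp_Mod_cat [simp]: "Cmp (Mod_cat R) L M N g f = compose (carrier L) g f"
  by (simp add: Mod_cat_def)

lemma compose_laws:
  "\<lbrakk>f \<in> extensional S; f ` S \<subseteq> T\<rbrakk> \<Longrightarrow> compose S (restrict (\<lambda>x. x) T) f = f"
  "f \<in> extensional S \<Longrightarrow> compose S f (restrict (\<lambda>x. x) S) = f"
  "f ` S \<subseteq> T \<Longrightarrow> compose S (compose T h g) f = compose S h (compose S g f)"
  by (auto simp: compose_def extensional_def fun_eq_iff)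

lemma rmod_hom_image: "f \<in> rmod_hom R M N \<Longrightarrow> f ` carrier M \<subseteq> carrier N"
  using rmod_homD(3)[of f R M N] by blast

lemma category_Mod_cat: "category (Mod_cat R)"
  unfolding category_def
proof (intro conjI ballI)
  fix M assume M: "M \<in> Obj (Mod_cat R)"
  show "Idn (Mod_cat R) M \<in> Hom (Mod_cat R) M M"
    using M rmod_hom_restrict_id[of R M M] by simp
qed (auto simp: rmod_hom_compose compose_laws rmod_homD(1) rmod_hom_image)

lemma iso_arrow_Mod_cat:
  assumes "right_module R M" "f \<in> rmod_hom R M N" "bij_betw f (carrier M) (carrier N)"
  shows "iso_arrow (Mod_cat R) M N f"
  unfolding iso_arrow_def
proof (intro conjI bexI[of _ "restrict (inv_into (carrier M) f) (carrier N)"])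
  show "restrict (inv_into (carrier M) f) (carrier N) \<in> Hom (Mod_cat R) N M"
    using rmod_hom_inverse[OF assms] by simp
qed (use assms in \<open>auto simp: compose_def bij_betw_def fun_eq_iff inv_into_into f_inv_into_f\<close>)

lemma right_module_pullback:
  assumes "right_module R N" "\<gamma> \<in> ring_hom R R"
  shows "right_module R (N\<lparr>ract := \<lambda>x b. ract N x (\<gamma> b)\<rparr>)"
proof -
  interpret N: rmodule R N using assms by (simp add: right_module_iff_rmodule)
  have "abelian_group (N\<lparr>ract := \<lambda>x b. ract N x (\<gamma> b)\<rparr>) \<longleftrightarrow> abelian_group N"
    by (rule abelian_group_cong) simp_all
  then show ?thesis
    using ring_hom_memE[OF assms(2)] N.ring_axioms N.M.abelian_group_axioms
    by (simp add: right_module_def N.ract_add_left N.ract_add_right N.ract_mult)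
qed

text \<open>
  Pulling back along \<open>\<gamma>\<^sup>-\<^sup>1\<close> is an inverse only up to isomorphism: the two actions agree on the carrier
  of \<open>R\<close>, whereas the action of a module is a total function whose other values are arbitrary.
\<close>

theorem pullback_equivalence:
  assumes R: "ring R" and \<gamma>: "\<gamma> \<in> ring_iso R R"
  shows "fully_faithful_essentially_surjective (Mod_cat R) (Mod_cat R)
           (pullback_functor \<gamma> :: (('r, 'm) rmod, _, _, _) cfunctor)"
proof -
  have hom: "\<gamma> \<in> ring_hom R R" and bij: "bij_betw \<gamma> (carrier R) (carrier R)"
    using \<gamma> by (auto simp: ring_iso_def)
  let ?d = "inv_into (carrier R) \<gamma>"
  have inv_hom: "?d \<in> ring_hom R R"
    using ring_iso_set_sym[OF R \<gamma>] by (simp add: ring_iso_def)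
  let ?P = "\<lambda>N :: ('r, 'm) rmod. N\<lparr>ract := \<lambda>x b. ract N x (\<gamma> b)\<rparr>"
  have inv: "\<gamma> (?d b) = b" "?d b \<in> carrier R" if "b \<in> carrier R" for b
    using bij that by (auto simp: bij_betw_def f_inv_into_f inv_into_into)
  have g: "\<gamma> b \<in> carrier R" if "b \<in> carrier R" for b using bij that by (auto simp: bij_betw_def)
  have homs: "rmod_hom R (?P M) (?P N) = rmod_hom R M N" for M N
    using g inv by (auto simp: rmod_hom_def) metis
  show ?thesis
    unfolding fully_faithful_essentially_surjective_def is_functor_def
  proof (intro conjI ballI; (rule category_Mod_cat)?)
    show "\<exists>X\<in>Obj (Mod_cat R). isomorphic_objs (Mod_cat R) (fobj (pullback_functor \<gamma>) X) Y"
      if "Y \<in> Obj (Mod_cat R)" for Y :: "('r, 'm) rmod"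
    proof (intro bexI)
      let ?X = "Y\<lparr>ract := \<lambda>x b. ract Y x (?d b)\<rparr>"
      have X: "right_module R ?X"
        using right_module_pullback[OF _ inv_hom] that by simp
      then show "?X \<in> Obj (Mod_cat R)" by simp
      have PX: "right_module R (?P ?X)" using right_module_pullback[OF X hom] .
      have "restrict (\<lambda>x. x) (carrier (?P ?X)) \<in> rmod_hom R (?P ?X) Y"
        by (rule rmod_hom_restrict_id[OF PX]) (use bij in \<open>auto simp: bij_betw_def\<close>)
      then have "iso_arrow (Mod_cat R) (?P ?X) Y (restrict (\<lambda>x. x) (carrier (?P ?X)))"
        by (rule iso_arrow_Mod_cat[OF PX]) (auto simp: bij_betw_def inj_on_def)
      then show "isomorphic_objs (Mod_cat R) (fobj (pullback_functor \<gamma>) ?X) Y"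
        unfolding isomorphic_objs_def pullback_functor_def by auto
    qed
  qed (use homs right_module_pullback[OF _ hom] in \<open>auto simp: pullback_functor_def bij_betw_def inj_on_def\<close>)
qed

lemma abelian_group_transport:
  assumes "abelian_group M" "inj_on j (carrier M)"
    "carrier N = j ` carrier M" "\<zero>\<^bsub>N\<^esub> = j \<zero>\<^bsub>M\<^esub>"
    and add: "\<And>x y. x \<in> carrier M \<Longrightarrow> y \<in> carrier M \<Longrightarrow> j x \<oplus>\<^bsub>N\<^esub> j y = j (x \<oplus>\<^bsub>M\<^esub> y)"
  shows "abelian_group N"
proof -
  interpret M: abelian_group M by fact
  show ?thesis
  proof (rule abelian_groupI)
    fix x assume "x \<in> carrier N"
    then obtain a where a: "a \<in> carrier M" "x = j a" using assms by blast
    then have "j (\<ominus>\<^bsub>M\<^esub> a) \<oplus>\<^bsub>N\<^esub> x = \<zero>\<^bsub>N\<^esub>" using assms(4) by (simp add: add M.l_neg)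
    then show "\<exists>y\<in>carrier N. y \<oplus>\<^bsub>N\<^esub> x = \<zero>\<^bsub>N\<^esub>" using a assms(3) by blast
  qed (auto simp: assms(3,4) add M.a_ac)
qed

text \<open>
  The modules \<open>M\<close> and \<open>N\<close> may live on different types: this is how a module constructed on another type
  is moved into the universe.
\<close>

lemma
  assumes "right_module R M" and inj: "inj_on j (carrier M)"
    and N: "carrier N = j ` carrier M" "\<zero>\<^bsub>N\<^esub> = j \<zero>\<^bsub>M\<^esub>"
    and add: "\<And>x y. x \<in> carrier M \<Longrightarrow> y \<in> carrier M \<Longrightarrow> j x \<oplus>\<^bsub>N\<^esub> j y = j (x \<oplus>\<^bsub>M\<^esub> y)"
    and act: "\<And>x a. x \<in> carrier M \<Longrightarrow> a \<in> carrier R \<Longrightarrow> ract N (j x) a = j (ract M x a)"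
  shows right_module_transfer: "right_module R N"
    and right_module_transfer_hom: "restrict j (carrier M) \<in> rmod_hom R M N"
    and right_module_transfer_bij: "bij_betw (restrict j (carrier M)) (carrier M) (carrier N)"
proof -
  interpret M: rmodule R M using assms by (simp add: right_module_iff_rmodule)
  have "abelian_group N"
    by (rule abelian_group_transport[OF M.M.abelian_group_axioms inj N add])
  then show "right_module R N"
    unfolding right_module_def using M.ring_axioms
    by (auto simp: N add act M.ract_add_left M.ract_add_right M.ract_mult)
  show "restrict j (carrier M) \<in> rmod_hom R M N"
    by (auto simp: rmod_hom_def N add act)
  show "bij_betw (restrict j (carrier M)) (carrier M) (carrier N)"
    using inj N by (auto simp: bij_betw_def inj_on_def)
qed

lemma rmod_hom_factor:
  assumes M: "right_module R M" and \<theta>: "\<theta> \<in> rmod_hom R M M'" "\<theta> ` carrier M = carrier M'"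
    and g: "g \<in> rmod_hom R M N" and k: "k \<in> extensional (carrier M')"
    and eq: "\<And>x. x \<in> carrier M \<Longrightarrow> k (\<theta> x) = g x"
  shows "k \<in> rmod_hom R M' N"
proof -
  interpret M: rmodule R M using M by (simp add: right_module_iff_rmodule)
  note th = rmod_homD[OF \<theta>(1)] and gh = rmod_homD[OF g]
  show ?thesis
    unfolding rmod_hom_iff \<theta>(2)[symmetric]
  proof (intro conjI additive_onI ballI)
    show "k \<in> extensional (\<theta> ` carrier M)" using k \<theta>(2) by simp
    show "k y \<in> carrier N" if "y \<in> \<theta> ` carrier M" for y using that eq gh(3) by auto
    show "k (y \<oplus>\<^bsub>M'\<^esub> z) = k y \<oplus>\<^bsub>N\<^esub> k z" if "y \<in> \<theta> ` carrier M" "z \<in> \<theta> ` carrier M" for y z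
      using that by (auto simp: eq gh(4) simp flip: th(4))
    show "k (ract M' y a) = ract N (k y) a" if "y \<in> \<theta> ` carrier M" "a \<in> carrier R" for y a
      using that by (auto simp: eq gh(5) simp flip: th(5))
  qed
qed

section \<open>Graded modules\<close>

lemma graded_module_direct_sum:
  "graded_module A \<A> M \<Longrightarrow> direct_sum M (grade M)"
  by (simp add: graded_module_def direct_sum_def direct_sum_axioms_def right_module_def)

locale gmodule = rmodule A M + direct_sum M "grade M"
  for A :: "('k, 'a) module" (structure) and \<A> :: "int \<Rightarrow> 'a set" and M :: "('a, 'm) gmod" +
  assumes ract_grade: "\<lbrakk>x \<in> grade M n; a \<in> \<A> m\<rbrakk> \<Longrightarrow> ract M x a \<in> grade M (n + m)"

lemma graded_module_iff_gmodule: "graded_module A \<A> M \<longleftrightarrow> gmodule A \<A> M"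
proof
  assume M: "graded_module A \<A> M"
  then interpret rmodule A M by (simp add: graded_module_def right_module_iff_rmodule)
  interpret direct_sum M "grade M" using M by (rule graded_module_direct_sum)
  show "gmodule A \<A> M"
    by unfold_locales (use M in \<open>auto simp: graded_module_def\<close>)
next
  assume "gmodule A \<A> M"
  then interpret gmodule A \<A> M .
  show "graded_module A \<A> M"
    using rmodule_axioms direct_sum ract_grade
    by (auto simp: graded_module_def right_module_iff_rmodule)
qed

lemma gmod_hom_iff:
  "f \<in> gmod_hom A M N \<longleftrightarrow> f \<in> rmod_hom A M N \<and> (\<forall>n. \<forall>x\<in>grade M n. f x \<in> grade N n)"
  by (auto simp: gmod_hom_def)

lemma gmod_homD:
  assumes "f \<in> gmod_hom A M N"
  shows "f \<in> rmod_hom A M N" "f \<in> extensional (carrier M)" "f ` carrier M \<subseteq> carrier N"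
    "x \<in> grade M n \<Longrightarrow> f x \<in> grade N n"
  using assms rmod_homD(1)[of f A M N] rmod_hom_image[of f A M N] by (auto simp: gmod_hom_iff)

lemma Obj_Gr [simp]: "M \<in> Obj (Gr A \<A>) \<longleftrightarrow> graded_module A \<A> M"
  by (simp add: Gr_def)

lemma Hom_Gr [simp]: "Hom (Gr A \<A>) = gmod_hom A"
  by (simp add: Gr_def)

lemma Idn_Gr [simp]: "Idn (Gr A \<A>) M = restrict (\<lambda>x. x) (carrier M)"
  by (simp add: Gr_def)

lemma Cmp_Gr [simp]: "Cmp (Gr A \<A>) L M N g f = compose (carrier L) g f"
  by (simp add: Gr_def)

lemma gmod_hom_restrict_id:
  assumes "graded_module A \<A> M"
  shows "restrict (\<lambda>x. x) (carrier M) \<in> gmod_hom A M M"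
proof -
  interpret M: gmodule A \<A> M using assms by (simp add: graded_module_iff_gmodule)
  show ?thesis
    using assms M.D_carrier rmod_hom_restrict_id[of A M M]
    by (auto simp: gmod_hom_iff graded_module_def)
qed

lemma gmod_hom_compose:
  assumes "graded_module A \<A> L" "f \<in> gmod_hom A L M" "g \<in> gmod_hom A M N"
  shows "compose (carrier L) g f \<in> gmod_hom A L N"
proof -
  interpret L: gmodule A \<A> L using assms by (simp add: graded_module_iff_gmodule)
  show ?thesis
    using assms L.D_carrier rmod_hom_compose[of A L f M g N]
    by (auto simp: gmod_hom_iff graded_module_def compose_def)
qed

lemma category_Gr: "category (Gr A \<A>)"
  unfolding category_def
  by (auto simp: gmod_hom_restrict_id gmod_hom_compose compose_laws gmod_homD)

text \<open>
  A bijective homomorphism of graded modules reflects degrees because it commutes with the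
  projections onto the components.
\<close>

lemma gmod_hom_component:
  assumes "graded_module A \<A> M" "graded_module A \<A> N" "f \<in> gmod_hom A M N" "x \<in> carrier M"
  shows "f (components M (grade M) x n) = components N (grade N) (f x) n"
proof -
  interpret M: gmodule A \<A> M using assms by (simp add: graded_module_iff_gmodule)
  interpret N: gmodule A \<A> N using assms by (simp add: graded_module_iff_gmodule)
  have f: "f \<in> rmod_hom A M N" "\<And>n x. x \<in> grade M n \<Longrightarrow> f x \<in> grade N n"
    using assms(3) by (auto simp: gmod_hom_iff)
  have f0: "f \<zero>\<^bsub>M\<^esub> = \<zero>\<^bsub>N\<^esub>"
    using assms f rmod_hom_zero by (auto simp: graded_module_def)
  show ?thesis
  proof (rule M.additive_eqI[OF N.M.abelian_group_axioms _ _ _ assms(4)])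
    show "additive_on (carrier M) M N (\<lambda>x. f (M.cmp x n))"
      "additive_on (carrier M) M N (\<lambda>x. N.cmp (f x) n)"
      by (rule additive_onI; use rmod_homD[OF f(1)] in
          \<open>simp add: M.components_add N.components_add\<close>)+
    show "f (M.cmp x n) = N.cmp (f x) n" if "x \<in> grade M m" for m x
      using f(2)[OF that] that f0 by (simp add: M.components_homogeneous N.components_homogeneous)
  qed
qed

lemma iso_arrow_Gr_iff:
  assumes M: "graded_module A \<A> M" and N: "graded_module A \<A> N"
  shows "iso_arrow (Gr A \<A>) M N f \<longleftrightarrow> f \<in> gmod_hom A M N \<and> bij_betw f (carrier M) (carrier N)"
proof
  interpret M: gmodule A \<A> M using M by (simp add: graded_module_iff_gmodule)
  interpret N: gmodule A \<A> N using N by (simp add: graded_module_iff_gmodule)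
  assume f: "f \<in> gmod_hom A M N \<and> bij_betw f (carrier M) (carrier N)"
  then have fr: "f \<in> rmod_hom A M N" by (simp add: gmod_hom_iff)
  let ?g = "restrict (inv_into (carrier M) f) (carrier N)"
  have "?g y \<in> grade M n" if y: "y \<in> grade N n" for y n
  proof -
    let ?x = "inv_into (carrier M) f y"
    have x: "?x \<in> carrier M" "f ?x = y"
      using f N.D_carrier[OF y] by (auto simp: bij_betw_def inv_into_into f_inv_into_f)
    have "f (M.cmp ?x n) = y"
      using gmod_hom_component[OF M N _ x(1), of f n] f x(2) y by (simp add: N.components_homogeneous)
    then have "M.cmp ?x n = ?x"
      using f x by (metis M.component_carrier bij_betw_imp_inj_on inj_onD)
    then show ?thesis using M.component_mem[OF x(1), of n] N.D_carrier[OF y] by simp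
  qed
  then have "?g \<in> gmod_hom A N M"
    using rmod_hom_inverse[OF _ fr] f M by (auto simp: gmod_hom_iff graded_module_def)
  then show "iso_arrow (Gr A \<A>) M N f"
    unfolding iso_arrow_def using f
    by (intro conjI bexI[of _ ?g])
      (auto simp: compose_def bij_betw_def fun_eq_iff inv_into_into f_inv_into_f)
next
  assume "iso_arrow (Gr A \<A>) M N f"
  then obtain g where fg: "f \<in> gmod_hom A M N" "g \<in> gmod_hom A N M"
    and eq: "compose (carrier M) g f = restrict (\<lambda>x. x) (carrier M)"
      "compose (carrier N) f g = restrict (\<lambda>x. x) (carrier N)"
    by (auto simp: iso_arrow_def)
  have "bij_betw f (carrier M) (carrier N)"
  proof (rule bij_betw_byWitness[where f' = g])
    show "\<forall>x\<in>carrier M. g (f x) = x" "\<forall>x\<in>carrier N. f (g x) = x"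
      using eq by (simp_all add: compose_def fun_eq_iff) metis+
    show "f ` carrier M \<subseteq> carrier N" "g ` carrier N \<subseteq> carrier M"
      using fg gmod_homD(3) by metis+
  qed
  with fg show "f \<in> gmod_hom A M N \<and> bij_betw f (carrier M) (carrier N)" by simp
qed

lemma internal_direct_sum_shift:
  assumes "direct_sum G D"
  shows "internal_direct_sum G UNIV (\<lambda>n. D (n + k))"
proof -
  interpret direct_sum G D by fact
  show ?thesis
  proof (rule internal_direct_sumI[where p = "\<lambda>n x. cmp x (n + k)"])
    show "additive_on (carrier G) G G (\<lambda>x. cmp x (n + k))" for n
      by (rule additive_onI) (simp_all add: components_add)
    fix x assume x: "x \<in> carrier G"
    have eq: "(\<lambda>n. n + k) ` {n. cmp x (n + k) \<noteq> \<zero>\<^bsub>G\<^esub>} = {n. cmp x n \<noteq> \<zero>\<^bsub>G\<^esub>}"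
      by (force simp: image_iff intro: exI[of _ "_ - k"])
    have inj: "inj_on (\<lambda>n. n + k) {n. cmp x (n + k) \<noteq> \<zero>\<^bsub>G\<^esub>}"
      by (simp add: inj_on_def)
    show "finite {n. cmp x (n + k) \<noteq> \<zero>\<^bsub>G\<^esub>}"
      by (rule finite_imageD[OF _ inj]) (unfold eq, rule finite_support[OF x])
    have "fin_sum G (\<lambda>n. cmp x (n + k)) = finsum G (cmp x) ((\<lambda>n. n + k) ` {n. cmp x (n + k) \<noteq> \<zero>\<^bsub>G\<^esub>})"
      unfolding fin_sum_def by (rule finsum_reindex[OF _ inj, symmetric]) (simp add: x)
    then show "fin_sum G (\<lambda>n. cmp x (n + k)) = x"
      unfolding eq using fin_sum_components[OF x] by (simp add: fin_sum_def)
  qed (auto simp: abelian_group_axioms component_subgroup component_mem components_homogeneous)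
qed

definition shift_by :: "int \<Rightarrow> ('a, 'm) gmod \<Rightarrow> ('a, 'm) gmod" where
  "shift_by k M = M\<lparr>grade := \<lambda>n. grade M (n + k)\<rparr>"

lemma shift_by_simps [simp]:
  "carrier (shift_by k M) = carrier M" "add (shift_by k M) = add M" "ract (shift_by k M) = ract M"
  "\<zero>\<^bsub>shift_by k M\<^esub> = \<zero>\<^bsub>M\<^esub>" "grade (shift_by k M) n = grade M (n + k)"
  by (simp_all add: shift_by_def)

lemma direct_sum_cong:
  fixes I :: "'i set"
  assumes "carrier G = carrier H" "add G = add H" "\<zero>\<^bsub>G\<^esub> = \<zero>\<^bsub>H\<^esub>"
  shows "internal_direct_sum G I D \<longleftrightarrow> internal_direct_sum H I D"
proof -
  have a_inv: "a_inv G = a_inv H"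
    using assms by (simp add: a_inv_def m_inv_def fun_eq_iff)
  have sub: "additive_subgroup S G \<longleftrightarrow> additive_subgroup S H" for S
    using assms a_inv by (simp add: additive_subgroup_def subgroup_def a_inv_def)
  have "fin_sum G = (fin_sum H :: ('i \<Rightarrow> _) \<Rightarrow> _)"
    unfolding fin_sum_def finsum_def finprod_def by (simp add: assms cong: if_cong)
  moreover have "fin_families G I D = fin_families H I D"
    using assms by (simp add: fin_families_def)
  ultimately show ?thesis
    using assms sub by (simp add: internal_direct_sum_def)
qed

lemma shift_by_graded:
  assumes "graded_module A \<A> M"
  shows "graded_module A \<A> (shift_by k M)"
proof -
  interpret M: gmodule A \<A> M using assms by (simp add: graded_module_iff_gmodule)
  have "abelian_group (shift_by k M) \<longleftrightarrow> abelian_group M" by (rule abelian_group_cong) simp_all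
  then have "right_module A (shift_by k M)"
    using assms by (simp add: graded_module_def right_module_def)
  moreover have "internal_direct_sum (shift_by k M) UNIV (grade (shift_by k M))"
    using internal_direct_sum_shift[OF M.direct_sum_axioms, of k]
      direct_sum_cong[of "shift_by k M" M UNIV "\<lambda>n. grade M (n + k)"]
    by (simp add: shift_by_def)
  moreover have "ract M x a \<in> grade M (n + m + k)" if "x \<in> grade M (n + k)" "a \<in> \<A> m" for x a n m
    using M.ract_grade[OF that] by (simp add: add_ac)
  ultimately show ?thesis by (simp add: graded_module_def)
qed

theorem shift_equivalence:
  "fully_faithful_essentially_surjective (Gr A \<A>) (Gr A \<A>)
     (shift_functor :: (('a, 'm) gmod, _, _, _) cfunctor)"
proof -
  have obj: "fobj shift_functor M = shift_by 1 M" for M :: "('a, 'm) gmod"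
    by (simp add: shift_functor_def shift_by_def)
  have arr: "farr shift_functor M N f = f" for M N :: "('a, 'm) gmod" and f
    by (simp add: shift_functor_def)
  have hom: "gmod_hom A (shift_by 1 M) (shift_by 1 N) = gmod_hom A M N" for M N :: "('a, 'm) gmod"
  proof -
    have "(\<forall>n. f ` grade M (n + 1) \<subseteq> grade N (n + 1)) \<longleftrightarrow> (\<forall>n. f ` grade M n \<subseteq> grade N n)"
      (is "?L \<longleftrightarrow> ?R") for f
    proof
      assume L: ?L
      show ?R
      proof
        fix n show "f ` grade M n \<subseteq> grade N n" using L[rule_format, of "n - 1"] by simp
      qed
    qed blast
    then show ?thesis by (simp add: gmod_hom_def rmod_hom_def)
  qed
  show ?thesis
    unfolding fully_faithful_essentially_surjective_def is_functor_def obj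
  proof (intro conjI ballI; (rule category_Gr)?)
    fix N :: "('a, 'm) gmod" assume N: "N \<in> Obj (Gr A \<A>)"
    have "shift_by 1 (shift_by (- 1) N) = N" by (simp add: shift_by_def)
    then have "isomorphic_objs (Gr A \<A>) (shift_by 1 (shift_by (- 1) N)) N"
      using N cat_ctx.iso_arrow_idn[of "Gr A \<A>" N] category_Gr
      unfolding isomorphic_objs_def cat_ctx_def by metis
    then show "\<exists>M\<in>Obj (Gr A \<A>). isomorphic_objs (Gr A \<A>) (shift_by 1 M) N"
      using N shift_by_graded[of A \<A> N "- 1"] by auto
  qed (use hom shift_by_graded in \<open>auto simp: arr bij_betw_def inj_on_def\<close>)
qed

subsection \<open>Transport of structure\<close>

text \<open>
  The projections of the new decomposition are the old ones conjugated by \<open>j\<close>.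
\<close>

lemma internal_direct_sum_transport:
  assumes "direct_sum G D" and H: "abelian_group H"
    and j: "additive_on (carrier G) G H j" and bij: "bij_betw j (carrier G) (carrier H)"
  shows "internal_direct_sum H UNIV (\<lambda>n. j ` D n)"
proof -
  interpret G: direct_sum G D by fact
  interpret H: abelian_group H by fact
  let ?i = "inv_into (carrier G) j"
  have i: "?i y \<in> carrier G" "j (?i y) = y" if "y \<in> carrier H" for y
    using bij that by (auto simp: bij_betw_def inv_into_into f_inv_into_f)
  have ij: "?i (j x) = x" if "x \<in> carrier G" for x using bij that by (auto simp: bij_betw_def)
  have i_add: "?i (y \<oplus>\<^bsub>H\<^esub> z) = ?i y \<oplus>\<^bsub>G\<^esub> ?i z" if "y \<in> carrier H" "z \<in> carrier H" for y z
    using ij[of "?i y \<oplus>\<^bsub>G\<^esub> ?i z"] additive_on_add[OF j] i that by simp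
  have jc: "j x \<in> carrier H" if "x \<in> carrier G" for x using additive_on_closed[OF j that] .
  have j0: "j \<zero>\<^bsub>G\<^esub> = \<zero>\<^bsub>H\<^esub>" using additive_on_zero[OF G.abelian_group_axioms H j] by simp
  have jz: "j x = \<zero>\<^bsub>H\<^esub> \<longleftrightarrow> x = \<zero>\<^bsub>G\<^esub>" if "x \<in> carrier G" for x
    using ij[OF that] ij[of "\<zero>\<^bsub>G\<^esub>"] j0 by auto
  show ?thesis
  proof (rule internal_direct_sumI[where p = "\<lambda>n y. j (G.cmp (?i y) n)"])
    show "additive_subgroup (j ` D n) H" for n
    proof (rule additive_subgroupI, rule subgroup.intro)
      show "j ` D n \<subseteq> carrier (add_monoid H)" using jc G.D_carrier by auto
      show "x \<otimes>\<^bsub>add_monoid H\<^esub> y \<in> j ` D n" if xy: "x \<in> j ` D n" "y \<in> j ` D n" for x y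
      proof -
        obtain a b where "a \<in> D n" "b \<in> D n" "x = j a" "y = j b" using xy by blast
        then show ?thesis
          using additive_on_add[OF j, of a b] G.D_carrier G.D_add by (auto intro!: image_eqI[of _ _ "a \<oplus>\<^bsub>G\<^esub> b"])
      qed
      show "\<one>\<^bsub>add_monoid H\<^esub> \<in> j ` D n" using j0 by (auto intro!: image_eqI[of _ _ "\<zero>\<^bsub>G\<^esub>"])
      show "inv\<^bsub>add_monoid H\<^esub> x \<in> j ` D n" if xD: "x \<in> j ` D n" for x
      proof -
        obtain a where a: "a \<in> D n" "x = j a" using xD by blast
        have "j (\<ominus>\<^bsub>G\<^esub> a) \<oplus>\<^bsub>H\<^esub> j a = \<zero>\<^bsub>H\<^esub>"
          using additive_on_add[OF j, of "\<ominus>\<^bsub>G\<^esub> a" a] G.D_carrier[OF a(1)] j0 by (simp add: G.l_neg)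
        then have "\<ominus>\<^bsub>H\<^esub> x = j (\<ominus>\<^bsub>G\<^esub> a)"
          using H.minus_equality jc G.D_carrier[OF a(1)] a(2) by auto
        then show ?thesis using G.D_neg[OF a(1)] by (simp add: a_inv_def)
      qed
    qed
    show "additive_on (carrier H) H H (\<lambda>y. j (G.cmp (?i y) n))" for n
      by (rule additive_onI) (simp_all add: i i_add jc G.components_add additive_on_add[OF j])
    show "j (G.cmp (?i y) n) = y" if "y \<in> j ` D n" for y n
      using that ij G.D_carrier by (auto simp: G.components_homogeneous)
    show "j (G.cmp (?i y) m) = \<zero>\<^bsub>H\<^esub>" if "y \<in> j ` D n" "m \<noteq> n" for y n m
      using that ij G.D_carrier by (auto simp: G.components_homogeneous j0)
    fix y assume y: "y \<in> carrier H"
    show "j (G.cmp (?i y) n) \<in> j ` D n" for n using G.component_mem i y by blast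
    have eq: "{n. j (G.cmp (?i y) n) \<noteq> \<zero>\<^bsub>H\<^esub>} = {n. G.cmp (?i y) n \<noteq> \<zero>\<^bsub>G\<^esub>}"
      using jz i y by auto
    show "finite {n. j (G.cmp (?i y) n) \<noteq> \<zero>\<^bsub>H\<^esub>}"
      unfolding eq using G.finite_support i y by blast
    have "fin_sum H (\<lambda>n. j (G.cmp (?i y) n)) = j (fin_sum G (G.cmp (?i y)))"
      unfolding fin_sum_def eq
      using additive_on_finsum[OF G.abelian_group_axioms H j, of "{n. G.cmp (?i y) n \<noteq> \<zero>\<^bsub>G\<^esub>}" "G.cmp (?i y)"]
        G.finite_support[OF i(1)[OF y]] i y by simp
    then show "fin_sum H (\<lambda>n. j (G.cmp (?i y) n)) = y"
      using G.fin_sum_components i y by simp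
  qed (rule H)
qed

lemma transport_rmod_simps:
  "carrier (transport_rmod j M) = j ` carrier M" "\<zero>\<^bsub>transport_rmod j M\<^esub> = j \<zero>\<^bsub>M\<^esub>"
  "x \<oplus>\<^bsub>transport_rmod j M\<^esub> y = j (inv_into (carrier M) j x \<oplus>\<^bsub>M\<^esub> inv_into (carrier M) j y)"
  "ract (transport_rmod j M) x a = j (ract M (inv_into (carrier M) j x) a)"
  by (simp_all add: transport_rmod_def Let_def)

lemma right_module_transport:
  assumes "right_module R M" "inj_on j (carrier M)"
  shows "right_module R (transport_rmod j M)"
  by (rule right_module_transfer[OF assms]) (simp_all add: transport_rmod_simps assms(2))

lemma transport_gmod_simps:
  "carrier (transport_gmod j M) = j ` carrier M" "\<zero>\<^bsub>transport_gmod j M\<^esub> = j \<zero>\<^bsub>M\<^esub>"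
  "x \<oplus>\<^bsub>transport_gmod j M\<^esub> y = j (inv_into (carrier M) j x \<oplus>\<^bsub>M\<^esub> inv_into (carrier M) j y)"
  "ract (transport_gmod j M) x a = j (ract M (inv_into (carrier M) j x) a)"
  "grade (transport_gmod j M) n = j ` grade M n"
  by (simp_all add: transport_gmod_def rmod.extend_def transport_rmod_def Let_def)

lemma graded_module_transport:
  assumes M: "graded_module A \<A> M" and inj: "inj_on j (carrier M)"
  shows "graded_module A \<A> (transport_gmod j M)"
proof -
  interpret M: gmodule A \<A> M using M by (simp add: graded_module_iff_gmodule)
  let ?N = "transport_gmod j M"
  have N: "right_module A ?N"
    using M inj unfolding graded_module_def
    by (intro right_module_transfer[where M = M and j = j]) (simp_all add: transport_gmod_simps)
  then have g: "abelian_group ?N" by (simp add: right_module_def)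
  have "internal_direct_sum ?N UNIV (\<lambda>n. j ` grade M n)"
    by (rule internal_direct_sum_transport[OF M.direct_sum_axioms g])
      (auto simp: additive_on_def transport_gmod_simps inj bij_betw_def)
  moreover have "grade ?N = (\<lambda>n. j ` grade M n)" by (simp add: fun_eq_iff transport_gmod_simps)
  ultimately show ?thesis
    using N M.ract_grade M.D_carrier inj by (auto simp: graded_module_def transport_gmod_simps)
qed

section \<open>Graded algebras with a unit of degree one\<close>

locale graded_alg = ring A + A: direct_sum A \<A>
  for K :: "'k ring" and A :: "('k, 'a) module" (structure) and \<A> :: "int \<Rightarrow> 'a set" +
  assumes graded_algebra: "graded_algebra K A \<A>"
begin

lemma grade_mult: "x \<in> \<A> n \<Longrightarrow> y \<in> \<A> m \<Longrightarrow> x \<otimes> y \<in> \<A> (n + m)"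
  using graded_algebra by (simp add: graded_algebra_def)

lemma grade_smult: "k \<in> carrier K \<Longrightarrow> x \<in> \<A> n \<Longrightarrow> k \<odot>\<^bsub>A\<^esub> x \<in> \<A> n"
  using graded_algebra by (simp add: graded_algebra_def)

lemma smult_module: "module K A"
  using graded_algebra by (simp add: graded_algebra_def assoc_algebra_def)

lemma smult_mult:
  assumes "k \<in> carrier K" "x \<in> carrier A" "y \<in> carrier A"
  shows "(k \<odot>\<^bsub>A\<^esub> x) \<otimes> y = k \<odot>\<^bsub>A\<^esub> (x \<otimes> y)" "x \<otimes> (k \<odot>\<^bsub>A\<^esub> y) = k \<odot>\<^bsub>A\<^esub> (x \<otimes> y)"
  using graded_algebra assms by (simp_all add: graded_algebra_def assoc_algebra_def)

lemma additive_mult_left: "y \<in> carrier A \<Longrightarrow> additive_on (carrier A) A A (\<lambda>x. x \<otimes> y)"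
  by (rule additive_onI) (simp_all add: l_distr)

lemma additive_smult: "k \<in> carrier K \<Longrightarrow> additive_on (carrier A) A A (\<lambda>x. k \<odot>\<^bsub>A\<^esub> x)"
  using smult_module by (intro additive_onI) (simp_all add: module.smult_closed module.smult_r_distr)

lemma component_mult_left:
  assumes "x \<in> \<A> n" "y \<in> carrier A"
  shows "A.cmp (x \<otimes> y) m = x \<otimes> A.cmp y (m - n)"
proof (rule A.additive_eqI[OF abelian_group_axioms _ _ _ assms(2)])
  have x: "x \<in> carrier A" using assms A.D_carrier by blast
  show "additive_on (carrier A) A A (\<lambda>y. A.cmp (x \<otimes> y) m)"
    "additive_on (carrier A) A A (\<lambda>y. x \<otimes> A.cmp y (m - n))"
    by (rule additive_onI; simp add: x r_distr A.components_add)+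
  show "A.cmp (x \<otimes> z) m = x \<otimes> A.cmp z (m - n)" if "z \<in> \<A> k" for z k
    using grade_mult[OF assms(1) that] that x by (auto simp: A.components_homogeneous)
qed

lemma component_mult_right:
  assumes "x \<in> \<A> n" "y \<in> carrier A"
  shows "A.cmp (y \<otimes> x) m = A.cmp y (m - n) \<otimes> x"
proof (rule A.additive_eqI[OF abelian_group_axioms _ _ _ assms(2)])
  have x: "x \<in> carrier A" using assms A.D_carrier by blast
  show "additive_on (carrier A) A A (\<lambda>y. A.cmp (y \<otimes> x) m)"
    "additive_on (carrier A) A A (\<lambda>y. A.cmp y (m - n) \<otimes> x)"
    by (rule additive_onI; simp add: x l_distr A.components_add)+
  show "A.cmp (z \<otimes> x) m = A.cmp z (m - n) \<otimes> x" if "z \<in> \<A> k" for z k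
    using grade_mult[OF that assms(1)] that x by (auto simp: A.components_homogeneous)
qed

lemma component_smult:
  assumes "k \<in> carrier K" "x \<in> carrier A"
  shows "A.cmp (k \<odot>\<^bsub>A\<^esub> x) n = k \<odot>\<^bsub>A\<^esub> A.cmp x n"
proof (rule A.additive_eqI[OF abelian_group_axioms _ _ _ assms(2)])
  note s = additive_on_closed[OF additive_smult[OF assms(1)]] additive_on_add[OF additive_smult[OF assms(1)]]
  show "additive_on (carrier A) A A (\<lambda>x. A.cmp (k \<odot>\<^bsub>A\<^esub> x) n)"
    "additive_on (carrier A) A A (\<lambda>x. k \<odot>\<^bsub>A\<^esub> A.cmp x n)"
    by (rule additive_onI; simp add: s A.components_add)+
  have "k \<odot>\<^bsub>A\<^esub> \<zero> = \<zero>"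
    using additive_on_zero[OF abelian_group_axioms abelian_group_axioms additive_smult[OF assms(1)]] by simp
  then show "A.cmp (k \<odot>\<^bsub>A\<^esub> z) n = k \<odot>\<^bsub>A\<^esub> A.cmp z n" if "z \<in> \<A> m" for z m
    using grade_smult[OF assms(1) that] that by (auto simp: A.components_homogeneous)
qed

lemma component_mult:
  assumes "x \<in> carrier A" "y \<in> carrier A"
  shows "A.cmp (x \<otimes> y) n = (\<Oplus>i\<in>{i. A.cmp x i \<noteq> \<zero>}. A.cmp x i \<otimes> A.cmp y (n - i))"
proof -
  let ?S = "{i. A.cmp x i \<noteq> \<zero>}"
  have add: "additive_on (carrier A) A A (\<lambda>x. A.cmp (x \<otimes> y) n)"
    using assms by (intro additive_onI) (simp_all add: l_distr A.components_add)
  have "A.cmp (x \<otimes> y) n = A.cmp (finsum A (A.cmp x) ?S \<otimes> y) n"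
    using A.component_expansion[OF assms(1) A.finite_support] assms by simp
  also have "\<dots> = (\<Oplus>i\<in>?S. A.cmp (A.cmp x i \<otimes> y) n)"
    using A.finite_support assms
    by (intro additive_on_finsum[OF abelian_group_axioms abelian_group_axioms add]) auto
  also have "\<dots> = (\<Oplus>i\<in>?S. A.cmp x i \<otimes> A.cmp y (n - i))"
    using assms by (intro finsum_cong') (auto simp: component_mult_left[OF A.component_mem])
  finally show ?thesis .
qed

lemma eq_by_components:
  assumes "x \<in> carrier A" "y \<in> carrier A" "\<And>n. A.cmp x n = A.cmp y n"
  shows "x = y"
  using A.fin_sum_components[OF assms(1)] A.fin_sum_components[OF assms(2)] assms(3)
  by (metis ext)

text \<open>
  Let \<open>e\<close> be the component of degree zero of \<open>\<one>\<close>.  Comparing components of degree \<open>n\<close> in \<open>x \<otimes> \<one> = x\<close>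
  gives \<open>x \<otimes> e = x\<close> for \<open>x \<in> \<A> n\<close>, hence for all \<open>x\<close>, and \<open>x = \<one>\<close> yields \<open>e = \<one>\<close>.
\<close>

lemma one_degree_zero: "\<one> \<in> \<A> 0"
proof -
  let ?e = "A.cmp \<one> 0"
  have "x \<otimes> ?e = x" if "x \<in> carrier A" for x
  proof (rule A.additive_eqI[OF abelian_group_axioms _ _ _ that])
    show "additive_on (carrier A) A A (\<lambda>x. x \<otimes> ?e)" by (rule additive_mult_left) simp
    show "additive_on (carrier A) A A (\<lambda>x. x)" by (rule additive_onI) auto
    show "y \<otimes> ?e = y" if "y \<in> \<A> n" for y n
      using component_mult_left[OF that one_closed, of n] that A.D_carrier[OF that]
      by (simp add: A.components_homogeneous)
  qed
  from this[of \<one>] show ?thesis using A.component_mem[OF one_closed, of 0] by simp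
qed

text \<open>
  In degree zero the equation \<open>u \<otimes> inv u = \<one>\<close> says that the component of degree \<open>- n\<close> of \<open>inv u\<close> is
  already a right inverse of the unit \<open>u\<close>, which has only one.
\<close>

lemma homogeneous_inverse:
  assumes "u \<in> Units A" "u \<in> \<A> n"
  shows "inv u \<in> \<A> (- n)"
proof -
  let ?s = "A.cmp (inv u) (- n)"
  have u: "u \<in> carrier A" "inv u \<in> carrier A" "u \<otimes> inv u = \<one>" using assms by auto
  have "u \<otimes> ?s = A.cmp (u \<otimes> inv u) 0"
    using component_mult_left[OF assms(2) u(2), of 0] by simp
  also have "\<dots> = u \<otimes> inv u"
    using one_degree_zero u by (simp add: A.components_homogeneous)
  finally have "?s = inv u" using assms u Units_l_cancel[OF assms(1), of ?s "inv u"] by simp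
  then show ?thesis using A.component_mem[OF u(2), of "- n"] by simp
qed

end

lemma graded_alg_iff: "graded_alg K A \<A> \<longleftrightarrow> graded_algebra K A \<A>"
proof
  assume a: "graded_algebra K A \<A>"
  then interpret ring A by (simp add: graded_algebra_def assoc_algebra_def)
  show "graded_alg K A \<A>"
    by unfold_locales (use a in \<open>auto simp: graded_algebra_def\<close>)
qed (simp add: graded_alg_def graded_alg_axioms_def)

text \<open>
  Stated for structures that are merely closed under their operations, in order to apply to skew
  Laurent polynomials directly from their definition.
\<close>

lemma graded_algebra_iso_inverse:
  assumes iso: "graded_algebra_iso K A \<A> B \<B> \<phi>"
    and closed: "\<And>x y. x \<in> carrier A \<Longrightarrow> y \<in> carrier A \<Longrightarrow> x \<otimes>\<^bsub>A\<^esub> y \<in> carrier A"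
      "\<And>x y. x \<in> carrier A \<Longrightarrow> y \<in> carrier A \<Longrightarrow> x \<oplus>\<^bsub>A\<^esub> y \<in> carrier A"
      "\<one>\<^bsub>A\<^esub> \<in> carrier A"
      "\<And>k x. k \<in> carrier K \<Longrightarrow> x \<in> carrier A \<Longrightarrow> k \<odot>\<^bsub>A\<^esub> x \<in> carrier A"
    and grading: "\<And>n. \<A> n \<subseteq> carrier A"
  shows "graded_algebra_iso K B \<B> A \<A> (inv_into (carrier A) \<phi>)"
proof -
  let ?i = "inv_into (carrier A) \<phi>"
  have ring: "\<phi> \<in> ring_hom A B" and bij: "bij_betw \<phi> (carrier A) (carrier B)"
    and smult: "\<And>k x. k \<in> carrier K \<Longrightarrow> x \<in> carrier A \<Longrightarrow> \<phi> (k \<odot>\<^bsub>A\<^esub> x) = k \<odot>\<^bsub>B\<^esub> \<phi> x"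
    and deg: "\<And>n. \<phi> ` \<A> n = \<B> n"
    using iso by (auto simp: graded_algebra_iso_def algebra_iso_def ring_iso_def)
  note hom = ring_hom_mult[OF ring] ring_hom_add[OF ring] ring_hom_one[OF ring]
  have i: "?i y \<in> carrier A" "\<phi> (?i y) = y" if "y \<in> carrier B" for y
    using bij that by (auto simp: bij_betw_def inv_into_into f_inv_into_f)
  have i_eq: "?i y = x" if "x \<in> carrier A" "\<phi> x = y" for x y
    using bij that by (auto simp: bij_betw_def)
  have "?i \<in> ring_iso B A"
  proof (rule ring_iso_memI)
    show "bij_betw ?i (carrier B) (carrier A)" by (rule bij_betw_inv_into[OF bij])
    show "?i (y \<otimes>\<^bsub>B\<^esub> z) = ?i y \<otimes>\<^bsub>A\<^esub> ?i z" if "y \<in> carrier B" "z \<in> carrier B" for y z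
      using that i closed by (intro i_eq) (simp_all add: hom)
    show "?i (y \<oplus>\<^bsub>B\<^esub> z) = ?i y \<oplus>\<^bsub>A\<^esub> ?i z" if "y \<in> carrier B" "z \<in> carrier B" for y z
      using that i closed by (intro i_eq) (simp_all add: hom)
    show "?i \<one>\<^bsub>B\<^esub> = \<one>\<^bsub>A\<^esub>" using closed(3) by (rule i_eq) (simp add: hom)
  qed (rule i)
  moreover have "?i (k \<odot>\<^bsub>B\<^esub> y) = k \<odot>\<^bsub>A\<^esub> ?i y" if "k \<in> carrier K" "y \<in> carrier B" for k y
    using that i closed by (intro i_eq) (simp_all add: smult)
  moreover have "?i ` \<B> n = \<A> n" for n
  proof -
    have "?i ` \<phi> ` \<A> n = (\<lambda>x. x) ` \<A> n"
      unfolding image_image using i_eq grading by (intro image_cong) auto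
    then show ?thesis by (simp add: deg)
  qed
  ultimately show ?thesis by (simp add: graded_algebra_iso_def algebra_iso_def)
qed

text \<open>
  The ring \<open>R\<close> is the component of degree zero, with a product that agrees with the product of \<open>A\<close> only
  on \<open>\<A> 0\<close>.  This leaves room for a Zhang twist in the role of \<open>A\<close>: twisting changes the product as a
  function, but not on \<open>\<A> 0\<close>, so the twist is to be compared with the untwisted ring \<open>A\<^sub>0\<close>.
  The map \<open>\<gamma>\<close> is conjugation by \<open>t\<close> on \<open>\<A> 0\<close>, stated without inverses.
\<close>

locale unit_degree_one = graded_alg K A \<A>
  for K :: "'k ring" and A :: "('k, 'a) module" (structure) and \<A> :: "int \<Rightarrow> 'a set" +
  fixes t :: 'a and R :: "('k, 'a) module" and \<gamma> :: "'a \<Rightarrow> 'a"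
  assumes t_unit: "t \<in> Units A" and t_degree: "t \<in> \<A> 1"
    and R_simps [simp]: "carrier R = \<A> 0" "add R = add A" "\<zero>\<^bsub>R\<^esub> = \<zero>" "\<one>\<^bsub>R\<^esub> = \<one>" "smult R = smult A"
    and R_mult: "\<lbrakk>a \<in> \<A> 0; b \<in> \<A> 0\<rbrakk> \<Longrightarrow> a \<otimes>\<^bsub>R\<^esub> b = a \<otimes> b"
    and \<gamma>_closed [simp]: "a \<in> \<A> 0 \<Longrightarrow> \<gamma> a \<in> \<A> 0"
    and \<gamma>_comm: "a \<in> \<A> 0 \<Longrightarrow> \<gamma> a \<otimes> t = t \<otimes> a"
begin

lemma degree_zero_closed [simp]: "a \<in> \<A> 0 \<Longrightarrow> a \<in> carrier A"
  by (rule A.D_carrier)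

lemma t_closed [simp]: "t \<in> carrier A"
  using t_unit by blast

definition tp :: "int \<Rightarrow> 'a" where "tp n = t [^] n"

lemma tp_units_of: "tp n = t [^]\<^bsub>units_of A\<^esub> n"
proof -
  have p: "t [^] k \<in> Units A" for k :: nat
    by (induction k) (simp_all add: t_unit)
  have a: "tp n = t [^] n" by (rule tp_def)
  have b: "t [^]\<^bsub>units_of A\<^esub> k = t [^] k" for k :: nat by (rule units_of_pow[OF t_unit])
  have c: "inv\<^bsub>units_of A\<^esub> (t [^] k) = inv (t [^] k)" for k :: nat by (rule units_of_inv[OF p])
  show ?thesis
    unfolding a int_pow_def2 b c by (rule refl)
qed

lemma tp_0 [simp]: "tp 0 = \<one>"
  by (simp only: tp_def int_pow_def2, simp)

lemma tp_1 [simp]: "tp 1 = t"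
  unfolding tp_def int_pow_def2 by simp

lemma tp_unit: "tp n \<in> Units A"
proof -
  interpret U: group "units_of A" by (rule units_group)
  have "t \<in> carrier (units_of A)" using t_unit by (simp add: units_of_carrier)
  from U.int_pow_closed[OF this, of n] show ?thesis by (simp add: tp_units_of units_of_carrier)
qed

lemma tp_closed [simp]: "tp n \<in> carrier A"
  using tp_unit Units_closed by blast

lemma tp_add: "tp (n + m) = tp n \<otimes> tp m"
proof -
  interpret U: group "units_of A" by (rule units_group)
  have "t \<in> carrier (units_of A)" using t_unit by (simp add: units_of_carrier)
  from U.int_pow_mult[OF this, of n m]
  show ?thesis unfolding tp_units_of units_of_mult .
qed

lemma tp_inverse [simp]: "tp n \<otimes> tp (- n) = \<one>" "tp (- n) \<otimes> tp n = \<one>"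
  by (simp_all flip: tp_add)

lemma tp_cancel [simp]:
  "x \<in> carrier A \<Longrightarrow> x \<otimes> tp n \<otimes> tp (- n) = x" "x \<in> carrier A \<Longrightarrow> x \<otimes> tp (- n) \<otimes> tp n = x"
  "x \<in> carrier A \<Longrightarrow> tp n \<otimes> (tp (- n) \<otimes> x) = x" "x \<in> carrier A \<Longrightarrow> tp (- n) \<otimes> (tp n \<otimes> x) = x"
  by (simp_all add: m_assoc) (simp_all flip: m_assoc)

lemma tp_degree: "tp n \<in> \<A> n"
proof -
  have nat: "tp (int k) \<in> \<A> (int k)" for k
  proof (induction k)
    case 0
    then show ?case by (simp add: one_degree_zero)
  next
    case (Suc k)
    then show ?case using grade_mult[OF Suc t_degree] tp_add[of "int k" 1] by (simp add: add.commute)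
  qed
  show ?thesis
  proof (cases "0 \<le> n")
    case True
    then show ?thesis using nat[of "nat n"] by simp
  next
    case False
    have "inv (tp (- n)) = tp n"
      by (rule inv_unique'[symmetric]) simp_all
    moreover have "tp (- n) \<in> \<A> (- n)" using nat[of "nat (- n)"] False by simp
    ultimately show ?thesis using homogeneous_inverse[OF tp_unit, of "- n" "- n"] by simp
  qed
qed

lemma grade_tp: "x \<in> \<A> n \<Longrightarrow> x \<otimes> tp m \<in> \<A> (n + m)" "x \<in> \<A> n \<Longrightarrow> tp m \<otimes> x \<in> \<A> (m + n)"
  using grade_mult tp_degree by blast+

lemma zero_tp [simp]: "x \<in> carrier A \<Longrightarrow> x \<otimes> tp n = \<zero> \<longleftrightarrow> x = \<zero>"
  using tp_cancel(1)[of x n] by fastforce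

lemma \<A>0_closed [simp]: "a \<in> \<A> 0 \<Longrightarrow> b \<in> \<A> 0 \<Longrightarrow> a \<otimes> b \<in> \<A> 0"
  using grade_mult[of a 0 b 0] by simp

lemma ring_R: "ring R"
proof (intro ringI monoidI abelian_groupI; simp add: R_mult one_degree_zero A.D_carrier A.D_add)
  show "\<exists>y\<in>\<A> 0. y \<oplus> x = \<zero>" if "x \<in> \<A> 0" for x
    using A.D_neg[OF that] l_neg[OF A.D_carrier[OF that]] by blast
qed (auto simp: A.D_carrier a_ac m_assoc l_distr r_distr)

lemma finsum_R:
  assumes "c \<in> S \<rightarrow> \<A> 0"
  shows "finsum R c S = finsum A c S"
proof -
  interpret R: ring R by (rule ring_R)
  show ?thesis
    using assms
  proof (induction S rule: infinite_finite_induct)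
    case (insert i S)
    then have "c \<in> S \<rightarrow> carrier R" "c \<in> S \<rightarrow> carrier A" "c i \<in> carrier R" "c i \<in> carrier A"
      using A.D_carrier by auto
    with insert show ?case by simp
  qed simp_all
qed

lemma \<gamma>_eq: "a \<in> \<A> 0 \<Longrightarrow> \<gamma> a = t \<otimes> a \<otimes> tp (- 1)"
  using tp_cancel(1)[of "\<gamma> a" 1] \<gamma>_comm[of a] A.D_carrier[of "\<gamma> a" 0] by simp

lemma \<gamma>_inverse:
  assumes "a \<in> \<A> 0"
  shows "tp (- 1) \<otimes> a \<otimes> t \<in> \<A> 0" "\<gamma> (tp (- 1) \<otimes> a \<otimes> t) = a" "tp (- 1) \<otimes> \<gamma> a \<otimes> t = a"
proof -
  have a: "a \<in> carrier A" "t \<in> carrier A" using assms A.D_carrier t_unit by auto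
  show 1: "tp (- 1) \<otimes> a \<otimes> t \<in> \<A> 0"
    using grade_tp(1)[OF grade_tp(2)[OF assms, of "- 1"], of 1] by simp
  show "\<gamma> (tp (- 1) \<otimes> a \<otimes> t) = a"
    unfolding \<gamma>_eq[OF 1] using a tp_cancel(3)[of "a" 1] tp_inverse[of 1] by (simp add: m_assoc)
  show "tp (- 1) \<otimes> \<gamma> a \<otimes> t = a"
    using a \<gamma>_comm[OF assms] tp_cancel(4)[of a 1] A.D_carrier[OF \<gamma>_closed[OF assms]] by (simp add: m_assoc)
qed

lemma \<gamma>_bij: "bij_betw \<gamma> (\<A> 0) (\<A> 0)"
  by (rule bij_betw_byWitness[where f' = "\<lambda>a. tp (- 1) \<otimes> a \<otimes> t"]) (auto simp: \<gamma>_inverse)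

lemma \<gamma>_ring_iso: "\<gamma> \<in> ring_iso R R"
proof -
  have "\<gamma> (a \<otimes> b) = \<gamma> a \<otimes> \<gamma> b" if "a \<in> \<A> 0" "b \<in> \<A> 0" for a b
  proof -
    have c: "a \<in> carrier A" "b \<in> carrier A" "t \<in> carrier A" using that A.D_carrier t_unit by auto
    have "\<gamma> a \<otimes> \<gamma> b = (\<gamma> a \<otimes> t) \<otimes> (b \<otimes> tp (- 1))"
      using c A.D_carrier[OF \<gamma>_closed[OF that(1)]] by (simp add: \<gamma>_eq[OF that(2)] m_assoc)
    also have "\<dots> = \<gamma> (a \<otimes> b)"
      using c that by (simp add: \<gamma>_comm \<gamma>_eq[of "a \<otimes> b"] m_assoc)
    finally show ?thesis by simp
  qed
  moreover have "\<gamma> (a \<oplus> b) = \<gamma> a \<oplus> \<gamma> b" if "a \<in> \<A> 0" "b \<in> \<A> 0" for a b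
    using that A.D_carrier A.D_add t_unit by (simp add: \<gamma>_eq r_distr l_distr)
  moreover have "\<gamma> \<one> = \<one>"
    using \<gamma>_eq[OF one_degree_zero] t_unit tp_inverse(1)[of 1] by simp
  ultimately show ?thesis
    using \<gamma>_bij by (auto simp: ring_iso_def ring_hom_def R_mult)
qed

lemma \<gamma>_algebra_iso: "algebra_iso K R R \<gamma>"
  using \<gamma>_ring_iso A.D_carrier t_unit
  by (auto simp: algebra_iso_def \<gamma>_eq grade_smult smult_mult)

text \<open>
  Conjugation by \<open>t\<^sup>n\<close> is the \<open>n\<close>-th power of conjugation by \<open>t\<close>, also for negative \<open>n\<close>, because the
  inverse of \<open>\<gamma>\<close> is conjugation by \<open>t\<^sup>-\<^sup>1\<close>.
\<close>

lemma aut_power_\<gamma>: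
  assumes "a \<in> \<A> 0"
  shows "aut_power (carrier R) \<gamma> n a = tp n \<otimes> a \<otimes> tp (- n)"
proof -
  have a: "a \<in> carrier A" using assms A.D_carrier by blast
  have conj: "tp n \<otimes> a \<otimes> tp (- n) \<in> \<A> 0" for n
    using grade_tp(1)[OF grade_tp(2)[OF assms, of n], of "- n"] by simp
  have step: "tp k \<otimes> (tp n \<otimes> a \<otimes> tp (- n)) \<otimes> tp (- k) = tp (k + n) \<otimes> a \<otimes> tp (- (k + n))" for k n
    using a tp_add[of "- n" "- k"] by (simp add: tp_add m_assoc add.commute)
  have pos: "(\<gamma> ^^ k) a = tp (int k) \<otimes> a \<otimes> tp (- int k)" for k
  proof (induction k)
    case (Suc k)
    then show ?case using conj[of "int k"] step[of 1 "int k"] by (simp add: \<gamma>_eq)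
  qed (use a in simp)
  have i: "inv_into (\<A> 0) \<gamma> b = tp (- 1) \<otimes> b \<otimes> tp 1" if "b \<in> \<A> 0" for b
    using \<gamma>_inverse[OF that] \<gamma>_bij by (metis bij_betw_imp_inj_on inv_into_f_eq tp_1)
  have neg: "(inv_into (\<A> 0) \<gamma> ^^ k) a = tp (- int k) \<otimes> a \<otimes> tp (int k)" for k
  proof (induction k)
    case (Suc k)
    then show ?case using conj[of "- int k"] step[of "- 1" "- int k"] by (simp add: i add.commute)
  qed (use a in simp)
  show ?thesis
    using pos[of "nat n"] neg[of "nat (- n)"] by (simp add: aut_power_def)
qed

text \<open>
  The nontrivial inclusion is \<open>x = (x t\<^sup>-\<^sup>m) t\<^sup>m\<close> for \<open>x\<close> of degree \<open>n + m\<close>.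
\<close>

theorem strongly_graded: "strongly_graded A \<A>"
  unfolding strongly_graded_def
proof (intro allI equalityI subsetI)
  fix n m x assume "x \<in> \<A> n \<cdot> \<A> m"
  then show "x \<in> \<A> (n + m)"
    by (induction rule: ideal_prod.induct) (auto simp: grade_mult A.D_add)
next
  fix n m x assume x: "x \<in> \<A> (n + m)"
  have "x \<otimes> tp (- m) \<otimes> tp m \<in> \<A> n \<cdot> \<A> m"
    using grade_tp(1)[OF x, of "- m"] tp_degree by (intro ideal_prod.prod) simp_all
  then show "x \<in> \<A> n \<cdot> \<A> m" using A.D_carrier[OF x] by simp
qed

subsection \<open>Skew Laurent polynomials\<close>

lemma skew_laurent_carrier:
  "f \<in> carrier (skew_laurent R \<gamma>) \<longleftrightarrow> (\<forall>n. f n \<in> \<A> 0) \<and> finite {n. f n \<noteq> \<zero>}"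
  by (simp add: skew_laurent_def)

lemma laurent_family:
  assumes "f \<in> carrier (skew_laurent R \<gamma>)"
  shows "(\<lambda>n. f n \<otimes> tp n) \<in> fin_families A UNIV \<A>"
  using assms A.D_carrier grade_tp(1)[of _ 0]
  by (auto simp: skew_laurent_carrier fin_families_def)

lemma laurent_eval_eq:
  assumes "f \<in> carrier (skew_laurent R \<gamma>)"
  shows "laurent_eval A t f = fin_sum A (\<lambda>n. f n \<otimes> tp n)"
proof -
  have "f n \<in> carrier A" for n using assms A.D_carrier by (auto simp: skew_laurent_carrier)
  then show ?thesis by (simp add: laurent_eval_def fin_sum_def tp_def[symmetric])
qed

lemma component_laurent_eval:
  assumes "f \<in> carrier (skew_laurent R \<gamma>)"
  shows "A.cmp (laurent_eval A t f) n = f n \<otimes> tp n"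
  using A.components_fin_sum[OF laurent_family[OF assms]] laurent_eval_eq[OF assms] by simp

text \<open>
  The coefficient of \<open>t\<^sup>n\<close> is recovered from an element \<open>x\<close> of \<open>A\<close> as \<open>x\<^sub>n t\<^sup>-\<^sup>n\<close>.
\<close>

lemma laurent_eval_bij: "bij_betw (laurent_eval A t) (carrier (skew_laurent R \<gamma>)) (carrier A)"
proof (rule bij_betw_byWitness[where f' = "\<lambda>x n. A.cmp x n \<otimes> tp (- n)"])
  let ?g = "\<lambda>x n. A.cmp x n \<otimes> tp (- n)"
  show "\<forall>f\<in>carrier (skew_laurent R \<gamma>). ?g (laurent_eval A t f) = f"
    using A.D_carrier by (auto simp: component_laurent_eval skew_laurent_carrier fun_eq_iff)
  have g: "?g x \<in> carrier (skew_laurent R \<gamma>)" if "x \<in> carrier A" for x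
    unfolding skew_laurent_carrier
    using that A.finite_support[OF that] grade_tp(1)[OF A.component_mem[OF that]] by (auto simp: fun_eq_iff) (metis add.right_inverse)
  then show "?g ` carrier A \<subseteq> carrier (skew_laurent R \<gamma>)" by blast
  show "\<forall>x\<in>carrier A. laurent_eval A t (?g x) = x"
    using A.fin_sum_components by (simp add: laurent_eval_eq[OF g])
  show "laurent_eval A t ` carrier (skew_laurent R \<gamma>) \<subseteq> carrier A"
  proof (rule image_subsetI)
    fix f assume f: "f \<in> carrier (skew_laurent R \<gamma>)"
    then have "f n \<otimes> tp n \<in> carrier A" for n using A.D_carrier by (simp add: skew_laurent_carrier)
    then show "laurent_eval A t f \<in> carrier A" by (auto simp: laurent_eval_eq[OF f] fin_sum_def)
  qed
qed

lemma laurent_eval_closed [simp]: "f \<in> carrier (skew_laurent R \<gamma>) \<Longrightarrow> laurent_eval A t f \<in> carrier A"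
  using laurent_eval_bij bij_betwE by blast

text \<open>
  The terms \<open>f\<^sub>n t\<^sup>n\<close> are the homogeneous components of the value of \<open>f\<close>.  To evaluate an expression in
  skew Laurent polynomials it is therefore enough to determine the components of the expected value,
  and finiteness of the support comes for free.
\<close>

lemma laurent_eval_eqI:
  assumes "x \<in> carrier A" "\<And>n. f n \<in> \<A> 0" "\<And>n. A.cmp x n = f n \<otimes> tp n"
  shows "f \<in> carrier (skew_laurent R \<gamma>) \<and> laurent_eval A t f = x"
proof -
  have "{n. A.cmp x n \<noteq> \<zero>} = {n. f n \<noteq> \<zero>}" using assms(2,3) A.D_carrier by simp
  then have f: "f \<in> carrier (skew_laurent R \<gamma>)"
    using assms(2) A.finite_support[OF assms(1)] by (simp add: skew_laurent_carrier)
  moreover have "laurent_eval A t f = x"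
    by (rule eq_by_components) (use f assms in \<open>simp_all add: component_laurent_eval\<close>)
  ultimately show ?thesis by simp
qed

text \<open>
  In degree \<open>n\<close> both sides are sums of the terms
  \<open>f\<^sub>i t\<^sup>i g\<^sub>n\<^sub>-\<^sub>i t\<^sup>n\<^sup>-\<^sup>i = f\<^sub>i (t\<^sup>i g\<^sub>n\<^sub>-\<^sub>i t\<^sup>-\<^sup>i) t\<^sup>n\<close>.
\<close>

lemma laurent_eval_mult:
  assumes f: "f \<in> carrier (skew_laurent R \<gamma>)" and g: "g \<in> carrier (skew_laurent R \<gamma>)"
  shows "f \<otimes>\<^bsub>skew_laurent R \<gamma>\<^esub> g \<in> carrier (skew_laurent R \<gamma>) \<and>
    laurent_eval A t (f \<otimes>\<^bsub>skew_laurent R \<gamma>\<^esub> g) = laurent_eval A t f \<otimes> laurent_eval A t g"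
proof -
  let ?E = "laurent_eval A t"
  have fA: "f i \<in> \<A> 0" "f i \<in> carrier A" and gA: "g i \<in> \<A> 0" "g i \<in> carrier A" for i
    using f g A.D_carrier by (auto simp: skew_laurent_carrier)
  have conj: "tp i \<otimes> g j \<otimes> tp (- i) \<in> \<A> 0" for i j
    using grade_tp(1)[OF grade_tp(2)[OF gA(1)[of j], of i], of "- i"] by simp
  let ?S = "{i. f i \<noteq> \<zero>}"
  let ?c = "\<lambda>n i. f i \<otimes> (tp i \<otimes> g (n - i) \<otimes> tp (- i))"
  have c: "?c n i \<in> \<A> 0" "?c n i \<in> carrier A" for n i
    using fA conj A.D_carrier by auto
  have prod: "(f \<otimes>\<^bsub>skew_laurent R \<gamma>\<^esub> g) n = (\<Oplus>i\<in>?S. ?c n i)" for n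
  proof -
    have "(f \<otimes>\<^bsub>skew_laurent R \<gamma>\<^esub> g) n = (\<Oplus>\<^bsub>R\<^esub>i\<in>?S. ?c n i)"
      using fA conj aut_power_\<gamma>[OF gA(1)] by (simp add: skew_laurent_def R_mult)
    also have "\<dots> = (\<Oplus>i\<in>?S. ?c n i)" using c by (intro finsum_R) auto
    finally show ?thesis .
  qed
  have fin: "finite ?S" using f by (simp add: skew_laurent_carrier)
  show ?thesis
  proof (rule laurent_eval_eqI)
    show "?E f \<otimes> ?E g \<in> carrier A" using f g by simp
    interpret R: ring R by (rule ring_R)
    show "(f \<otimes>\<^bsub>skew_laurent R \<gamma>\<^esub> g) n \<in> \<A> 0" for n
      using R.finsum_closed[of "?c n" ?S] c by (simp add: prod finsum_R)
    fix n
    have "A.cmp (?E f \<otimes> ?E g) n = (\<Oplus>i\<in>?S. (f i \<otimes> tp i) \<otimes> (g (n - i) \<otimes> tp (n - i)))"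
      using f g fA by (simp add: component_mult component_laurent_eval)
    also have "\<dots> = (\<Oplus>i\<in>?S. ?c n i \<otimes> tp n)"
    proof (rule finsum_cong')
      show "(f i \<otimes> tp i) \<otimes> (g (n - i) \<otimes> tp (n - i)) = ?c n i \<otimes> tp n" for i
        using fA gA tp_add[of "- i" n] by (simp add: m_assoc)
    qed (use c in auto)
    also have "\<dots> = (f \<otimes>\<^bsub>skew_laurent R \<gamma>\<^esub> g) n \<otimes> tp n"
      unfolding prod using c fin by (subst finsum_ldistr) auto
    finally show "A.cmp (?E f \<otimes> ?E g) n = (f \<otimes>\<^bsub>skew_laurent R \<gamma>\<^esub> g) n \<otimes> tp n" .
  qed
qed

lemma laurent_eval_add:
  assumes f: "f \<in> carrier (skew_laurent R \<gamma>)" and g: "g \<in> carrier (skew_laurent R \<gamma>)"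
  shows "f \<oplus>\<^bsub>skew_laurent R \<gamma>\<^esub> g \<in> carrier (skew_laurent R \<gamma>) \<and>
    laurent_eval A t (f \<oplus>\<^bsub>skew_laurent R \<gamma>\<^esub> g) = laurent_eval A t f \<oplus> laurent_eval A t g"
proof (rule laurent_eval_eqI)
  have fg: "f n \<in> \<A> 0" "g n \<in> \<A> 0" for n using f g by (auto simp: skew_laurent_carrier)
  show "laurent_eval A t f \<oplus> laurent_eval A t g \<in> carrier A" using f g by simp
  show "(f \<oplus>\<^bsub>skew_laurent R \<gamma>\<^esub> g) n \<in> \<A> 0" for n using fg by (simp add: skew_laurent_def A.D_add)
  show "A.cmp (laurent_eval A t f \<oplus> laurent_eval A t g) n = (f \<oplus>\<^bsub>skew_laurent R \<gamma>\<^esub> g) n \<otimes> tp n" for n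
    using f g fg[THEN A.D_carrier]
    by (simp add: A.components_add component_laurent_eval skew_laurent_def l_distr)
qed

lemma laurent_eval_one:
  "\<one>\<^bsub>skew_laurent R \<gamma>\<^esub> \<in> carrier (skew_laurent R \<gamma>) \<and>
    laurent_eval A t \<one>\<^bsub>skew_laurent R \<gamma>\<^esub> = \<one>"
proof (rule laurent_eval_eqI)
  show "\<one>\<^bsub>skew_laurent R \<gamma>\<^esub> n \<in> \<A> 0" for n by (simp add: skew_laurent_def one_degree_zero)
  show "A.cmp \<one> n = \<one>\<^bsub>skew_laurent R \<gamma>\<^esub> n \<otimes> tp n" for n
    by (simp add: A.components_homogeneous[OF one_degree_zero] skew_laurent_def)
qed simp

lemma laurent_eval_smult:
  assumes k: "k \<in> carrier K" and f: "f \<in> carrier (skew_laurent R \<gamma>)"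
  shows "k \<odot>\<^bsub>skew_laurent R \<gamma>\<^esub> f \<in> carrier (skew_laurent R \<gamma>) \<and>
    laurent_eval A t (k \<odot>\<^bsub>skew_laurent R \<gamma>\<^esub> f) = k \<odot>\<^bsub>A\<^esub> laurent_eval A t f"
proof (rule laurent_eval_eqI)
  have fn: "f n \<in> \<A> 0" for n using f by (auto simp: skew_laurent_carrier)
  show "k \<odot>\<^bsub>A\<^esub> laurent_eval A t f \<in> carrier A"
    using additive_on_closed[OF additive_smult[OF k]] f by simp
  show "(k \<odot>\<^bsub>skew_laurent R \<gamma>\<^esub> f) n \<in> \<A> 0" for n
    using fn k by (simp add: skew_laurent_def grade_smult)
  show "A.cmp (k \<odot>\<^bsub>A\<^esub> laurent_eval A t f) n = (k \<odot>\<^bsub>skew_laurent R \<gamma>\<^esub> f) n \<otimes> tp n" for n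
    using f k fn[THEN A.D_carrier]
    by (simp add: component_smult component_laurent_eval skew_laurent_def smult_mult)
qed

lemma laurent_eval_grading: "laurent_eval A t ` skew_laurent_grading R n = \<A> n"
proof (intro equalityI subsetI)
  fix y assume "y \<in> laurent_eval A t ` skew_laurent_grading R n"
  then obtain f where f: "f n \<in> \<A> 0" "\<And>m. m \<noteq> n \<Longrightarrow> f m = \<zero>" "y = laurent_eval A t f"
    by (auto simp: skew_laurent_grading_def)
  have yn: "f n \<otimes> tp n \<in> \<A> n" using grade_tp(1)[OF f(1), of n] by simp
  have "laurent_eval A t f = f n \<otimes> tp n"
  proof (rule conjunct2[OF laurent_eval_eqI])
    show "f n \<otimes> tp n \<in> carrier A" using yn A.D_carrier by blast
    show "f m \<in> \<A> 0" for m using f by (cases "m = n") auto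
    show "A.cmp (f n \<otimes> tp n) m = f m \<otimes> tp m" for m
      using f by (cases "m = n") (auto simp: A.components_homogeneous[OF yn])
  qed
  then show "y \<in> \<A> n" using yn f by simp
next
  fix y assume y: "y \<in> \<A> n"
  let ?f = "\<lambda>m. if m = n then y \<otimes> tp (- n) else \<zero>"
  have y0: "y \<otimes> tp (- n) \<in> \<A> 0" using grade_tp(1)[OF y, of "- n"] by simp
  have "laurent_eval A t ?f = y"
    by (rule conjunct2[OF laurent_eval_eqI])
      (use y y0 A.D_carrier[OF y] in \<open>auto simp: A.components_homogeneous[OF y]\<close>)
  moreover have "?f \<in> skew_laurent_grading R n" using y0 by (simp add: skew_laurent_grading_def)
  ultimately show "y \<in> laurent_eval A t ` skew_laurent_grading R n" by (metis image_eqI)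
qed

theorem laurent_iso:
  "graded_algebra_iso K (skew_laurent R \<gamma>) (skew_laurent_grading R) A \<A> (laurent_eval A t)"
proof -
  have "laurent_eval A t \<in> ring_iso (skew_laurent R \<gamma>) A"
    by (rule ring_iso_memI)
      (simp_all add: laurent_eval_bij laurent_eval_mult laurent_eval_add laurent_eval_one)
  then show ?thesis
    unfolding graded_algebra_iso_def algebra_iso_def
    by (simp add: laurent_eval_smult laurent_eval_grading)
qed

lemma laurent_grading_closed: "skew_laurent_grading R n \<subseteq> carrier (skew_laurent R \<gamma>)"
proof
  fix f assume f: "f \<in> skew_laurent_grading R n"
  have "f m \<in> \<A> 0" for m using f by (cases "m = n") (auto simp: skew_laurent_grading_def)
  moreover have "finite {m. f m \<noteq> \<zero>}"
    by (rule finite_subset[of _ "{n}"]) (use f in \<open>auto simp: skew_laurent_grading_def\<close>)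
  ultimately show "f \<in> carrier (skew_laurent R \<gamma>)" by (simp add: skew_laurent_carrier)
qed

theorem laurent_iso_inverse:
  "graded_algebra_iso K A \<A> (skew_laurent R \<gamma>) (skew_laurent_grading R)
     (inv_into (carrier (skew_laurent R \<gamma>)) (laurent_eval A t))"
  by (rule graded_algebra_iso_inverse[OF laurent_iso])
    (simp_all add: laurent_eval_mult laurent_eval_add laurent_eval_one laurent_eval_smult
      laurent_grading_closed)

end

section \<open>Tensoring with the component of degree one\<close>

lemma (in abelian_group) add_minus_minus:
  assumes "x \<in> carrier G" "y \<in> carrier G"
  shows "x \<oplus> y \<ominus> x \<ominus> y = \<zero>"
proof -
  have "x \<oplus> y \<ominus> x \<ominus> y = (x \<oplus> y) \<oplus> \<ominus> (x \<oplus> y)"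
    using assms by (simp add: minus_eq minus_add a_assoc)
  then show ?thesis using assms by (simp add: r_neg)
qed

locale tensor_unit = unit_degree_one K A \<A> t R \<gamma> + N: rmodule R N
  for K :: "'k ring" and A :: "('k, 'a) module" (structure) and \<A> :: "int \<Rightarrow> 'a set"
    and t :: 'a and R :: "('k, 'a) module" and \<gamma> :: "'a \<Rightarrow> 'a" and N :: "('a, 'm) rmod"
begin

abbreviation B :: "('a, 'a, 'a) bimod" where "B \<equiv> component_bimod A \<A> 1"

abbreviation F :: "('m \<times> 'a \<Rightarrow>\<^sub>0 int) monoid" where "F \<equiv> free_Abelian_group (carrier N \<times> \<A> 1)"

abbreviation T :: "('m \<times> 'a \<Rightarrow>\<^sub>0 int) set" where "T \<equiv> tensor_subgroup R N B"

lemma B_simps [simp]: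
  "carrier B = \<A> 1" "add B = add A" "ract B = monoid.mult A" "lact B = monoid.mult A"
  by (simp_all add: component_bimod_def)

lemma untwist [simp]: "b \<in> \<A> 1 \<Longrightarrow> b \<otimes> tp (- 1) \<in> \<A> 0"
  using grade_tp(1)[of b 1 "- 1"] by simp

text \<open>
  Every tensor has the form \<open>x \<otimes> t\<close> because \<open>x \<otimes> b = x (b t\<^sup>-\<^sup>1) \<otimes> t\<close>.  The homomorphism below, defined on
  the free abelian group that presents the tensor product, computes the element \<open>x\<close>.
\<close>

definition eval :: "('m \<times> 'a \<Rightarrow>\<^sub>0 int) \<Rightarrow> 'm" where
  "eval = (SOME h. h \<in> hom F (add_monoid N) \<and>
     (\<forall>x\<in>carrier N. \<forall>b\<in>\<A> 1. h (frag_of (x, b)) = ract N x (b \<otimes> tp (- 1))))"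

lemma eval_hom: "eval \<in> hom F (add_monoid N)"
  and eval_of [simp]: "\<lbrakk>x \<in> carrier N; b \<in> \<A> 1\<rbrakk> \<Longrightarrow> eval (frag_of (x, b)) = ract N x (b \<otimes> tp (- 1))"
proof -
  have im: "(\<lambda>(x, b). ract N x (b \<otimes> tp (- 1))) ` (carrier N \<times> \<A> 1) \<subseteq> carrier (add_monoid N)"
    by auto
  obtain h where "h \<in> hom F (add_monoid N)"
    "\<And>p. p \<in> carrier N \<times> \<A> 1 \<Longrightarrow> h (frag_of p) = (\<lambda>(x, b). ract N x (b \<otimes> tp (- 1))) p"
    using comm_group.free_Abelian_group_universal[OF N.M.a_comm_group im] by metis
  then have "\<exists>h. h \<in> hom F (add_monoid N) \<and>
     (\<forall>x\<in>carrier N. \<forall>b\<in>\<A> 1. h (frag_of (x, b)) = ract N x (b \<otimes> tp (- 1)))"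
    by auto
  from someI_ex[OF this]
  show "eval \<in> hom F (add_monoid N)"
    "\<lbrakk>x \<in> carrier N; b \<in> \<A> 1\<rbrakk> \<Longrightarrow> eval (frag_of (x, b)) = ract N x (b \<otimes> tp (- 1))"
    unfolding eval_def by blast+
qed

lemma eval_closed [simp]: "c \<in> carrier F \<Longrightarrow> eval c \<in> carrier N"
  using eval_hom hom_in_carrier by fastforce

lemma F_diff [simp]: "c \<in> carrier F \<Longrightarrow> d \<in> carrier F \<Longrightarrow> c - d \<in> carrier F"
  and F_add [simp]: "c \<in> carrier F \<Longrightarrow> d \<in> carrier F \<Longrightarrow> c + d \<in> carrier F"
  and F_minus [simp]: "c \<in> carrier F \<Longrightarrow> - c \<in> carrier F"
  and F_of [simp]: "frag_of (x, b) \<in> carrier F \<longleftrightarrow> x \<in> carrier N \<and> b \<in> \<A> 1"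
  using keys_diff[of c d] keys_add[of c d] by auto

declare carrier_free_Abelian_group_iff [simp del]

lemma eval_add: "c \<in> carrier F \<Longrightarrow> d \<in> carrier F \<Longrightarrow> eval (c + d) = eval c \<oplus>\<^bsub>N\<^esub> eval d"
  using hom_mult[OF eval_hom] by simp

lemma eval_0: "eval 0 = \<zero>\<^bsub>N\<^esub>"
  using hom_one[OF eval_hom] N.M.a_group by simp

lemma eval_diff:
  assumes "c \<in> carrier F" "d \<in> carrier F"
  shows "eval (c - d) = eval c \<ominus>\<^bsub>N\<^esub> eval d"
proof -
  have "eval (c - d) \<oplus>\<^bsub>N\<^esub> eval d = eval c"
    using eval_add[of "c - d" d] assms by simp
  then show ?thesis
    using assms by (simp add: N.M.minus_eq N.M.add.inv_solve_right)
qed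

lemma F_induct [consumes 1, case_names zero diff of]:
  assumes "c \<in> carrier F" "P 0"
    "\<And>c d. \<lbrakk>c \<in> carrier F; d \<in> carrier F; P c; P d\<rbrakk> \<Longrightarrow> P (c - d)"
    "\<And>x b. \<lbrakk>x \<in> carrier N; b \<in> \<A> 1\<rbrakk> \<Longrightarrow> P (frag_of (x, b))"
  shows "P c"
  using assms by (intro free_Abelian_group_induct[of c "carrier N \<times> \<A> 1" P])
    (auto simp: carrier_free_Abelian_group_iff)

lemma relations_closed: "tensor_relations R N B \<subseteq> carrier F"
proof -
  have "a \<otimes> b \<in> \<A> 1" if "a \<in> \<A> 0" "b \<in> \<A> 1" for a b
    using grade_mult[OF that] by simp
  then show ?thesis unfolding tensor_relations_def by (auto intro!: F_diff simp: A.D_add)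
qed

lemma subgroup_T: "subgroup T F"
  unfolding tensor_subgroup_def B_simps
  using group.generate_is_subgroup[OF group_free_Abelian_group relations_closed] by simp

lemma T_closed: "c \<in> T \<Longrightarrow> c \<in> carrier F"
  using subgroup.mem_carrier[OF subgroup_T] .

lemma T_add: "c \<in> T \<Longrightarrow> d \<in> T \<Longrightarrow> c + d \<in> T"
  using subgroup.m_closed[OF subgroup_T] by fastforce

lemma T_minus: "c \<in> T \<Longrightarrow> - c \<in> T"
  using subgroup.m_inv_closed[OF subgroup_T] T_closed
  by (fastforce simp: carrier_free_Abelian_group_iff)

lemma T_diff: "c \<in> T \<Longrightarrow> d \<in> T \<Longrightarrow> c - d \<in> T"
  using T_add[OF _ T_minus, of c d] by simp

lemma T_relation: "c \<in> tensor_relations R N B \<Longrightarrow> c \<in> T"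
  unfolding tensor_subgroup_def by (rule generate.incl)

lemma T_add_left:
  "\<lbrakk>x \<in> carrier N; y \<in> carrier N; b \<in> \<A> 1\<rbrakk> \<Longrightarrow>
    frag_of (x \<oplus>\<^bsub>N\<^esub> y, b) - frag_of (x, b) - frag_of (y, b) \<in> T"
  by (intro T_relation) (auto simp: tensor_relations_def)

lemma T_balanced:
  "\<lbrakk>x \<in> carrier N; a \<in> \<A> 0; b \<in> \<A> 1\<rbrakk> \<Longrightarrow> frag_of (ract N x a, b) - frag_of (x, a \<otimes> b) \<in> T"
  by (intro T_relation) (auto simp: tensor_relations_def)

lemma t_in [simp]: "t \<in> \<A> 1" by (rule t_degree)

lemma eval_relation:
  assumes "c \<in> tensor_relations R N B"
  shows "eval c = \<zero>\<^bsub>N\<^esub>"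
proof -
  have ab: "a \<otimes> b \<in> \<A> 1" if "a \<in> \<A> 0" "b \<in> \<A> 1" for a b
    using grade_mult[OF that] by simp
  consider
    (left) x y b where "c = frag_of (x \<oplus>\<^bsub>N\<^esub> y, b) - frag_of (x, b) - frag_of (y, b)"
      "x \<in> carrier N" "y \<in> carrier N" "b \<in> \<A> 1"
  | (right) x b b' where "c = frag_of (x, b \<oplus> b') - frag_of (x, b) - frag_of (x, b')"
      "x \<in> carrier N" "b \<in> \<A> 1" "b' \<in> \<A> 1"
  | (balanced) x a b where "c = frag_of (ract N x a, b) - frag_of (x, a \<otimes> b)"
      "x \<in> carrier N" "a \<in> \<A> 0" "b \<in> \<A> 1"
    using assms unfolding tensor_relations_def by auto
  then show ?thesis
  proof cases
    case left
    then show ?thesis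
      by (simp add: eval_diff N.ract_add_left N.M.add_minus_minus)
  next
    case right
    have "ract N x ((b \<oplus> b') \<otimes> tp (- 1)) =
        ract N x (b \<otimes> tp (- 1)) \<oplus>\<^bsub>N\<^esub> ract N x (b' \<otimes> tp (- 1))"
      using N.ract_add_right[of x "b \<otimes> tp (- 1)" "b' \<otimes> tp (- 1)"] right
        A.D_carrier[of b 1] A.D_carrier[of b' 1] by (simp add: l_distr)
    with right show ?thesis
      by (simp add: eval_diff A.D_add N.M.add_minus_minus)
  next
    case balanced
    have "ract N (ract N x a) (b \<otimes> tp (- 1)) = ract N x (a \<otimes> b \<otimes> tp (- 1))"
      using N.ract_mult[of x a "b \<otimes> tp (- 1)"] balanced A.D_carrier[of b 1] by (simp add: R_mult m_assoc)
    with balanced ab show ?thesis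
      by (simp add: eval_diff N.M.minus_eq N.M.r_neg)
  qed
qed

text \<open>
  One half of the description of the relation subgroup as the kernel of \<open>eval\<close>: the map respects
  the defining relations.
\<close>

lemma eval_T:
  assumes "c \<in> T" shows "eval c = \<zero>\<^bsub>N\<^esub>"
proof -
  have "c \<in> generate F (tensor_relations R N B)" using assms by (simp add: tensor_subgroup_def)
  then have "c \<in> carrier F \<and> eval c = \<zero>\<^bsub>N\<^esub>"
  proof (induction rule: generate.induct)
    case one
    then show ?case by (simp add: eval_0 carrier_free_Abelian_group_iff)
  next
    case (incl h)
    then show ?case using relations_closed eval_relation by blast
  next
    case (inv h)
    then have h: "h \<in> carrier F" "eval h = \<zero>\<^bsub>N\<^esub>" using relations_closed eval_relation by blast+
    have "0 \<in> carrier F" by (simp add: carrier_free_Abelian_group_iff)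
    then have "eval (0 - h) = \<zero>\<^bsub>N\<^esub>"
      using h eval_diff[of 0 h] by (simp add: eval_0 N.M.minus_eq)
    then show ?case using h by (simp add: carrier_free_Abelian_group_iff)
  next
    case (eng h1 h2)
    then show ?case by (simp add: eval_add)
  qed
  then show ?thesis ..
qed

lemma T_zero_tensor: "frag_of (\<zero>\<^bsub>N\<^esub>, t) \<in> T"
  using T_minus[OF T_add_left[of "\<zero>\<^bsub>N\<^esub>" "\<zero>\<^bsub>N\<^esub>" t]] by simp

text \<open>
  The other half rests on a normal form: modulo the relations every element equals a single generator
  \<open>x \<otimes> t\<close>.  For differences this uses additivity in the first argument, for generators the relation
  \<open>x \<otimes> b = x (b t\<^sup>-\<^sup>1) \<otimes> t\<close>.
\<close>

lemma normal_form:
  assumes "c \<in> carrier F"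
  shows "c - frag_of (eval c, t) \<in> T"
  using assms
proof (induction c rule: F_induct)
  case zero
  then show ?case using T_minus[OF T_zero_tensor] by (simp add: eval_0)
next
  case (diff c d)
  let ?c = "eval c" and ?d = "eval d"
  have N: "?c \<in> carrier N" "?d \<in> carrier N" using diff by simp_all
  \<comment> \<open>Additivity for \<open>?c = (?c \<ominus> ?d) \<oplus> ?d\<close>, since no relation mentions differences.\<close>
  have "frag_of (?c, t) - frag_of (?c \<ominus>\<^bsub>N\<^esub> ?d, t) - frag_of (?d, t) \<in> T"
    using T_add_left[of "?c \<ominus>\<^bsub>N\<^esub> ?d" ?d t] N by (simp add: N.M.minus_eq N.M.a_assoc N.M.l_neg)
  from T_add[OF T_diff[OF diff.IH] this]
  show ?case using diff by (simp add: eval_diff algebra_simps)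
next
  case (of x b)
  have "frag_of (ract N x (b \<otimes> tp (- 1)), t) - frag_of (x, b) \<in> T"
    using T_balanced[of x "b \<otimes> tp (- 1)" t] of tp_cancel(2)[of b 1] A.D_carrier[of b 1] by simp
  from T_minus[OF this] show ?case using of by simp
qed

lemma T_iff: "c \<in> T \<longleftrightarrow> c \<in> carrier F \<and> eval c = \<zero>\<^bsub>N\<^esub>"
proof
  assume "c \<in> carrier F \<and> eval c = \<zero>\<^bsub>N\<^esub>"
  then have "c - frag_of (\<zero>\<^bsub>N\<^esub>, t) \<in> T" using normal_form[of c] by simp
  from T_add[OF this T_zero_tensor] show "c \<in> T" by simp
qed (use T_closed eval_T in blast)

text \<open>
  The class of \<open>x \<otimes> t\<close>, described as a fibre of \<open>eval\<close>.  With this description the operations of the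
  tensor product, which are unions over all representatives, can be computed without choosing one.
\<close>

definition cls :: "'m \<Rightarrow> ('m \<times> 'a \<Rightarrow>\<^sub>0 int) set" where
  "cls x = {c \<in> carrier F. eval c = x}"

lemma tensor_class_eq:
  assumes "c \<in> carrier F"
  shows "tensor_class R N B c = cls (eval c)"
proof (rule Set.set_eqI)
  fix d :: "'m \<times> 'a \<Rightarrow>\<^sub>0 int"
  have "d \<in> tensor_class R N B c \<longleftrightarrow> d - c \<in> T"
    by (auto simp: tensor_class_def r_coset_def intro!: bexI[of _ "d - c"])
  also have "\<dots> \<longleftrightarrow> d \<in> carrier F \<and> eval d = eval c"
  proof
    assume dc: "d - c \<in> T"
    then have d: "d \<in> carrier F" using F_add[OF T_closed[OF dc] assms] by simp
    then have "eval (d - c) = eval d \<ominus>\<^bsub>N\<^esub> eval c" using eval_diff assms by blast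
    then have "eval d \<oplus>\<^bsub>N\<^esub> \<ominus>\<^bsub>N\<^esub> eval c = \<zero>\<^bsub>N\<^esub>" using dc by (simp add: T_iff N.M.minus_eq)
    then have "eval d = eval c" using d assms N.M.minus_equality[of "eval d" "\<ominus>\<^bsub>N\<^esub> eval c"] by simp
    then show "d \<in> carrier F \<and> eval d = eval c" using d by simp
  next
    assume "d \<in> carrier F \<and> eval d = eval c"
    then show "d - c \<in> T" using assms by (simp add: T_iff eval_diff N.M.minus_eq N.M.r_neg)
  qed
  finally show "d \<in> tensor_class R N B c \<longleftrightarrow> d \<in> cls (eval c)" by (simp add: cls_def)
qed

lemma frag_in_cls: "x \<in> carrier N \<Longrightarrow> frag_of (x, t) \<in> cls x"
  by (simp add: cls_def) (metis N.ract_one R_simps(4) tp_1 tp_inverse(1))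

lemma cls_inj: "inj_on cls (carrier N)"
proof (rule inj_onI)
  fix x y assume "x \<in> carrier N" "y \<in> carrier N" "cls x = cls y"
  then have "frag_of (x, t) \<in> cls x" "frag_of (x, t) \<in> cls y" using frag_in_cls by auto
  then show "x = y" by (simp add: cls_def)
qed

lemma normal_T: "T \<lhd> F"
  using comm_group.normal_iff_subgroup[OF abelian_free_Abelian_group] subgroup_T by blast

lemma coset_eq: "c \<in> carrier F \<Longrightarrow> T #>\<^bsub>F\<^esub> c = cls (eval c)"
  using tensor_class_eq by (simp add: tensor_class_def)

lemma tensor_carrier: "carrier (tensor R N B) = cls ` carrier N"
proof -
  have "carrier (tensor R N B) = (\<lambda>c. cls (eval c)) ` carrier F"
    by (auto simp: tensor_def Let_def FactGroup_def RCOSETS_def coset_eq)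
  also have "\<dots> = cls ` carrier N"
  proof (intro equalityI image_subsetI)
    show "cls x \<in> (\<lambda>c. cls (eval c)) ` carrier F" if "x \<in> carrier N" for x
      using frag_in_cls[OF that] by (auto simp: cls_def intro!: image_eqI[of _ _ "frag_of (x, t)"])
  qed simp
  finally show ?thesis .
qed

lemma tensor_zero: "\<zero>\<^bsub>tensor R N B\<^esub> = cls \<zero>\<^bsub>N\<^esub>"
  by (auto simp: tensor_def Let_def FactGroup_def cls_def T_iff)

lemma cls_add:
  assumes "x \<in> carrier N" "y \<in> carrier N"
  shows "cls x \<oplus>\<^bsub>tensor R N B\<^esub> cls y = cls (x \<oplus>\<^bsub>N\<^esub> y)"
proof -
  let ?x = "frag_of (x, t)" and ?y = "frag_of (y, t)"
  have c: "?x \<in> carrier F" "?y \<in> carrier F" "eval ?x = x" "eval ?y = y"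
    using frag_in_cls assms by (auto simp: cls_def)
  have "cls x \<oplus>\<^bsub>tensor R N B\<^esub> cls y = (T #>\<^bsub>F\<^esub> ?x) <#>\<^bsub>F\<^esub> (T #>\<^bsub>F\<^esub> ?y)"
    using c by (simp add: tensor_def Let_def FactGroup_def coset_eq)
  also have "\<dots> = cls (x \<oplus>\<^bsub>N\<^esub> y)"
    using normal.rcos_sum[OF normal_T c(1,2)] c coset_eq[of "?x + ?y"] by (simp add: eval_add)
  finally show ?thesis .
qed

text \<open>
  The action of \<open>a\<close> on the right factor becomes the action of \<open>\<gamma> a\<close>:
  \<open>b a t\<^sup>-\<^sup>1 = (b t\<^sup>-\<^sup>1) (t a t\<^sup>-\<^sup>1)\<close>.
\<close>

lemma eval_ract:
  assumes "c \<in> carrier F" and a: "a \<in> \<A> 0"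
  shows "frag_extend (\<lambda>(x, b). frag_of (x, b \<otimes> a)) c \<in> carrier F \<and>
    eval (frag_extend (\<lambda>(x, b). frag_of (x, b \<otimes> a)) c) = ract N (eval c) (\<gamma> a)"
  using assms(1)
proof (induction c rule: F_induct)
  case zero
  then show ?case using a by (simp add: eval_0 carrier_free_Abelian_group_iff)
next
  case (diff c d)
  have "ract N (eval c \<ominus>\<^bsub>N\<^esub> eval d) (\<gamma> a) \<oplus>\<^bsub>N\<^esub> ract N (eval d) (\<gamma> a) = ract N (eval c) (\<gamma> a)"
    using N.ract_add_left[of "eval c \<ominus>\<^bsub>N\<^esub> eval d" "eval d" "\<gamma> a"] diff a
    by (simp add: N.M.minus_eq N.M.a_assoc N.M.l_neg)
  then have "ract N (eval c \<ominus>\<^bsub>N\<^esub> eval d) (\<gamma> a) = ract N (eval c) (\<gamma> a) \<ominus>\<^bsub>N\<^esub> ract N (eval d) (\<gamma> a)"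
    using diff a by (metis N.M.add.inv_solve_right N.M.minus_closed N.M.minus_eq N.ract_closed R_simps(1) \<gamma>_closed eval_closed)
  then show ?case using diff by (simp add: frag_extend_diff eval_diff)
next
  case (of x b)
  have ba: "b \<otimes> a \<in> \<A> 1" using grade_mult[OF of(2) a] by simp
  have b: "b \<in> carrier A" using of A.D_carrier by blast
  have "b \<otimes> tp (- 1) \<otimes> \<gamma> a = b \<otimes> a \<otimes> tp (- 1)"
    using a b tp_cancel(4)[of "a \<otimes> tp (- 1)" 1] by (simp add: \<gamma>_eq m_assoc)
  then show ?case
    using of ba a N.ract_mult[of x "b \<otimes> tp (- 1)" "\<gamma> a"] by (simp add: R_mult)
qed

lemma cls_ract:
  assumes "x \<in> carrier N" "a \<in> \<A> 0"
  shows "ract (tensor R N B) (cls x) a = cls (ract N x (\<gamma> a))"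
proof -
  have "tensor_class R N B (frag_extend (\<lambda>(x, b). frag_of (x, b \<otimes> a)) c) = cls (ract N x (\<gamma> a))"
    if "c \<in> cls x" for c
    using that eval_ract[of c a] assms(2) by (simp add: cls_def tensor_class_eq)
  moreover have "cls x \<noteq> {}" using frag_in_cls[OF assms(1)] by blast
  ultimately show ?thesis by (simp add: tensor_def Let_def)
qed

abbreviation j :: "('m \<times> 'a \<Rightarrow>\<^sub>0 int) set \<Rightarrow> 'm" where "j \<equiv> chosen_injection (tensor R N B)"

text \<open>
  The tensor product is in bijection with \<open>N\<close>, so it does embed into the universe.
\<close>

lemma j_inj: "inj_on j (carrier (tensor R N B))"
proof -
  have "inj_on (inv_into (carrier N) cls) (carrier (tensor R N B))"
    unfolding tensor_carrier by (rule inj_on_inv_into) simp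
  then have "\<exists>j :: _ \<Rightarrow> 'm. inj_on j (carrier (tensor R N B))" by blast
  from someI_ex[OF this] show ?thesis unfolding chosen_injection_def .
qed

abbreviation N\<gamma> :: "('a, 'm) rmod" where "N\<gamma> \<equiv> fobj (pullback_functor \<gamma>) N"

abbreviation NB :: "('a, 'm) rmod" where "NB \<equiv> fobj (tensor_functor R B) N"

definition \<theta> :: "'m \<Rightarrow> 'm" where "\<theta> = restrict (\<lambda>x. j (cls x)) (carrier N)"

lemma j_inv: "x \<in> carrier N \<Longrightarrow> inv_into (carrier (tensor R N B)) j (j (cls x)) = cls x"
  by (rule inv_into_f_f[OF j_inj]) (simp add: tensor_carrier)

lemma NB_eq: "NB = transport_rmod j (tensor R N B)"
  by (simp add: tensor_functor_def)

lemma
  shows NB_right_module: "right_module R NB"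
    and \<theta>_hom: "\<theta> \<in> rmod_hom R N\<gamma> NB"
    and \<theta>_bij: "bij_betw \<theta> (carrier N\<gamma>) (carrier NB)"
proof -
  have carr: "carrier N\<gamma> = carrier N" by (simp add: pullback_functor_def)
  have N: "right_module R N\<gamma>"
    using right_module_pullback[of R N \<gamma>] N.rmodule_axioms \<gamma>_ring_iso
    by (simp add: pullback_functor_def right_module_iff_rmodule ring_iso_def)
  have inj: "inj_on (\<lambda>x. j (cls x)) (carrier N\<gamma>)"
    using cls_inj j_inj unfolding tensor_carrier carr by (auto simp: inj_on_def)
  note tr = N inj
  have 1: "carrier NB = (\<lambda>x. j (cls x)) ` carrier N\<gamma>"
    by (simp add: NB_eq transport_rmod_simps tensor_carrier carr image_image)
  have 2: "\<zero>\<^bsub>NB\<^esub> = j (cls \<zero>\<^bsub>N\<gamma>\<^esub>)"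
    by (simp add: NB_eq transport_rmod_simps tensor_zero pullback_functor_def)
  have 3: "j (cls x) \<oplus>\<^bsub>NB\<^esub> j (cls y) = j (cls (x \<oplus>\<^bsub>N\<gamma>\<^esub> y))"
    if "x \<in> carrier N\<gamma>" "y \<in> carrier N\<gamma>" for x y
    using that by (simp add: carr NB_eq transport_rmod_simps j_inv cls_add pullback_functor_def)
  have 4: "ract NB (j (cls x)) a = j (cls (ract N\<gamma> x a))"
    if "x \<in> carrier N\<gamma>" "a \<in> carrier R" for x a
    using that by (simp add: carr NB_eq transport_rmod_simps j_inv cls_ract pullback_functor_def)
  have th: "\<theta> = restrict (\<lambda>x. j (cls x)) (carrier N\<gamma>)" by (simp add: \<theta>_def carr)
  show "right_module R NB" by (rule right_module_transfer[OF N inj 1 2 3 4])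
  show "\<theta> \<in> rmod_hom R N\<gamma> NB" unfolding th by (rule right_module_transfer_hom[OF N inj 1 2 3 4])
  show "bij_betw \<theta> (carrier N\<gamma>) (carrier NB)"
    unfolding th by (rule right_module_transfer_bij[OF N inj 1 2 3 4])
qed

end

context unit_degree_one
begin

text \<open>
  The isomorphism is \<open>x \<mapsto> x \<otimes> t\<close>; functoriality of the tensor product is transported along it from
  the pullback functor.
\<close>

theorem tensor_functor_iso:
  "naturally_isomorphic (Mod_cat R :: (('a, 'm) rmod, 'm \<Rightarrow> 'm) cat) (Mod_cat R)
     (tensor_functor R (component_bimod A \<A> 1)) (pullback_functor \<gamma>)"
proof -
  let ?B = "component_bimod A \<A> 1"
  let ?G = "tensor_functor R ?B :: (('a, 'm) rmod, 'm \<Rightarrow> 'm, ('a, 'm) rmod, 'm \<Rightarrow> 'm) cfunctor"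
  let ?P = "pullback_functor \<gamma> :: (('a, 'm) rmod, 'm \<Rightarrow> 'm, ('a, 'm) rmod, 'm \<Rightarrow> 'm) cfunctor"
  define \<theta> where "\<theta> N = tensor_unit.\<theta> A \<A> t R N" for N :: "('a, 'm) rmod"
  have P: "is_functor (Mod_cat R) (Mod_cat R) ?P"
    using ffes_functor[OF pullback_equivalence[OF ring_R \<gamma>_ring_iso]] .
  have ctx: "tensor_unit K A \<A> t R \<gamma> N" if "right_module R N" for N :: "('a, 'm) rmod"
    using that unit_degree_one_axioms by (simp add: tensor_unit_def right_module_iff_rmodule)
  have PN: "right_module R (fobj ?P N)" if "right_module R N" for N
    using functor_obj[OF P] that by simp
  note th = tensor_unit.\<theta>_hom[OF ctx, folded \<theta>_def] tensor_unit.\<theta>_bij[OF ctx, folded \<theta>_def]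
  have arr: "farr ?G M N f \<in> extensional (carrier (fobj ?G M)) \<and>
      (\<forall>x\<in>carrier M. farr ?G M N f (\<theta> M x) = \<theta> N (f x))"
    if M: "right_module R M" and N: "right_module R N" and f: "f \<in> rmod_hom R M N"
    for M N :: "('a, 'm) rmod" and f
  proof -
    interpret M: tensor_unit K A \<A> t R \<gamma> M using M by (rule ctx)
    interpret N: tensor_unit K A \<A> t R \<gamma> N using N by (rule ctx)
    have ev: "frag_extend (\<lambda>(x, b). frag_of (f x, b)) c \<in> carrier N.F \<and>
      N.eval (frag_extend (\<lambda>(x, b). frag_of (f x, b)) c) = f (M.eval c)" if "c \<in> carrier M.F" for c
      using that
    proof (induction c rule: M.F_induct)
      case zero
      then show ?case
        using rmod_hom_zero[OF M N f] by (simp add: M.eval_0 N.eval_0 carrier_free_Abelian_group_iff)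
    next
      case (diff c d)
      have "f (M.eval c \<ominus>\<^bsub>M\<^esub> M.eval d) \<oplus>\<^bsub>N\<^esub> f (M.eval d) = f (M.eval c)"
        using rmod_homD(4)[OF f, of "M.eval c \<ominus>\<^bsub>M\<^esub> M.eval d" "M.eval d"] diff
        by (simp add: M.N.M.minus_eq M.N.M.a_assoc M.N.M.l_neg)
      then have "f (M.eval c \<ominus>\<^bsub>M\<^esub> M.eval d) = f (M.eval c) \<ominus>\<^bsub>N\<^esub> f (M.eval d)"
        using diff rmod_homD(3)[OF f]
        by (metis M.N.M.minus_closed M.eval_closed N.N.M.add.inv_solve_right N.N.M.minus_eq)
      then show ?case using diff by (simp add: frag_extend_diff M.eval_diff N.eval_diff)
    next
      case (of x b)
      then show ?case using rmod_homD(3,5)[OF f] by simp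
    qed
    have tm: "tensor_map R N ?B f (M.cls x) = N.cls (f x)" if "x \<in> carrier M" for x
    proof -
      have "tensor_class R N ?B (frag_extend (\<lambda>(x, b). frag_of (f x, b)) c) = N.cls (f x)"
        if "c \<in> M.cls x" for c
        using that ev[of c] by (simp add: M.cls_def N.tensor_class_eq)
      moreover have "M.cls x \<noteq> {}" using M.frag_in_cls[OF that] by blast
      ultimately show ?thesis by (simp add: tensor_map_def)
    qed
    have farr: "farr ?G M N f = restrict (\<lambda>x. N.j (tensor_map R N ?B f
        (inv_into (carrier (tensor R M ?B)) M.j x))) (M.j ` carrier (tensor R M ?B))"
      by (simp add: tensor_functor_def Let_def)
    have carr: "carrier (fobj ?G M) = M.j ` carrier (tensor R M ?B)"
      by (simp add: M.NB_eq transport_rmod_simps)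
    show ?thesis
      unfolding farr carr
      using tm M.j_inv rmod_homD(3)[OF f]
      by (auto simp: \<theta>_def M.\<theta>_def N.\<theta>_def M.tensor_carrier)
  qed
  have carr: "carrier (fobj ?P M) = carrier M" and fP: "farr ?P M N f = f" for M N f
    by (simp_all add: pullback_functor_def)
  show ?thesis
  proof (rule naturally_isomorphic_by_transport[OF P, where \<theta> = \<theta>])
    fix M assume M: "M \<in> Obj (Mod_cat R :: (('a, 'm) rmod, 'm \<Rightarrow> 'm) cat)"
    then show "fobj ?G M \<in> Obj (Mod_cat R)"
      using tensor_unit.NB_right_module[OF ctx] by simp
    show "iso_arrow (Mod_cat R) (fobj ?P M) (fobj ?G M) (\<theta> M)"
      using M th[of M] by (intro iso_arrow_Mod_cat) (auto intro: PN)
    fix N f assume N: "N \<in> Obj (Mod_cat R :: (('a, 'm) rmod, 'm \<Rightarrow> 'm) cat)" "f \<in> Hom (Mod_cat R) M N"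
    then have MN: "right_module R M" "right_module R N" "f \<in> rmod_hom R M N" using M by simp_all
    have fPh: "f \<in> rmod_hom R (fobj ?P M) (fobj ?P N)"
      using functor_hom[OF P, of M N f] MN by (simp add: fP)
    show "farr ?G M N f \<in> Hom (Mod_cat R) (fobj ?G M) (fobj ?G N)"
      unfolding Hom_Mod_cat
    proof (rule rmod_hom_factor)
      show "right_module R (fobj ?P M)" "\<theta> M \<in> rmod_hom R (fobj ?P M) (fobj ?G M)"
        using PN MN th by auto
      show "\<theta> M ` carrier (fobj ?P M) = carrier (fobj ?G M)"
        using th(2)[OF MN(1)] by (simp add: bij_betw_def)
      show "compose (carrier (fobj ?P M)) (\<theta> N) f \<in> rmod_hom R (fobj ?P M) (fobj ?G N)"
        by (rule rmod_hom_compose[OF PN[OF MN(1)] fPh th(1)[OF MN(2)]])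
    qed (use arr[OF MN] in \<open>auto simp: compose_def carr\<close>)
    show "Cmp (Mod_cat R) (fobj ?P M) (fobj ?G M) (fobj ?G N) (farr ?G M N f) (\<theta> M) =
        Cmp (Mod_cat R) (fobj ?P M) (fobj ?P N) (fobj ?G N) (\<theta> N) (farr ?P M N f)"
      using arr[OF MN] by (auto simp: compose_def carr fP)
  qed
qed

end

section \<open>Torsion modules over an algebra with a unit of degree one\<close>

definition zero_gmod :: "('a, 'm) gmod \<Rightarrow> ('a, 'm) gmod" where
  "zero_gmod M = M\<lparr>carrier := {\<zero>\<^bsub>M\<^esub>}, grade := \<lambda>_. {\<zero>\<^bsub>M\<^esub>}\<rparr>"

lemma zero_gmod_simps [simp]:
  "carrier (zero_gmod M) = {\<zero>\<^bsub>M\<^esub>}" "add (zero_gmod M) = add M" "\<zero>\<^bsub>zero_gmod M\<^esub> = \<zero>\<^bsub>M\<^esub>"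
  "ract (zero_gmod M) = ract M" "grade (zero_gmod M) n = {\<zero>\<^bsub>M\<^esub>}"
  by (simp_all add: zero_gmod_def)

lemma zero_gmod_graded:
  assumes "graded_module A \<A> M" "\<And>n a. a \<in> \<A> n \<Longrightarrow> a \<in> carrier A"
  shows "graded_module A \<A> (zero_gmod M)"
proof -
  interpret M: gmodule A \<A> M using assms(1) by (simp add: graded_module_iff_gmodule)
  let ?Z = "zero_gmod M"
  have Z: "abelian_group ?Z" by (rule abelian_groupI) auto
  interpret Z: abelian_group ?Z by (rule Z)
  have "right_module A ?Z"
    using Z M.ring_axioms by (auto simp: right_module_def)
  moreover have "internal_direct_sum ?Z UNIV (\<lambda>_. {\<zero>\<^bsub>M\<^esub>})"
  proof (rule internal_direct_sumI[OF Z, where p = "\<lambda>_ _. \<zero>\<^bsub>M\<^esub>"])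
    show "additive_subgroup {\<zero>\<^bsub>M\<^esub>} ?Z"
      using Z.add.subgroup_self by (intro additive_subgroupI) simp
  qed (auto simp: additive_on_def fin_sum_def)
  moreover have "grade ?Z = (\<lambda>_. {\<zero>\<^bsub>M\<^esub>})" by (simp add: fun_eq_iff)
  ultimately show ?thesis using assms(2) by (auto simp: graded_module_def)
qed

context unit_degree_one
begin

text \<open>
  \<open>\<one> = \<one> t t\<^sup>-\<^sup>1\<close>, and the middle factor has nonzero degree.
\<close>

lemma one_in_irrelevant_ideal: "\<one> \<in> irrelevant_ideal A \<A>"
proof -
  let ?c = "\<lambda>i. if i = (1 :: int) then t else \<zero>"
  have "?c \<in> fin_families A (- {0}) \<A>"
    using t_degree by (auto simp: fin_families_def)
  then have "t \<in> fin_sum A ` fin_families A (- {0}) \<A>"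
    using fin_sum_single[of t "1 :: int"] by (metis (no_types, lifting) image_eqI t_closed)
  then have "\<one> \<otimes> t \<otimes> tp (- 1) \<in> irrelevant_ideal A \<A>"
    unfolding irrelevant_ideal_def by (intro ideal_prod.prod) auto
  then show ?thesis using tp_inverse(1)[of 1] by simp
qed

definition zero_modules :: "('a, 'm) gmod set" where
  "zero_modules = {M. graded_module A \<A> M \<and> carrier M = {\<zero>\<^bsub>M\<^esub>}}"

lemma localizing_zero_modules: "localizing A \<A> (zero_modules :: ('a, 'm) gmod set)"
  unfolding localizing_def
proof (intro conjI ballI allI impI)
  show "zero_modules \<subseteq> {M :: ('a, 'm) gmod. graded_module A \<A> M}"
    by (auto simp: zero_modules_def)
next
  fix M N :: "('a, 'm) gmod"
  assume M: "M \<in> zero_modules" and N: "graded_module A \<A> N"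
    and "\<exists>f\<in>gmod_hom A N M. inj_on f (carrier N)"
  then obtain f where f: "f ` carrier N \<subseteq> carrier M" "inj_on f (carrier N)"
    using gmod_homD(3) by blast
  interpret N: gmodule A \<A> N using N by (simp add: graded_module_iff_gmodule)
  have "x = \<zero>\<^bsub>N\<^esub>" if "x \<in> carrier N" for x
    using f M that N.M.zero_closed by (auto simp: zero_modules_def inj_on_def image_subset_iff)
  then show "N \<in> zero_modules" using N by (auto simp: zero_modules_def)
next
  fix M N :: "('a, 'm) gmod"
  assume M: "M \<in> zero_modules" and N: "graded_module A \<A> N"
    and "\<exists>f\<in>gmod_hom A M N. f ` carrier M = carrier N"
  then obtain f where "f ` carrier M = carrier N" by blast
  then have "carrier N = {f \<zero>\<^bsub>M\<^esub>}" using M by (auto simp: zero_modules_def)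
  moreover interpret N: gmodule A \<A> N using N by (simp add: graded_module_iff_gmodule)
  have "\<zero>\<^bsub>N\<^esub> \<in> carrier N" by simp
  ultimately have "carrier N = {\<zero>\<^bsub>N\<^esub>}" by simp
  then show "N \<in> zero_modules" using N by (simp add: zero_modules_def)
next
  fix L N M :: "('a, 'm) gmod"
  assume L: "L \<in> zero_modules" and N: "N \<in> zero_modules" and M: "graded_module A \<A> M"
    and "\<exists>f g. short_exact A L f M g N"
  then obtain f g where fg: "g \<in> gmod_hom A M N" "f ` carrier L = {x \<in> carrier M. g x = \<zero>\<^bsub>N\<^esub>}"
    by (auto simp: short_exact_def)
  have "g x = \<zero>\<^bsub>N\<^esub>" if "x \<in> carrier M" for x
    using gmod_homD(3)[OF fg(1)] that N by (auto simp: zero_modules_def)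
  then have "carrier M = {f \<zero>\<^bsub>L\<^esub>}" using fg(2) L by (auto simp: zero_modules_def)
  moreover interpret M: gmodule A \<A> M using M by (simp add: graded_module_iff_gmodule)
  have "\<zero>\<^bsub>M\<^esub> \<in> carrier M" by simp
  ultimately have "carrier M = {\<zero>\<^bsub>M\<^esub>}" by simp
  then show "M \<in> zero_modules" using M by (simp add: zero_modules_def)
next
  fix I :: "'m set" and N :: "'m \<Rightarrow> ('a, 'm) gmod" and j and M :: "('a, 'm) gmod"
  assume M: "graded_module A \<A> M"
    and N: "\<forall>i\<in>I. N i \<in> zero_modules \<and> j i \<in> gmod_hom A (N i) M \<and> inj_on (j i) (carrier (N i))"
    and sum: "internal_direct_sum M I (\<lambda>i. j i ` carrier (N i))"
  interpret M: gmodule A \<A> M using M by (simp add: graded_module_iff_gmodule)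
  have "j i ` carrier (N i) = {\<zero>\<^bsub>M\<^esub>}" if "i \<in> I" for i
    using N that rmod_hom_zero[of A "N i" M "j i"] gmod_homD(1)[of "j i" A "N i" M] M
    by (auto simp: zero_modules_def graded_module_def)
  then have "c i = \<zero>\<^bsub>M\<^esub>" if "c \<in> fin_families M I (\<lambda>i. j i ` carrier (N i))" for c i
    using that by (cases "i \<in> I") (auto simp: fin_families_def)
  then have "fin_sum M c = \<zero>\<^bsub>M\<^esub>" if "c \<in> fin_families M I (\<lambda>i. j i ` carrier (N i))" for c
    using that by (simp add: fin_sum_def)
  moreover have "carrier M = fin_sum M ` fin_families M I (\<lambda>i. j i ` carrier (N i))"
    using sum by (simp add: internal_direct_sum_def bij_betw_def)
  ultimately have "carrier M \<subseteq> {\<zero>\<^bsub>M\<^esub>}" by auto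
  then have "carrier M = {\<zero>\<^bsub>M\<^esub>}" using M.M.zero_closed by blast
  then show "M \<in> zero_modules" using M by (simp add: zero_modules_def)
qed

text \<open>
  The irrelevant ideal contains \<open>\<one>\<close>, so it annihilates zero modules only; and the zero modules already
  form a localizing subcategory.
\<close>

lemma Tors_eq: "Tors A \<A> = (zero_modules :: ('a, 'm) gmod set)"
proof
  have "{M :: ('a, 'm) gmod. graded_module A \<A> M \<and>
      (\<forall>x\<in>carrier M. \<forall>a\<in>irrelevant_ideal A \<A>. ract M x a = \<zero>\<^bsub>M\<^esub>)} \<subseteq> zero_modules"
  proof
    fix M :: "('a, 'm) gmod"
    assume "M \<in> {M. graded_module A \<A> M \<and>
      (\<forall>x\<in>carrier M. \<forall>a\<in>irrelevant_ideal A \<A>. ract M x a = \<zero>\<^bsub>M\<^esub>)}"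
    then have M: "graded_module A \<A> M" and tors: "\<And>x. x \<in> carrier M \<Longrightarrow> ract M x \<one> = \<zero>\<^bsub>M\<^esub>"
      using one_in_irrelevant_ideal by auto
    interpret M: gmodule A \<A> M using M by (simp add: graded_module_iff_gmodule)
    have "x = \<zero>\<^bsub>M\<^esub>" if "x \<in> carrier M" for x using tors[OF that] that by simp
    then have "carrier M = {\<zero>\<^bsub>M\<^esub>}" using M.M.zero_closed by blast
    then show "M \<in> zero_modules" using M by (simp add: zero_modules_def)
  qed
  then show "Tors A \<A> \<subseteq> (zero_modules :: ('a, 'm) gmod set)"
    unfolding Tors_def using localizing_zero_modules by (intro Inter_lower) simp
next
  have "ract M x a = \<zero>\<^bsub>M\<^esub>"
    if "graded_module A \<A> M" "carrier M = {\<zero>\<^bsub>M\<^esub>}" "x \<in> carrier M" "a \<in> irrelevant_ideal A \<A>"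
    for M :: "('a, 'm) gmod" and x a
  proof -
    interpret M: gmodule A \<A> M using that(1) by (simp add: graded_module_iff_gmodule)
    have sub: "fin_sum A ` fin_families A (- {0}) \<A> \<subseteq> carrier A"
    proof (rule image_subsetI)
      fix c assume c: "c \<in> fin_families A (- {0}) \<A>"
      have "c i \<in> carrier A" for i
        using c A.D_carrier[of "c i" i] by (cases "i = 0") (auto simp: fin_families_def)
      then show "fin_sum A c \<in> carrier A" unfolding fin_sum_def by (intro finsum_closed) simp
    qed
    have S: "y \<in> carrier A" if "y \<in> carrier A \<cdot> (fin_sum A ` fin_families A (- {0}) \<A>)" for y
      using that by (induction rule: ideal_prod.induct) (use sub in auto)
    have "a \<in> carrier A"
      using that(4) unfolding irrelevant_ideal_def
      by (induction rule: ideal_prod.induct) (auto simp: S)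
    then show ?thesis using M.ract_closed[of x a] that by blast
  qed
  then show "(zero_modules :: ('a, 'm) gmod set) \<subseteq> Tors A \<A>"
    unfolding Tors_def zero_modules_def by blast
qed

text \<open>
  A homomorphism whose kernel and cokernel vanish is bijective.
\<close>

lemma torsion_isos_iff:
  assumes M: "graded_module A \<A> M" and N: "graded_module A \<A> N"
  shows "f \<in> torsion_isos A \<A> M N \<longleftrightarrow> iso_arrow (Gr A \<A>) M N f"
proof -
  interpret M: gmodule A \<A> M using M by (simp add: graded_module_iff_gmodule)
  interpret N: gmodule A \<A> N using N by (simp add: graded_module_iff_gmodule)
  have "f \<in> torsion_isos A \<A> M N \<longleftrightarrow> f \<in> gmod_hom A M N \<and> bij_betw f (carrier M) (carrier N)"
  proof
    assume a: "f \<in> torsion_isos A \<A> M N"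
    then have f: "f \<in> gmod_hom A M N" by (simp add: torsion_isos_def)
    have "\<exists>L\<in>Tors A \<A>. \<exists>i\<in>gmod_hom A L M.
        inj_on i (carrier L) \<and> i ` carrier L = {x \<in> carrier M. f x = \<zero>\<^bsub>N\<^esub>}"
      using a by (simp add: torsion_isos_def)
    then obtain L where L': "L \<in> Tors A \<A>"
      and "\<exists>i\<in>gmod_hom A L M. inj_on i (carrier L) \<and> i ` carrier L = {x \<in> carrier M. f x = \<zero>\<^bsub>N\<^esub>}" ..
    then obtain i where i: "inj_on i (carrier L) \<and> i ` carrier L = {x \<in> carrier M. f x = \<zero>\<^bsub>N\<^esub>}" by - (erule bexE)
    have "\<exists>Q\<in>Tors A \<A>. \<exists>p\<in>gmod_hom A N Q.
        p ` carrier N = carrier Q \<and> {y \<in> carrier N. p y = \<zero>\<^bsub>Q\<^esub>} = f ` carrier M"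
      using a by (simp add: torsion_isos_def)
    then obtain Q where Q': "Q \<in> Tors A \<A>"
      and "\<exists>p\<in>gmod_hom A N Q. p ` carrier N = carrier Q \<and> {y \<in> carrier N. p y = \<zero>\<^bsub>Q\<^esub>} = f ` carrier M" ..
    then obtain p where p: "p ` carrier N = carrier Q \<and> {y \<in> carrier N. p y = \<zero>\<^bsub>Q\<^esub>} = f ` carrier M" by - (erule bexE)
    have L: "carrier L = {\<zero>\<^bsub>L\<^esub>}" "i ` carrier L = {x \<in> carrier M. f x = \<zero>\<^bsub>N\<^esub>}"
      and Q: "carrier Q = {\<zero>\<^bsub>Q\<^esub>}" "p ` carrier N = carrier Q"
        "{y \<in> carrier N. p y = \<zero>\<^bsub>Q\<^esub>} = f ` carrier M"
      using L' Q' i p by (simp_all add: Tors_eq zero_modules_def)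
    note fh = rmod_homD[OF gmod_homD(1)[OF f]]
    have f0: "f \<zero>\<^bsub>M\<^esub> = \<zero>\<^bsub>N\<^esub>"
      using rmod_hom_zero[OF _ _ gmod_homD(1)[OF f]] M N by (simp add: graded_module_def)
    have kerL: "{x \<in> carrier M. f x = \<zero>\<^bsub>N\<^esub>} = {i \<zero>\<^bsub>L\<^esub>}" using L by auto
    have ker: "x = \<zero>\<^bsub>M\<^esub>" if "x \<in> carrier M" "f x = \<zero>\<^bsub>N\<^esub>" for x
    proof -
      have "x \<in> {i \<zero>\<^bsub>L\<^esub>}" "\<zero>\<^bsub>M\<^esub> \<in> {i \<zero>\<^bsub>L\<^esub>}"
        unfolding kerL[symmetric] using that f0 by simp_all
      then show ?thesis by simp
    qed
    have "inj_on f (carrier M)"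
    proof (rule inj_onI)
      fix x y assume xy: "x \<in> carrier M" "y \<in> carrier M" "f x = f y"
      have "f (\<ominus>\<^bsub>M\<^esub> y) \<oplus>\<^bsub>N\<^esub> f y = \<zero>\<^bsub>N\<^esub>"
        using fh(4)[of "\<ominus>\<^bsub>M\<^esub> y" y] xy f0 by (simp add: M.M.l_neg)
      then have "f (\<ominus>\<^bsub>M\<^esub> y \<oplus>\<^bsub>M\<^esub> x) = \<zero>\<^bsub>N\<^esub>" using fh(4)[of "\<ominus>\<^bsub>M\<^esub> y" x] xy by simp
      then have "\<ominus>\<^bsub>M\<^esub> y \<oplus>\<^bsub>M\<^esub> x = \<zero>\<^bsub>M\<^esub>" using ker xy by simp
      then have "y \<oplus>\<^bsub>M\<^esub> (\<ominus>\<^bsub>M\<^esub> y \<oplus>\<^bsub>M\<^esub> x) = y \<oplus>\<^bsub>M\<^esub> \<zero>\<^bsub>M\<^esub>" by (rule arg_cong)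
      then show "x = y" using xy(1,2) by (simp only: M.M.r_neg2 M.M.r_zero)
    qed
    moreover have "f ` carrier M = carrier N" using Q by auto
    ultimately show "f \<in> gmod_hom A M N \<and> bij_betw f (carrier M) (carrier N)"
      using f by (simp add: bij_betw_def)
  next
    assume "f \<in> gmod_hom A M N \<and> bij_betw f (carrier M) (carrier N)"
    then have f: "f \<in> gmod_hom A M N" and b: "inj_on f (carrier M)" "f ` carrier M = carrier N"
      by (auto simp: bij_betw_def)
    have f0: "f \<zero>\<^bsub>M\<^esub> = \<zero>\<^bsub>N\<^esub>"
      using rmod_hom_zero[OF _ _ gmod_homD(1)[OF f]] M N by (simp add: graded_module_def)
    have ker: "{\<zero>\<^bsub>M\<^esub>} = {x \<in> carrier M. f x = \<zero>\<^bsub>N\<^esub>}"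
    proof (intro equalityI subsetI)
      fix x assume "x \<in> {x \<in> carrier M. f x = \<zero>\<^bsub>N\<^esub>}"
      then have "x \<in> carrier M" "f x = f \<zero>\<^bsub>M\<^esub>" using f0 by simp_all
      then show "x \<in> {\<zero>\<^bsub>M\<^esub>}" using inj_onD[OF b(1)] by simp
    qed (simp add: f0)
    have T: "zero_gmod M \<in> Tors A \<A>" "zero_gmod N \<in> Tors A \<A>"
      using zero_gmod_graded[OF M A.D_carrier] zero_gmod_graded[OF N A.D_carrier]
      by (simp_all add: Tors_eq zero_modules_def)
    have i: "restrict (\<lambda>x. x) {\<zero>\<^bsub>M\<^esub>} \<in> gmod_hom A (zero_gmod M) M"
      by (auto simp: gmod_hom_iff rmod_hom_def)
    have p: "restrict (\<lambda>_. \<zero>\<^bsub>N\<^esub>) (carrier N) \<in> gmod_hom A N (zero_gmod N)"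
      using N.D_carrier by (auto simp: gmod_hom_iff rmod_hom_def)
    show "f \<in> torsion_isos A \<A> M N"
      unfolding torsion_isos_def mem_Collect_eq
    proof (intro conjI f)
      have "restrict (\<lambda>x. x) {\<zero>\<^bsub>M\<^esub>} ` carrier (zero_gmod M) = {x \<in> carrier M. f x = \<zero>\<^bsub>N\<^esub>}"
        unfolding ker[symmetric] by simp
      then show "\<exists>L\<in>Tors A \<A>. \<exists>i\<in>gmod_hom A L M.
          inj_on i (carrier L) \<and> i ` carrier L = {x \<in> carrier M. f x = \<zero>\<^bsub>N\<^esub>}"
        by (intro bexI[OF _ T(1)] bexI[OF _ i] conjI) simp_all
      have "\<zero>\<^bsub>N\<^esub> \<in> restrict (\<lambda>_. \<zero>\<^bsub>N\<^esub>) (carrier N) ` carrier N"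
        by (rule image_eqI[of _ _ "\<zero>\<^bsub>N\<^esub>"]) simp_all
      then have "restrict (\<lambda>_. \<zero>\<^bsub>N\<^esub>) (carrier N) ` carrier N = carrier (zero_gmod N)"
        by auto
      then show "\<exists>Q\<in>Tors A \<A>. \<exists>p\<in>gmod_hom A N Q.
          p ` carrier N = carrier Q \<and> {y \<in> carrier N. p y = \<zero>\<^bsub>Q\<^esub>} = f ` carrier M"
        using b(2) by (intro bexI[OF _ T(2)] bexI[OF _ p] conjI) auto
    qed
  qed
  then show ?thesis by (simp add: iso_arrow_Gr_iff[OF M N])
qed

lemma iso_localization_torsion:
  "iso_localization (Gr A \<A> :: (('a, 'm) gmod, 'm \<Rightarrow> 'm) cat) (torsion_isos A \<A>)"
  by unfold_locales (simp_all add: category_Gr torsion_isos_iff)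

end

section \<open>The component of degree zero\<close>

definition zero_part :: "('a, 'm) gmod \<Rightarrow> ('a, 'm) rmod" where
  "zero_part M = \<lparr>carrier = grade M 0, monoid.mult = monoid.mult M, one = one M,
     ring.zero = ring.zero M, add = add M, ract = ract M\<rparr>"

lemma zero_part_simps [simp]:
  "carrier (zero_part M) = grade M 0" "add (zero_part M) = add M" "\<zero>\<^bsub>zero_part M\<^esub> = \<zero>\<^bsub>M\<^esub>"
  "ract (zero_part M) = ract M"
  by (simp_all add: zero_part_def)

definition zero_part_functor ::
    "(('a, 'm) gmod, 'm \<Rightarrow> 'm, ('a, 'm) rmod, 'm \<Rightarrow> 'm) cfunctor" where
  "zero_part_functor = \<lparr>fobj = zero_part, farr = (\<lambda>M N f. restrict f (grade M 0))\<rparr>"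

lemma zero_part_functor_simps [simp]:
  "fobj zero_part_functor M = zero_part M" "farr zero_part_functor M N f = restrict f (grade M 0)"
  by (simp_all add: zero_part_functor_def)

context unit_degree_one
begin

lemma zero_part_right_module:
  assumes "graded_module A \<A> M"
  shows "right_module R (zero_part M)"
proof -
  interpret M: gmodule A \<A> M using assms by (simp add: graded_module_iff_gmodule)
  have "abelian_group (zero_part M)"
  proof (rule abelian_groupI)
    show "\<exists>y\<in>carrier (zero_part M). y \<oplus>\<^bsub>zero_part M\<^esub> x = \<zero>\<^bsub>zero_part M\<^esub>"
      if "x \<in> carrier (zero_part M)" for x
      using that M.D_neg M.M.l_neg M.D_carrier by (metis zero_part_simps)
  qed (auto simp: M.D_add M.D_carrier M.M.a_ac)
  then show ?thesis
    using ring_R M.ract_grade[of _ 0 _ 0]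
    by (auto simp: right_module_def M.D_carrier M.ract_add_left M.ract_add_right M.ract_mult R_mult)
qed

lemma zero_part_hom:
  assumes M: "graded_module A \<A> M" and f: "f \<in> gmod_hom A M N"
  shows "restrict f (grade M 0) \<in> rmod_hom R (zero_part M) (zero_part N)"
proof -
  interpret M: gmodule A \<A> M using M by (simp add: graded_module_iff_gmodule)
  show ?thesis
    using rmod_homD[OF gmod_homD(1)[OF f]] gmod_homD(4)[OF f] M.ract_grade[of _ 0 _ 0]
    by (auto simp: rmod_hom_def M.D_add M.D_carrier)
qed

lemma homogeneous_eq_zero_part:
  assumes "graded_module A \<A> M" "x \<in> grade M n"
  shows "ract M x (tp (- n)) \<in> grade M 0" "ract M (ract M x (tp (- n))) (tp n) = x"
proof -
  interpret M: gmodule A \<A> M using assms by (simp add: graded_module_iff_gmodule)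
  show "ract M x (tp (- n)) \<in> grade M 0" using M.ract_grade[OF assms(2) tp_degree, of "- n"] by simp
  show "ract M (ract M x (tp (- n))) (tp n) = x"
    using M.D_carrier[OF assms(2)] by (simp flip: M.ract_mult)
qed

text \<open>
  A homomorphism is determined by its restriction to degree zero, since \<open>x = (x t\<^sup>-\<^sup>n) t\<^sup>n\<close> for \<open>x\<close> of
  degree \<open>n\<close>.
\<close>

lemma zero_part_faithful:
  assumes M: "graded_module A \<A> M" and N: "graded_module A \<A> N"
    and fg: "f \<in> gmod_hom A M N" "g \<in> gmod_hom A M N" and eq: "\<And>x. x \<in> grade M 0 \<Longrightarrow> f x = g x"
  shows "f = g"
proof -
  interpret M: gmodule A \<A> M using M by (simp add: graded_module_iff_gmodule)
  interpret N: gmodule A \<A> N using N by (simp add: graded_module_iff_gmodule)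
  note f = rmod_homD[OF gmod_homD(1)[OF fg(1)]] and g = rmod_homD[OF gmod_homD(1)[OF fg(2)]]
  have "f x = g x" if "x \<in> grade M n" for x n
  proof -
    note h = homogeneous_eq_zero_part[OF M that]
    have "f (ract M (ract M x (tp (- n))) (tp n)) = g (ract M (ract M x (tp (- n))) (tp n))"
      using f(5) g(5) eq[OF h(1)] M.D_carrier[OF h(1)] by simp
    then show ?thesis unfolding h(2) .
  qed
  then have "f x = g x" if "x \<in> carrier M" for x
    using M.additive_eqI[OF N.M.abelian_group_axioms f(2) g(2) _ that] by blast
  then show ?thesis using f(1) g(1) by (intro extensionalityI) auto
qed

text \<open>
  The extension of \<open>f\<close> must be \<open>x \<mapsto> f (x t\<^sup>-\<^sup>n) t\<^sup>n\<close> on elements of degree \<open>n\<close>.  It is compatible with the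
  action of \<open>a \<in> \<A> m\<close> because \<open>x a t\<^sup>-\<^sup>n\<^sup>-\<^sup>m = (x t\<^sup>-\<^sup>n) (t\<^sup>n a t\<^sup>-\<^sup>n\<^sup>-\<^sup>m)\<close>, where the last factor has degree
  zero and is moved through \<open>f\<close>.
\<close>

lemma zero_part_full:
  assumes M: "graded_module A \<A> M" and N: "graded_module A \<A> N"
    and f: "f \<in> rmod_hom R (zero_part M) (zero_part N)"
  shows "\<exists>g\<in>gmod_hom A M N. restrict g (grade M 0) = f"
proof -
  interpret M: gmodule A \<A> M using M by (simp add: graded_module_iff_gmodule)
  interpret N: gmodule A \<A> N using N by (simp add: graded_module_iff_gmodule)
  have f0: "f x \<in> grade N 0" "f x \<in> carrier N" if "x \<in> grade M 0" for x
    using rmod_homD(3)[OF f] that N.D_carrier by auto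
  have fadd: "f (x \<oplus>\<^bsub>M\<^esub> y) = f x \<oplus>\<^bsub>N\<^esub> f y" if "x \<in> grade M 0" "y \<in> grade M 0" for x y
    using rmod_homD(4)[OF f] that by simp
  have fact: "f (ract M x a) = ract N (f x) a" if "x \<in> grade M 0" "a \<in> \<A> 0" for x a
    using rmod_homD(5)[OF f] that by simp
  define \<phi> where "\<phi> n x = ract N (f (ract M x (tp (- n)))) (tp n)" for n x
  note z = homogeneous_eq_zero_part[OF M]
  have \<phi>_grade: "\<phi> n x \<in> grade N n" if "x \<in> grade M n" for n x
    using N.ract_grade[OF f0(1)[OF z(1)[OF that]] tp_degree, of n] by (simp add: \<phi>_def)
  have \<phi>_add: "additive_on (grade M n) M N (\<phi> n)" for n
    by (rule additive_onI)
      (use N.D_carrier[OF \<phi>_grade] z(1) f0(2) M.D_carrier in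
        \<open>auto simp: \<phi>_def M.ract_add_left fadd N.ract_add_left\<close>)
  define g where "g = M.glue N \<phi>"
  have g_add: "additive_on (carrier M) M N g"
    and g_hom: "\<And>x n. x \<in> grade M n \<Longrightarrow> g x = \<phi> n x"
    unfolding g_def using M.glue_additive[OF N.M.abelian_group_axioms \<phi>_add]
      M.glue_homogeneous[OF N.M.abelian_group_axioms \<phi>_add] by blast+
  have act_hom: "g (ract M x a) = ract N (g x) a" if x: "x \<in> grade M n" and a: "a \<in> \<A> m" for x n a m
  proof -
    have xc: "x \<in> carrier M" "a \<in> carrier A" using x a M.D_carrier A.D_carrier by auto
    \<comment> \<open>The factor \<open>t\<^sup>n a t\<^sup>-\<^sup>n\<^sup>-\<^sup>m\<close> of degree zero that \<open>f\<close> is linear for.\<close>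
    let ?b = "tp n \<otimes> a \<otimes> tp (- (n + m))"
    have b: "?b \<in> \<A> 0" using grade_tp(1)[OF grade_tp(2)[OF a, of n], of "- (n + m)"] by simp
    have 1: "ract M (ract M x a) (tp (- (n + m))) = ract M (ract M x (tp (- n))) ?b"
      using xc by (simp add: m_assoc flip: M.ract_mult)
    have 2: "?b \<otimes> tp (n + m) = tp n \<otimes> a"
      using xc tp_cancel(2)[of "tp n \<otimes> a" "n + m"] by simp
    have "g (ract M x a) = ract N (f (ract M (ract M x (tp (- n))) ?b)) (tp (n + m))"
      using g_hom[OF M.ract_grade[OF x a]] 1 by (simp add: \<phi>_def)
    also have "\<dots> = ract N (f (ract M x (tp (- n)))) (?b \<otimes> tp (n + m))"
      using fact[OF z(1)[OF x] b] f0(2)[OF z(1)[OF x]] b by (simp add: N.ract_mult)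
    also have "\<dots> = ract N (g x) a"
      unfolding 2 using f0(2)[OF z(1)[OF x]] xc by (simp add: g_hom[OF x] \<phi>_def N.ract_mult)
    finally show ?thesis .
  qed
  have gc: "g x \<in> carrier N" if "x \<in> carrier M" for x using additive_on_closed[OF g_add that] .
  have act_left: "g (ract M x a) = ract N (g x) a" if x: "x \<in> grade M n" and a: "a \<in> carrier A" for x n a
  proof (rule A.additive_eqI[OF N.M.abelian_group_axioms _ _ _ a])
    have xc: "x \<in> carrier M" using x M.D_carrier by blast
    show "additive_on (carrier A) A N (\<lambda>a. g (ract M x a))"
      by (rule additive_onI) (simp_all add: xc gc M.ract_add_right additive_on_add[OF g_add])
    show "additive_on (carrier A) A N (\<lambda>a. ract N (g x) a)"
      by (rule additive_onI) (simp_all add: xc gc N.ract_add_right)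
  qed (rule act_hom[OF x])
  have act: "g (ract M x a) = ract N (g x) a" if x: "x \<in> carrier M" and a: "a \<in> carrier A" for x a
  proof (rule M.additive_eqI[OF N.M.abelian_group_axioms _ _ _ x])
    show "additive_on (carrier M) M N (\<lambda>x. g (ract M x a))"
      by (rule additive_onI) (simp_all add: a gc M.ract_add_left additive_on_add[OF g_add])
    show "additive_on (carrier M) M N (\<lambda>x. ract N (g x) a)"
      by (rule additive_onI) (simp_all add: a gc N.ract_add_left additive_on_add[OF g_add])
  qed (rule act_left[OF _ a])
  have "restrict g (carrier M) \<in> gmod_hom A M N"
    using act gc additive_on_add[OF g_add] \<phi>_grade g_hom M.D_carrier
    by (auto simp: gmod_hom_iff rmod_hom_def)
  moreover have "restrict (restrict g (carrier M)) (grade M 0) = f"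
  proof (rule extensionalityI[where A = "grade M 0"])
    show "f \<in> extensional (grade M 0)" using rmod_homD(1)[OF f] by simp
    show "restrict (restrict g (carrier M)) (grade M 0) x = f x" if "x \<in> grade M 0" for x
      using that M.D_carrier[OF that] f0 by (simp add: g_hom[OF that] \<phi>_def)
  qed (rule restrict_extensional)
  ultimately show ?thesis by blast
qed

lemma zero_part_bij:
  assumes "graded_module A \<A> M" "graded_module A \<A> N"
  shows "bij_betw (\<lambda>f. restrict f (grade M 0)) (gmod_hom A M N) (rmod_hom R (zero_part M) (zero_part N))"
proof -
  have "inj_on (\<lambda>f. restrict f (grade M 0)) (gmod_hom A M N)"
    by (rule inj_onI) (metis (no_types, lifting) assms restrict_apply' zero_part_faithful)
  then show ?thesis
    using zero_part_hom[OF assms(1)] zero_part_full[OF assms] by (force simp: bij_betw_def)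
qed

lemma zero_part_is_functor: "is_functor (Gr A \<A>) (Mod_cat R) zero_part_functor"
  unfolding is_functor_def
proof (intro conjI ballI category_Gr category_Mod_cat)
  fix L M N f g
  assume L: "L \<in> Obj (Gr A \<A>)" and f: "f \<in> Hom (Gr A \<A>) L M" and g: "g \<in> Hom (Gr A \<A>) M N"
  interpret L: gmodule A \<A> L using L by (simp add: graded_module_iff_gmodule)
  show "farr zero_part_functor L N (Cmp (Gr A \<A>) L M N g f) =
    Cmp (Mod_cat R) (fobj zero_part_functor L) (fobj zero_part_functor M) (fobj zero_part_functor N)
     (farr zero_part_functor M N g) (farr zero_part_functor L M f)"
    using gmod_homD(4)[of f A L M _ 0] f L.D_carrier by (auto simp: compose_def fun_eq_iff)
next
  fix M assume "M \<in> Obj (Gr A \<A>)"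
  then interpret M: gmodule A \<A> M by (simp add: graded_module_iff_gmodule)
  show "farr zero_part_functor M M (Idn (Gr A \<A>) M) = Idn (Mod_cat R) (fobj zero_part_functor M)"
    using M.D_carrier by (auto simp: fun_eq_iff)
qed (auto simp: zero_part_right_module zero_part_hom)

text \<open>Multiplication by the unit of degree one identifies the components of degrees 0 and 1.\<close>

lemma zero_part_shift:
  "naturally_isomorphic (Gr A \<A> :: (('a, 'm) gmod, 'm \<Rightarrow> 'm) cat) (Mod_cat R)
     (zero_part_functor \<circ>F shift_functor) (pullback_functor \<gamma> \<circ>F zero_part_functor)"
proof -
  let ?Z = "zero_part_functor :: (('a, 'm) gmod, 'm \<Rightarrow> 'm, ('a, 'm) rmod, 'm \<Rightarrow> 'm) cfunctor"
  let ?P = "pullback_functor \<gamma> :: (('a, 'm) rmod, 'm \<Rightarrow> 'm, ('a, 'm) rmod, 'm \<Rightarrow> 'm) cfunctor"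
  let ?S = "shift_functor :: (('a, 'm) gmod, 'm \<Rightarrow> 'm, ('a, 'm) gmod, 'm \<Rightarrow> 'm) cfunctor"
  have P: "is_functor (Mod_cat R) (Mod_cat R) ?P"
    using ffes_functor[OF pullback_equivalence[OF ring_R \<gamma>_ring_iso]] .
  have S: "is_functor (Gr A \<A>) (Gr A \<A>) ?S" using ffes_functor[OF shift_equivalence] .
  have PZ: "is_functor (Gr A \<A>) (Mod_cat R) (?P \<circ>F ?Z)" "is_functor (Gr A \<A>) (Mod_cat R) (?Z \<circ>F ?S)"
    using functor_comp_functor zero_part_is_functor P S by blast+
  define \<theta> where "\<theta> M = restrict (\<lambda>x. ract M x t) (grade M 0)" for M :: "('a, 'm) gmod"
  have PZo: "carrier (fobj (?P \<circ>F ?Z) M) = grade M 0" "add (fobj (?P \<circ>F ?Z) M) = add M"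
    "ract (fobj (?P \<circ>F ?Z) M) x a = ract M x (\<gamma> a)" "farr (?P \<circ>F ?Z) M N f = restrict f (grade M 0)"
    for M N x a f
    by (simp_all add: comp_functor_def pullback_functor_def)
  have ZSo: "carrier (fobj (?Z \<circ>F ?S) M) = grade M 1" "add (fobj (?Z \<circ>F ?S) M) = add M"
    "ract (fobj (?Z \<circ>F ?S) M) = ract M" "farr (?Z \<circ>F ?S) M N f = restrict f (grade M 1)"
    for M N f
    by (simp_all add: comp_functor_def shift_functor_def)
  show ?thesis
  proof (rule naturally_isomorphic_by_transport[OF PZ(1), where \<theta> = \<theta>])
    fix M assume M: "M \<in> Obj (Gr A \<A> :: (('a, 'm) gmod, 'm \<Rightarrow> 'm) cat)"
    then interpret M: gmodule A \<A> M by (simp add: graded_module_iff_gmodule)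
    show "fobj (?Z \<circ>F ?S) M \<in> Obj (Mod_cat R)" using functor_obj[OF PZ(2) M] .
    have x1: "ract M x t \<in> grade M 1" if "x \<in> grade M 0" for x
      using M.ract_grade[OF that t_degree] by simp
    have "\<theta> M \<in> rmod_hom R (fobj (?P \<circ>F ?Z) M) (fobj (?Z \<circ>F ?S) M)"
    proof -
      have "ract M (ract M x (\<gamma> a)) t = ract M (ract M x t) a" if "x \<in> grade M 0" "a \<in> \<A> 0" for x a
        using that M.D_carrier \<gamma>_comm by (simp flip: M.ract_mult)
      then show ?thesis
        using x1 M.ract_grade[of _ 0 _ 0]
        by (auto simp: rmod_hom_def PZo ZSo \<theta>_def M.D_add M.D_carrier M.ract_add_left)
    qed
    moreover have "bij_betw (\<theta> M) (grade M 0) (grade M 1)"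
    proof (rule bij_betw_byWitness[where f' = "\<lambda>x. ract M x (tp (- 1))"])
      show "\<forall>x\<in>grade M 0. ract M (\<theta> M x) (tp (- 1)) = x"
        using M.D_carrier tp_inverse(1)[of 1] by (simp add: \<theta>_def flip: M.ract_mult)
      show "\<forall>x\<in>grade M 1. \<theta> M (ract M x (tp (- 1))) = x"
        using homogeneous_eq_zero_part[of M _ 1] M by (simp add: \<theta>_def)
      show "\<theta> M ` grade M 0 \<subseteq> grade M 1" using x1 by (auto simp: \<theta>_def)
      show "(\<lambda>x. ract M x (tp (- 1))) ` grade M 1 \<subseteq> grade M 0"
        using homogeneous_eq_zero_part[of M _ 1] M by auto
    qed
    ultimately show "iso_arrow (Mod_cat R) (fobj (?P \<circ>F ?Z) M) (fobj (?Z \<circ>F ?S) M) (\<theta> M)"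
      using functor_obj[OF PZ(1) M] by (intro iso_arrow_Mod_cat) (simp_all add: PZo ZSo)
    fix N f assume N: "N \<in> Obj (Gr A \<A> :: (('a, 'm) gmod, 'm \<Rightarrow> 'm) cat)" and f: "f \<in> Hom (Gr A \<A>) M N"
    show "farr (?Z \<circ>F ?S) M N f \<in> Hom (Mod_cat R) (fobj (?Z \<circ>F ?S) M) (fobj (?Z \<circ>F ?S) N)"
      using functor_hom[OF PZ(2) M N f] .
    have "f (ract M x t) = ract N (f x) t" "f x \<in> grade N 0" if "x \<in> grade M 0" for x
      using rmod_homD(5)[OF gmod_homD(1), of f A M N x t] gmod_homD(4)[of f A M N x 0] f M.D_carrier[OF that] that
      by simp_all
    then show "Cmp (Mod_cat R) (fobj (?P \<circ>F ?Z) M) (fobj (?Z \<circ>F ?S) M) (fobj (?Z \<circ>F ?S) N)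
        (farr (?Z \<circ>F ?S) M N f) (\<theta> M) =
       Cmp (Mod_cat R) (fobj (?P \<circ>F ?Z) M) (fobj (?P \<circ>F ?Z) N) (fobj (?Z \<circ>F ?S) N)
        (\<theta> N) (farr (?P \<circ>F ?Z) M N f)"
      using x1 by (auto simp: compose_def PZo ZSo \<theta>_def fun_eq_iff)
  qed
qed

end

section \<open>Coinduced modules\<close>

text \<open>
  A finitely supported function is determined by the finite set of pairs \<open>(n, f n)\<close> with \<open>f n \<noteq> z\<close>,
  and an infinite type has as many elements as there are finite sets of pairs of integers and elements.
\<close>

lemma finitely_supported_functions_inject:
  assumes "infinite (UNIV :: 'm set)"
  shows "\<exists>j :: (int \<Rightarrow> 'm) \<Rightarrow> 'm. inj_on j {f. finite {n. f n \<noteq> z}}"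
proof -
  have inf: "infinite ((UNIV :: int set) \<times> (UNIV :: 'm set))"
    using assms finite_cartesian_productD2[of "UNIV :: int set" "UNIV :: 'm set"] by auto
  have "{f :: int \<Rightarrow> 'm. finite {n. f n \<noteq> z}} \<lesssim> Fpow ((UNIV :: int set) \<times> (UNIV :: 'm set))"
    using lepoll_restricted_funspace[of "UNIV :: int set" "UNIV :: 'm set" "\<lambda>_. z"] by simp
  also have "\<dots> \<approx> (UNIV :: int set) \<times> (UNIV :: 'm set)"
    by (rule eqpoll_Fpow[OF inf])
  also have "\<dots> \<lesssim> (UNIV :: 'm set)"
  proof -
    have "|UNIV :: int set| \<le>o |UNIV :: 'm set|"
      using infinite_iff_card_of_countable[of "UNIV :: int set" "UNIV :: 'm set"] assms by simp
    then have "|(UNIV :: int set) \<times> (UNIV :: 'm set)| \<le>o |UNIV :: 'm set|"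
      using assms card_of_mono1[OF subset_refl] by (intro card_of_Times_ordLeq_infinite)
    then show ?thesis by (simp add: lepoll_def card_of_ordLeq[symmetric])
  qed
  finally show ?thesis by (simp add: lepoll_def)
qed

text \<open>
  A graded \<open>A\<close>-module with prescribed component \<open>N\<close> of degree zero is found inside the group of
  \<open>A\<^sub>0\<close>-linear maps \<open>A \<rightarrow> N\<close>.  There an element \<open>a\<close> of \<open>A\<close> acts by precomposition with left multiplication
  by \<open>a\<close>, so associativity of the action is associativity of \<open>A\<close>; for \<open>N \<otimes> A\<close> it would have to be
  derived from the presentation.  The maps that vanish on almost all components form a submodule
  that is the direct sum of its homogeneous parts.
\<close>

locale coinduction_ctx = unit_degree_one K A \<A> t R \<gamma> + N: rmodule R N
  for K :: "'k ring" and A :: "('k, 'a) module" (structure) and \<A> :: "int \<Rightarrow> 'a set"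
    and t :: 'a and R :: "('k, 'a) module" and \<gamma> :: "'a \<Rightarrow> 'a" and N :: "('a, 'm) rmod"
begin

definition supp :: "('a \<Rightarrow> 'm) \<Rightarrow> int set" where
  "supp \<phi> = {n. \<exists>x\<in>\<A> n. \<phi> x \<noteq> \<zero>\<^bsub>N\<^esub>}"

definition finite_homs :: "('a \<Rightarrow> 'm) set" where
  "finite_homs = {\<phi> \<in> extensional (carrier A). additive_on (carrier A) A N \<phi> \<and>
     (\<forall>x\<in>carrier A. \<forall>a\<in>\<A> 0. \<phi> (x \<otimes> a) = ract N (\<phi> x) a) \<and> finite (supp \<phi>)}"

text \<open>
  Multiplication by an element of degree \<open>m\<close> moves the support of a map by \<open>- m\<close>; hence the maps
  supported in degree \<open>- n\<close> are given degree \<open>n\<close>.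
\<close>

definition coinduced :: "('a, 'a \<Rightarrow> 'm) gmod" where
  "coinduced = \<lparr>carrier = finite_homs, monoid.mult = undefined, one = undefined,
     ring.zero = restrict (\<lambda>_. \<zero>\<^bsub>N\<^esub>) (carrier A),
     add = (\<lambda>\<phi> \<psi>. restrict (\<lambda>x. \<phi> x \<oplus>\<^bsub>N\<^esub> \<psi> x) (carrier A)),
     ract = (\<lambda>\<phi> a. restrict (\<lambda>x. \<phi> (a \<otimes> x)) (carrier A)),
     grade = (\<lambda>n. {\<phi> \<in> finite_homs. supp \<phi> \<subseteq> {- n}})\<rparr>"

lemma coinduced_simps [simp]:
  "carrier coinduced = finite_homs" "\<zero>\<^bsub>coinduced\<^esub> = restrict (\<lambda>_. \<zero>\<^bsub>N\<^esub>) (carrier A)"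
  "\<phi> \<oplus>\<^bsub>coinduced\<^esub> \<psi> = restrict (\<lambda>x. \<phi> x \<oplus>\<^bsub>N\<^esub> \<psi> x) (carrier A)"
  "ract coinduced \<phi> a = restrict (\<lambda>x. \<phi> (a \<otimes> x)) (carrier A)"
  "grade coinduced n = {\<phi> \<in> finite_homs. supp \<phi> \<subseteq> {- n}}"
  by (simp_all add: coinduced_def)

lemma finite_homsD:
  assumes "\<phi> \<in> finite_homs"
  shows "\<phi> \<in> extensional (carrier A)" "additive_on (carrier A) A N \<phi>"
    "x \<in> carrier A \<Longrightarrow> \<phi> x \<in> carrier N"
    "x \<in> carrier A \<Longrightarrow> y \<in> carrier A \<Longrightarrow> \<phi> (x \<oplus> y) = \<phi> x \<oplus>\<^bsub>N\<^esub> \<phi> y"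
    "x \<in> carrier A \<Longrightarrow> a \<in> \<A> 0 \<Longrightarrow> \<phi> (x \<otimes> a) = ract N (\<phi> x) a"
    "finite (supp \<phi>)" "\<phi> \<zero> = \<zero>\<^bsub>N\<^esub>"
  using assms additive_on_zero[OF abelian_group_axioms N.M.abelian_group_axioms, of "carrier A" \<phi>]
  by (auto simp: finite_homs_def additive_on_def)

lemma finite_homsI:
  assumes "\<And>x. x \<in> carrier A \<Longrightarrow> f x \<in> carrier N"
    "\<And>x y. x \<in> carrier A \<Longrightarrow> y \<in> carrier A \<Longrightarrow> f (x \<oplus> y) = f x \<oplus>\<^bsub>N\<^esub> f y"
    "\<And>x a. x \<in> carrier A \<Longrightarrow> a \<in> \<A> 0 \<Longrightarrow> f (x \<otimes> a) = ract N (f x) a"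
    "finite S" "\<And>n x. n \<notin> S \<Longrightarrow> x \<in> \<A> n \<Longrightarrow> f x = \<zero>\<^bsub>N\<^esub>"
  shows "restrict f (carrier A) \<in> finite_homs \<and> supp (restrict f (carrier A)) \<subseteq> S"
proof
  show s: "supp (restrict f (carrier A)) \<subseteq> S"
    using assms(5) A.D_carrier by (auto simp: supp_def)
  show "restrict f (carrier A) \<in> finite_homs"
    using assms(1-3) finite_subset[OF s assms(4)] by (auto simp: finite_homs_def additive_on_def)
qed

lemma supp_zero: "\<phi> \<in> finite_homs \<Longrightarrow> n \<notin> supp \<phi> \<Longrightarrow> x \<in> \<A> n \<Longrightarrow> \<phi> x = \<zero>\<^bsub>N\<^esub>"
  by (auto simp: supp_def)

lemma finite_homs_eqI:
  assumes "\<phi> \<in> finite_homs" "\<psi> \<in> finite_homs" "\<And>n x. x \<in> \<A> n \<Longrightarrow> \<phi> x = \<psi> x"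
  shows "\<phi> = \<psi>"
proof (rule extensionalityI)
  show "\<phi> \<in> extensional (carrier A)" "\<psi> \<in> extensional (carrier A)"
    using assms finite_homsD(1) by blast+
  show "\<phi> x = \<psi> x" if "x \<in> carrier A" for x
    by (rule A.additive_eqI[OF N.M.abelian_group_axioms finite_homsD(2)[OF assms(1)]
          finite_homsD(2)[OF assms(2)] assms(3) that])
qed

lemma zero_hom: "restrict (\<lambda>_. \<zero>\<^bsub>N\<^esub>) (carrier A) \<in> finite_homs"
  by (rule finite_homsI[where S = "{}", THEN conjunct1]) auto

lemma add_hom:
  assumes "\<phi> \<in> finite_homs" "\<psi> \<in> finite_homs"
  shows "restrict (\<lambda>x. \<phi> x \<oplus>\<^bsub>N\<^esub> \<psi> x) (carrier A) \<in> finite_homs \<and>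
    supp (restrict (\<lambda>x. \<phi> x \<oplus>\<^bsub>N\<^esub> \<psi> x) (carrier A)) \<subseteq> supp \<phi> \<union> supp \<psi>"
proof (rule finite_homsI)
  note p = finite_homsD[OF assms(1)] and q = finite_homsD[OF assms(2)]
  show "\<phi> x \<oplus>\<^bsub>N\<^esub> \<psi> x = \<zero>\<^bsub>N\<^esub>" if "n \<notin> supp \<phi> \<union> supp \<psi>" "x \<in> \<A> n" for n x
    using that supp_zero[OF assms(1) _ that(2)] supp_zero[OF assms(2) _ that(2)] by simp
qed (use finite_homsD[OF assms(1)] finite_homsD[OF assms(2)] in
  \<open>simp_all add: N.M.a_ac N.ract_add_left\<close>)

lemma neg_hom:
  assumes "\<phi> \<in> finite_homs"
  shows "restrict (\<lambda>x. \<ominus>\<^bsub>N\<^esub> \<phi> x) (carrier A) \<in> finite_homs \<and>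
    supp (restrict (\<lambda>x. \<ominus>\<^bsub>N\<^esub> \<phi> x) (carrier A)) \<subseteq> supp \<phi>"
proof (rule finite_homsI)
  note p = finite_homsD[OF assms]
  show "\<ominus>\<^bsub>N\<^esub> \<phi> (x \<otimes> a) = ract N (\<ominus>\<^bsub>N\<^esub> \<phi> x) a" if "x \<in> carrier A" "a \<in> \<A> 0" for x a
  proof (rule N.M.minus_equality)
    show "ract N (\<ominus>\<^bsub>N\<^esub> \<phi> x) a \<oplus>\<^bsub>N\<^esub> \<phi> (x \<otimes> a) = \<zero>\<^bsub>N\<^esub>"
      using that p N.ract_add_left[of "\<ominus>\<^bsub>N\<^esub> \<phi> x" "\<phi> x" a] by (simp add: N.M.l_neg)
  qed (use that p in simp_all)
  show "\<ominus>\<^bsub>N\<^esub> \<phi> x = \<zero>\<^bsub>N\<^esub>" if "n \<notin> supp \<phi>" "x \<in> \<A> n" for n x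
    using supp_zero[OF assms that] by simp
qed (use finite_homsD[OF assms] in \<open>simp_all add: N.M.minus_add\<close>)

lemma act_hom_homogeneous:
  assumes "\<phi> \<in> finite_homs" "a \<in> \<A> k"
  shows "restrict (\<lambda>x. \<phi> (a \<otimes> x)) (carrier A) \<in> finite_homs \<and>
    supp (restrict (\<lambda>x. \<phi> (a \<otimes> x)) (carrier A)) \<subseteq> (\<lambda>n. n - k) ` supp \<phi>"
proof (rule finite_homsI)
  have a: "a \<in> carrier A" using assms A.D_carrier by blast
  note p = finite_homsD[OF assms(1)]
  show "\<phi> (a \<otimes> x) = \<zero>\<^bsub>N\<^esub>" if "n \<notin> (\<lambda>n. n - k) ` supp \<phi>" "x \<in> \<A> n" for n x
  proof (rule supp_zero[OF assms(1) _ grade_mult[OF assms(2) that(2)]])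
    show "k + n \<notin> supp \<phi>" using that(1) by (force simp: image_iff)
  qed
  show "\<phi> (a \<otimes> x) \<in> carrier N" if "x \<in> carrier A" for x using that a p by simp
  show "\<phi> (a \<otimes> (x \<oplus> y)) = \<phi> (a \<otimes> x) \<oplus>\<^bsub>N\<^esub> \<phi> (a \<otimes> y)" if "x \<in> carrier A" "y \<in> carrier A" for x y
    using that a p by (simp add: r_distr)
  show "\<phi> (a \<otimes> (x \<otimes> b)) = ract N (\<phi> (a \<otimes> x)) b" if "x \<in> carrier A" "b \<in> \<A> 0" for x b
    using that a p(5)[of "a \<otimes> x" b] by (simp add: m_assoc)
qed (use finite_homsD(6)[OF assms(1)] in simp)

text \<open>
  Elements of \<open>A\<close> need not be homogeneous, so that finiteness of the support is shown by adding up
  homogeneous elements, each of which merely shifts the support.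
\<close>

lemma act_hom:
  assumes "\<phi> \<in> finite_homs" "a \<in> carrier A"
  shows "restrict (\<lambda>x. \<phi> (a \<otimes> x)) (carrier A) \<in> finite_homs"
  using assms(2)
proof (induction a rule: A.homogeneous_induct)
  case zero
  have "restrict (\<lambda>x. \<phi> (\<zero> \<otimes> x)) (carrier A) = restrict (\<lambda>_. \<zero>\<^bsub>N\<^esub>) (carrier A)"
    by (rule restrict_ext) (simp add: finite_homsD(7)[OF assms(1)])
  then show ?case using zero_hom by (simp only:)
next
  case (homogeneous n a)
  then show ?case by (rule act_hom_homogeneous[OF assms(1), THEN conjunct1])
next
  case (add a b)
  have "restrict (\<lambda>x. \<phi> ((a \<oplus> b) \<otimes> x)) (carrier A) =
      restrict (\<lambda>x. restrict (\<lambda>x. \<phi> (a \<otimes> x)) (carrier A) x \<oplus>\<^bsub>N\<^esub>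
        restrict (\<lambda>x. \<phi> (b \<otimes> x)) (carrier A) x) (carrier A)"
    by (rule restrict_ext) (use add(1,2) in \<open>simp add: l_distr finite_homsD(4)[OF assms(1)]\<close>)
  then show ?case using add_hom[OF add(3,4)] by (simp only:)
qed

lemma coinduced_abelian_group: "abelian_group coinduced"
proof (rule abelian_groupI)
  fix \<phi> assume "\<phi> \<in> carrier coinduced"
  then have \<phi>: "\<phi> \<in> finite_homs" by simp
  note p = finite_homsD[OF \<phi>]
  show "\<zero>\<^bsub>coinduced\<^esub> \<oplus>\<^bsub>coinduced\<^esub> \<phi> = \<phi>"
    using p by (intro extensionalityI[where A = "carrier A"]) simp_all
  have "restrict (\<lambda>x. \<ominus>\<^bsub>N\<^esub> \<phi> x) (carrier A) \<oplus>\<^bsub>coinduced\<^esub> \<phi> = \<zero>\<^bsub>coinduced\<^esub>"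
    by (simp, rule restrict_ext) (use p in \<open>simp add: N.M.l_neg\<close>)
  then show "\<exists>\<psi>\<in>carrier coinduced. \<psi> \<oplus>\<^bsub>coinduced\<^esub> \<phi> = \<zero>\<^bsub>coinduced\<^esub>"
    using neg_hom[OF \<phi>, THEN conjunct1] by (metis coinduced_simps(1))
  fix \<psi> assume "\<psi> \<in> carrier coinduced"
  then have \<psi>: "\<psi> \<in> finite_homs" by simp
  note q = finite_homsD[OF \<psi>]
  show "\<phi> \<oplus>\<^bsub>coinduced\<^esub> \<psi> \<in> carrier coinduced" using add_hom[OF \<phi> \<psi>] by simp
  show "\<phi> \<oplus>\<^bsub>coinduced\<^esub> \<psi> = \<psi> \<oplus>\<^bsub>coinduced\<^esub> \<phi>"
    by (simp, rule restrict_ext) (use p q in \<open>simp add: N.M.a_comm\<close>)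
  fix \<chi> assume "\<chi> \<in> carrier coinduced"
  then have \<chi>: "\<chi> \<in> finite_homs" by simp
  show "\<phi> \<oplus>\<^bsub>coinduced\<^esub> \<psi> \<oplus>\<^bsub>coinduced\<^esub> \<chi> = \<phi> \<oplus>\<^bsub>coinduced\<^esub> (\<psi> \<oplus>\<^bsub>coinduced\<^esub> \<chi>)"
    by (simp, rule restrict_ext) (use p q finite_homsD[OF \<chi>] in \<open>simp add: N.M.a_assoc\<close>)
qed (simp add: zero_hom)

lemma coinduced_right_module: "right_module A coinduced"
  unfolding right_module_def
proof (intro conjI ballI ring_axioms coinduced_abelian_group)
  fix \<phi> assume "\<phi> \<in> carrier coinduced"
  then have \<phi>: "\<phi> \<in> finite_homs" by simp
  note p = finite_homsD[OF \<phi>]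
  show "ract coinduced \<phi> \<one> = \<phi>"
    using p by (intro extensionalityI[where A = "carrier A"]) simp_all
  fix a assume a: "a \<in> carrier A"
  show "ract coinduced \<phi> a \<in> carrier coinduced" using act_hom[OF \<phi> a] by simp
  show "ract coinduced (\<phi> \<oplus>\<^bsub>coinduced\<^esub> \<psi>) a = ract coinduced \<phi> a \<oplus>\<^bsub>coinduced\<^esub> ract coinduced \<psi> a" for \<psi>
    by (simp, rule restrict_ext) (use a in simp)
  fix b assume b: "b \<in> carrier A"
  show "ract coinduced \<phi> (a \<oplus> b) = ract coinduced \<phi> a \<oplus>\<^bsub>coinduced\<^esub> ract coinduced \<phi> b"
    by (simp, rule restrict_ext) (use a b p in \<open>simp add: l_distr\<close>)
  show "ract coinduced \<phi> (a \<otimes> b) = ract coinduced (ract coinduced \<phi> a) b"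
    by (simp, rule restrict_ext) (use a b in \<open>simp add: m_assoc\<close>)
qed

lemma component_hom:
  assumes "\<phi> \<in> finite_homs"
  shows "restrict (\<lambda>x. \<phi> (A.cmp x (- n))) (carrier A) \<in> finite_homs \<and>
    supp (restrict (\<lambda>x. \<phi> (A.cmp x (- n))) (carrier A)) \<subseteq> {- n}"
proof (rule finite_homsI)
  note p = finite_homsD[OF assms]
  show "\<phi> (A.cmp x (- n)) = \<zero>\<^bsub>N\<^esub>" if "m \<notin> {- n}" "x \<in> \<A> m" for m x
    using that p(7) by (simp add: A.components_homogeneous[OF that(2)])
  show "\<phi> (A.cmp (x \<otimes> a) (- n)) = ract N (\<phi> (A.cmp x (- n))) a" if "x \<in> carrier A" "a \<in> \<A> 0" for x a
    using that p(5) by (simp add: component_mult_right[OF that(2)])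
qed (use finite_homsD[OF assms] in \<open>simp_all add: A.components_add\<close>)

text \<open>
  The projection to degree \<open>n\<close> composes a map with the projection of \<open>A\<close> to its component of degree
  \<open>- n\<close>.
\<close>

lemma coinduced_direct_sum: "internal_direct_sum coinduced UNIV (grade coinduced)"
proof (rule internal_direct_sumI[where p = "\<lambda>n \<phi>. restrict (\<lambda>x. \<phi> (A.cmp x (- n))) (carrier A)"])
  interpret C: abelian_group coinduced by (rule coinduced_abelian_group)
  show "additive_subgroup (grade coinduced n) coinduced" for n
  proof (rule additive_subgroupI, rule subgroup.intro)
    show "\<phi> \<otimes>\<^bsub>add_monoid coinduced\<^esub> \<psi> \<in> grade coinduced n"
      if "\<phi> \<in> grade coinduced n" "\<psi> \<in> grade coinduced n" for \<phi> \<psi>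
      using that add_hom[of \<phi> \<psi>] by auto
    show "\<one>\<^bsub>add_monoid coinduced\<^esub> \<in> grade coinduced n"
      using zero_hom by (auto simp: supp_def A.D_carrier)
    show "inv\<^bsub>add_monoid coinduced\<^esub> \<phi> \<in> grade coinduced n" if "\<phi> \<in> grade coinduced n" for \<phi>
    proof -
      have \<phi>: "\<phi> \<in> finite_homs" "supp \<phi> \<subseteq> {- n}" using that by auto
      let ?n = "restrict (\<lambda>x. \<ominus>\<^bsub>N\<^esub> \<phi> x) (carrier A)"
      have "?n \<oplus>\<^bsub>coinduced\<^esub> \<phi> = \<zero>\<^bsub>coinduced\<^esub>"
        by (simp, rule restrict_ext) (use finite_homsD[OF \<phi>(1)] in \<open>simp add: N.M.l_neg\<close>)
      then have "\<ominus>\<^bsub>coinduced\<^esub> \<phi> = ?n"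
        using \<phi> neg_hom[OF \<phi>(1), THEN conjunct1] by (intro C.minus_equality) simp_all
      then show ?thesis using neg_hom[OF \<phi>(1)] \<phi>(2) by (auto simp: a_inv_def)
    qed
  qed auto
  show "additive_on (carrier coinduced) coinduced coinduced (\<lambda>\<phi>. restrict (\<lambda>x. \<phi> (A.cmp x (- n))) (carrier A))" for n
    by (rule additive_onI) (simp_all add: component_hom cong: restrict_cong)
  show "restrict (\<lambda>x. \<phi> (A.cmp x (- n))) (carrier A) = \<phi>" if "\<phi> \<in> grade coinduced n" for n \<phi>
  proof (rule finite_homs_eqI)
    have \<phi>: "\<phi> \<in> finite_homs" "supp \<phi> \<subseteq> {- n}" using that by auto
    show "\<phi> \<in> finite_homs" "restrict (\<lambda>x. \<phi> (A.cmp x (- n))) (carrier A) \<in> finite_homs"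
      using component_hom \<phi> by blast+
    show "restrict (\<lambda>x. \<phi> (A.cmp x (- n))) (carrier A) x = \<phi> x" if "x \<in> \<A> m" for x m
    proof (cases "m = - n")
      case True
      then show ?thesis using A.D_carrier[OF that] by (simp add: A.components_homogeneous[OF that])
    next
      case False
      then have "\<phi> x = \<zero>\<^bsub>N\<^esub>" using supp_zero[OF \<phi>(1) _ that] \<phi>(2) by blast
      with False show ?thesis
        using A.D_carrier[OF that] finite_homsD(7)[OF \<phi>(1)] by (simp add: A.components_homogeneous[OF that])
    qed
  qed
  show "restrict (\<lambda>x. \<phi> (A.cmp x (- m))) (carrier A) = \<zero>\<^bsub>coinduced\<^esub>"
    if "\<phi> \<in> grade coinduced n" "m \<noteq> n" for n m \<phi>
  proof -
    have \<phi>: "\<phi> \<in> finite_homs" "- m \<notin> supp \<phi>" using that by auto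
    then show ?thesis
      unfolding coinduced_simps by (intro restrict_ext) (rule supp_zero[OF \<phi> A.component_mem])
  qed
  fix \<phi> assume "\<phi> \<in> carrier coinduced"
  then have \<phi>: "\<phi> \<in> finite_homs" by simp
  show "restrict (\<lambda>x. \<phi> (A.cmp x (- n))) (carrier A) \<in> grade coinduced n" for n
    using component_hom[OF \<phi>] by simp
  let ?p = "\<lambda>n. restrict (\<lambda>x. \<phi> (A.cmp x (- n))) (carrier A)"
  have nz: "{n. ?p n \<noteq> \<zero>\<^bsub>coinduced\<^esub>} \<subseteq> uminus ` supp \<phi>"
  proof
    fix n assume "n \<in> {n. ?p n \<noteq> \<zero>\<^bsub>coinduced\<^esub>}"
    then have "?p n \<noteq> \<zero>\<^bsub>coinduced\<^esub>" by simp
    moreover have "?p n = \<zero>\<^bsub>coinduced\<^esub>" if "- n \<notin> supp \<phi>"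
      unfolding coinduced_simps by (intro restrict_ext) (rule supp_zero[OF \<phi> that A.component_mem])
    ultimately have "- n \<in> supp \<phi>" by blast
    then show "n \<in> uminus ` supp \<phi>" by force
  qed
  then show fin: "finite {n. ?p n \<noteq> \<zero>\<^bsub>coinduced\<^esub>}"
    using finite_homsD(6)[OF \<phi>] finite_subset by blast
  let ?S = "uminus ` supp \<phi>"
  have S: "finite ?S" using finite_homsD(6)[OF \<phi>] by simp
  have pc: "?p n \<in> carrier coinduced" for n using component_hom[OF \<phi>] by simp
  have sum: "fin_sum coinduced ?p = finsum coinduced ?p T" if "finite T" "?S \<subseteq> T" for T
    using nz that pc by (intro C.fin_sum_eq_finsum) auto
  show "fin_sum coinduced ?p = \<phi>"
  proof (rule finite_homs_eqI)
    show "fin_sum coinduced ?p \<in> finite_homs"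
      using C.finsum_closed[of ?p ?S] pc sum[OF S] by simp
    show "\<phi> \<in> finite_homs" by (rule \<phi>)
    fix m x assume x: "x \<in> \<A> m"
    have xc: "x \<in> carrier A" using x A.D_carrier by blast
    \<comment> \<open>The index of the only summand that can be nonzero at \<open>x\<close> is added, as it may lie outside \<open>?S\<close>.\<close>
    let ?T = "insert (- m) ?S"
    have ev: "additive_on (carrier coinduced) coinduced N (\<lambda>\<psi>. \<psi> x)"
      using xc finite_homsD(3) by (intro additive_onI) auto
    have "fin_sum coinduced ?p x = finsum coinduced ?p ?T x" using sum[of ?T, OF _ subset_insertI] S by simp
    also have "\<dots> = (\<Oplus>\<^bsub>N\<^esub>n\<in>?T. ?p n x)"
      by (rule additive_on_finsum[OF C.abelian_group_axioms N.M.abelian_group_axioms ev])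
        (use S in simp, rule Pi_I, rule pc)
    also have "\<dots> = (\<Oplus>\<^bsub>N\<^esub>n\<in>?T. if - m = n then \<phi> x else \<zero>\<^bsub>N\<^esub>)"
      using xc finite_homsD(3,7)[OF \<phi>]
      by (intro N.M.finsum_cong') (auto simp: A.components_homogeneous[OF x])
    also have "\<dots> = \<phi> x"
      using S finite_homsD(3)[OF \<phi> xc] by (subst N.M.finsum_singleton) auto
    finally show "fin_sum coinduced ?p x = \<phi> x" .
  qed
qed (rule coinduced_abelian_group)

lemma coinduced_graded: "graded_module A \<A> coinduced"
  unfolding graded_module_def
proof (intro conjI allI ballI coinduced_right_module coinduced_direct_sum)
  fix n m \<phi> a assume "\<phi> \<in> grade coinduced n" and a: "a \<in> \<A> m"
  then have \<phi>: "\<phi> \<in> finite_homs" "supp \<phi> \<subseteq> {- n}" by auto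
  show "ract coinduced \<phi> a \<in> grade coinduced (n + m)"
    using act_hom_homogeneous[OF \<phi>(1) a] \<phi>(2) by fastforce
qed

definition constant_hom :: "'m \<Rightarrow> 'a \<Rightarrow> 'm" where
  "constant_hom y = restrict (\<lambda>x. ract N y (A.cmp x 0)) (carrier A)"

lemma constant_hom:
  assumes y: "y \<in> carrier N"
  shows "constant_hom y \<in> grade coinduced 0"
proof -
  have c: "A.cmp x 0 \<in> \<A> 0" if "x \<in> carrier A" for x using A.component_mem that .
  have "restrict (\<lambda>x. ract N y (A.cmp x 0)) (carrier A) \<in> finite_homs \<and>
    supp (restrict (\<lambda>x. ract N y (A.cmp x 0)) (carrier A)) \<subseteq> {0}"
  proof (rule finite_homsI)
    show "ract N y (A.cmp x 0) \<in> carrier N" if "x \<in> carrier A" for x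
      using y c[OF that] by simp
    show "ract N y (A.cmp (x \<oplus> z) 0) = ract N y (A.cmp x 0) \<oplus>\<^bsub>N\<^esub> ract N y (A.cmp z 0)"
      if "x \<in> carrier A" "z \<in> carrier A" for x z
      using y that c N.ract_add_right[of y "A.cmp x 0" "A.cmp z 0"] by (simp add: A.components_add)
    show "ract N y (A.cmp (x \<otimes> a) 0) = ract N (ract N y (A.cmp x 0)) a"
      if "x \<in> carrier A" "a \<in> \<A> 0" for x a
      using y that c N.ract_mult[of y "A.cmp x 0" a] by (simp add: component_mult_right[OF that(2)] R_mult)
    show "ract N y (A.cmp x 0) = \<zero>\<^bsub>N\<^esub>" if "n \<notin> {0}" "x \<in> \<A> n" for n x
      using y that N.ract_zero_right by (simp add: A.components_homogeneous[OF that(2)])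
  qed simp
  then show ?thesis by (simp add: constant_hom_def)
qed

lemma constant_hom_one: "y \<in> carrier N \<Longrightarrow> constant_hom y \<one> = y"
  using N.ract_one by (simp add: constant_hom_def A.components_homogeneous[OF one_degree_zero])

text \<open>
  A map supported in degree zero is determined there by its value at \<open>\<one>\<close>, because it is \<open>A\<^sub>0\<close>-linear.
\<close>

lemma constant_hom_unique:
  assumes "\<phi> \<in> grade coinduced 0"
  shows "\<phi> = constant_hom (\<phi> \<one>)"
proof (rule finite_homs_eqI)
  have \<phi>: "\<phi> \<in> finite_homs" "supp \<phi> \<subseteq> {0}" using assms by auto
  have y: "\<phi> \<one> \<in> carrier N" using finite_homsD(3)[OF \<phi>(1)] by simp
  show "\<phi> \<in> finite_homs" "constant_hom (\<phi> \<one>) \<in> finite_homs"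
    using \<phi> constant_hom[OF y] by auto
  show "\<phi> x = constant_hom (\<phi> \<one>) x" if x: "x \<in> \<A> n" for x n
  proof (cases "n = 0")
    case True
    then show ?thesis
      using x finite_homsD(5)[OF \<phi>(1) one_closed, of x]
      by (simp add: constant_hom_def A.components_homogeneous[of x 0])
  next
    case False
    then show ?thesis
      using x A.D_carrier[OF x] supp_zero[OF \<phi>(1) _ x] \<phi>(2) y N.ract_zero_right
      by (auto simp: constant_hom_def A.components_homogeneous[OF x])
  qed
qed

text \<open>
  Since \<open>A\<^sub>n = t\<^sup>n A\<^sub>0\<close>, an \<open>A\<^sub>0\<close>-linear map is determined by its values at the powers of \<open>t\<close>, that is, by a
  finitely supported function on the integers.  If \<open>A\<close> is nonzero, the powers of \<open>t\<close> are distinct and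
  the universe is infinite, so there is room for these functions; if \<open>A\<close> is zero, there is only one map.
\<close>

lemma coinduced_inject:
  assumes \<iota>: "inj_on (\<iota> :: 'a \<Rightarrow> 'm) (carrier A)"
  shows "\<exists>j :: ('a \<Rightarrow> 'm) \<Rightarrow> 'm. inj_on j (carrier coinduced)"
proof (cases "\<one> = \<zero>")
  case True
  have zero: "x = \<zero>" if "x \<in> carrier A" for x
    using True that l_one[OF that] l_null[OF that] by simp
  have "\<phi> = \<psi>" if "\<phi> \<in> finite_homs" "\<psi> \<in> finite_homs" for \<phi> \<psi>
    using that by (rule finite_homs_eqI) (metis A.D_carrier finite_homsD(7) that zero)
  then have "inj_on (\<lambda>_. undefined) (carrier coinduced)" by (auto simp: inj_on_def)
  then show ?thesis by blast
next
  case False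
  have inj: "inj (\<lambda>n. \<iota> (tp n))"
  proof (rule injI)
    fix n m assume "\<iota> (tp n) = \<iota> (tp m)"
    then have "tp n = tp m" using \<iota> by (simp add: inj_on_eq_iff)
    moreover have "tp n \<noteq> \<zero>"
      using False zero_tp[of \<one> n] by auto
    ultimately show "n = m" using A.D_disjoint[of "tp n" n m] tp_degree by metis
  qed
  have inf: "infinite (UNIV :: 'm set)"
  proof
    assume "finite (UNIV :: 'm set)"
    then have "finite (range (\<lambda>n. \<iota> (tp n)))" by (rule finite_subset[OF subset_UNIV])
    then show False using finite_imageD[OF _ inj] infinite_UNIV_int by blast
  qed
  obtain j :: "(int \<Rightarrow> 'm) \<Rightarrow> 'm" where j: "inj_on j {f. finite {n. f n \<noteq> \<zero>\<^bsub>N\<^esub>}}"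
    using finitely_supported_functions_inject[OF inf] by blast
  have "inj_on (\<lambda>\<phi> n. \<phi> (tp n)) (carrier coinduced)"
  proof (rule inj_onI)
    fix \<phi> \<psi> assume "\<phi> \<in> carrier coinduced" "\<psi> \<in> carrier coinduced"
      and eq: "(\<lambda>n. \<phi> (tp n)) = (\<lambda>n. \<psi> (tp n))"
    then have h: "\<phi> \<in> finite_homs" "\<psi> \<in> finite_homs" by simp_all
    show "\<phi> = \<psi>"
    proof (rule finite_homs_eqI[OF h])
      fix n x assume x: "x \<in> \<A> n"
      have a: "tp (- n) \<otimes> x \<in> \<A> 0" using grade_tp(2)[OF x, of "- n"] by simp
      have "\<phi> (tp n \<otimes> (tp (- n) \<otimes> x)) = \<psi> (tp n \<otimes> (tp (- n) \<otimes> x))"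
        using finite_homsD(5)[OF h(1) tp_closed a] finite_homsD(5)[OF h(2) tp_closed a] fun_cong[OF eq, of n] by simp
      then show "\<phi> x = \<psi> x" using A.D_carrier[OF x] by simp
    qed
  qed
  moreover have "(\<lambda>\<phi> n. \<phi> (tp n)) ` carrier coinduced \<subseteq> {f. finite {n. f n \<noteq> \<zero>\<^bsub>N\<^esub>}}"
  proof (clarsimp)
    fix \<phi> assume \<phi>: "\<phi> \<in> finite_homs"
    have "{n. \<phi> (tp n) \<noteq> \<zero>\<^bsub>N\<^esub>} \<subseteq> supp \<phi>" using tp_degree by (auto simp: supp_def)
    then show "finite {n. \<phi> (tp n) \<noteq> \<zero>\<^bsub>N\<^esub>}" using finite_homsD(6)[OF \<phi>] finite_subset by blast
  qed
  ultimately have "inj_on (j \<circ> (\<lambda>\<phi> n. \<phi> (tp n))) (carrier coinduced)"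
    using j by (intro comp_inj_on) (auto intro: inj_on_subset)
  then show ?thesis by blast
qed

lemma zero_part_essentially_surjective:
  assumes \<iota>: "inj_on (\<iota> :: 'a \<Rightarrow> 'm) (carrier A)"
  shows "\<exists>M. graded_module A \<A> M \<and> isomorphic_objs (Mod_cat R) (zero_part M) N"
proof -
  obtain j :: "('a \<Rightarrow> 'm) \<Rightarrow> 'm" where j: "inj_on j (carrier coinduced)"
    using coinduced_inject[OF \<iota>] by blast
  let ?M = "transport_gmod j coinduced"
  have M: "graded_module A \<A> ?M" by (rule graded_module_transport[OF coinduced_graded j])
  have N: "right_module R N" using N.rmodule_axioms by (simp add: right_module_iff_rmodule)
  let ?k = "\<lambda>y. j (constant_hom y)"
  have ch: "constant_hom y \<in> finite_homs" if "y \<in> carrier N" for y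
    using constant_hom[OF that] by simp
  have inv: "inv_into finite_homs j (?k y) = constant_hom y" if "y \<in> carrier N" for y
    using inv_into_f_f[OF j] ch[OF that] by simp
  have 0: "inj_on ?k (carrier N)"
  proof (rule inj_onI)
    fix y z assume yz: "y \<in> carrier N" "z \<in> carrier N" "?k y = ?k z"
    then have "constant_hom y = constant_hom z"
      using j ch by (auto simp: inj_on_def)
    then show "y = z" using constant_hom_one yz(1,2) by metis
  qed
  have g0: "grade coinduced 0 = constant_hom ` carrier N"
  proof (intro equalityI subsetI)
    fix \<phi> assume \<phi>: "\<phi> \<in> grade coinduced 0"
    then have "\<phi> \<one> \<in> carrier N" using finite_homsD(3)[of \<phi> \<one>] by simp
    then show "\<phi> \<in> constant_hom ` carrier N" using constant_hom_unique[OF \<phi>] by blast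
  qed (use constant_hom in blast)
  have 1: "carrier (zero_part ?M) = ?k ` carrier N"
    unfolding zero_part_simps transport_gmod_simps g0 by (simp add: image_image)
  have hom: "constant_hom y \<oplus>\<^bsub>coinduced\<^esub> constant_hom z = constant_hom (y \<oplus>\<^bsub>N\<^esub> z)"
    if "y \<in> carrier N" "z \<in> carrier N" for y z
    using that A.component_mem[of _ 0] by (simp add: constant_hom_def N.ract_add_left cong: restrict_cong)
  have act: "ract coinduced (constant_hom y) a = constant_hom (ract N y a)"
    if "y \<in> carrier N" "a \<in> \<A> 0" for y a
    using that A.component_mem[of _ 0] N.ract_mult[of y a]
    by (simp add: constant_hom_def component_mult_left[OF that(2)] R_mult cong: restrict_cong)
  have 2: "\<zero>\<^bsub>zero_part ?M\<^esub> = ?k \<zero>\<^bsub>N\<^esub>"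
  proof -
    have "constant_hom \<zero>\<^bsub>N\<^esub> = \<zero>\<^bsub>coinduced\<^esub>"
      using A.component_mem[of _ 0] by (simp add: constant_hom_def cong: restrict_cong)
    then show ?thesis by (simp only: zero_part_simps transport_gmod_simps)
  qed
  have 3: "?k y \<oplus>\<^bsub>zero_part ?M\<^esub> ?k z = ?k (y \<oplus>\<^bsub>N\<^esub> z)" if "y \<in> carrier N" "z \<in> carrier N" for y z
    unfolding zero_part_simps transport_gmod_simps coinduced_simps(1) inv[OF that(1)] inv[OF that(2)] hom[OF that] ..
  have 4: "ract (zero_part ?M) (?k y) a = ?k (ract N y a)" if "y \<in> carrier N" "a \<in> carrier R" for y a
    using that(2)
    unfolding zero_part_simps transport_gmod_simps coinduced_simps(1) inv[OF that(1)] by (simp only: act[OF that(1)] R_simps)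
  have "iso_arrow (Mod_cat R) N (zero_part ?M) (restrict ?k (carrier N))"
    by (rule iso_arrow_Mod_cat[OF N right_module_transfer_hom[OF N 0 1 2 3 4]
          right_module_transfer_bij[OF N 0 1 2 3 4]])
  then have "isomorphic_objs (Mod_cat R) (zero_part ?M) N"
    unfolding isomorphic_objs_def iso_arrow_def by blast
  then show ?thesis using M by blast
qed

end

context unit_degree_one
begin

theorem zero_part_equivalence:
  assumes "inj_on (\<iota> :: 'a \<Rightarrow> 'm) (carrier A)"
  shows "fully_faithful_essentially_surjective (Gr A \<A> :: (('a, 'm) gmod, 'm \<Rightarrow> 'm) cat) (Mod_cat R) zero_part_functor"
  unfolding fully_faithful_essentially_surjective_def
proof (intro conjI ballI zero_part_is_functor)
  fix M N assume "M \<in> Obj (Gr A \<A> :: (('a, 'm) gmod, 'm \<Rightarrow> 'm) cat)"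
    "N \<in> Obj (Gr A \<A> :: (('a, 'm) gmod, 'm \<Rightarrow> 'm) cat)"
  then show "bij_betw (farr zero_part_functor M N) (Hom (Gr A \<A>) M N)
      (Hom (Mod_cat R) (fobj zero_part_functor M) (fobj zero_part_functor N))"
    using zero_part_bij[of M N] by (simp add: zero_part_functor_def)
next
  fix N assume "N \<in> Obj (Mod_cat R :: (('a, 'm) rmod, 'm \<Rightarrow> 'm) cat)"
  then interpret coinduction_ctx K A \<A> t R \<gamma> N
    by (simp add: coinduction_ctx_def unit_degree_one_axioms right_module_iff_rmodule)
  show "\<exists>M\<in>Obj (Gr A \<A>). isomorphic_objs (Mod_cat R) (fobj zero_part_functor M) N"
    using zero_part_essentially_surjective[OF assms] by auto
qed

lemma regular_gmod_simps [simp]: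
  "carrier (regular_gmod A \<A>) = carrier A" "\<zero>\<^bsub>regular_gmod A \<A>\<^esub> = \<zero>" "add (regular_gmod A \<A>) = add A"
  "ract (regular_gmod A \<A>) = monoid.mult A" "grade (regular_gmod A \<A>) n = \<A> n"
  by (simp_all add: regular_gmod_def regular_rmod_def rmod.extend_def)

lemma regular_gmod_graded: "graded_module A \<A> (regular_gmod A \<A>)"
proof -
  have "abelian_group (regular_gmod A \<A>) \<longleftrightarrow> abelian_group A"
    by (rule abelian_group_cong) simp_all
  moreover have "internal_direct_sum (regular_gmod A \<A>) UNIV \<A> \<longleftrightarrow> internal_direct_sum A UNIV \<A>"
    by (rule direct_sum_cong) simp_all
  moreover have "grade (regular_gmod A \<A>) = \<A>" by (simp add: fun_eq_iff)
  ultimately show ?thesis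
    using A.direct_sum
    by (auto simp: graded_module_def right_module_def ring_axioms abelian_group_axioms
        l_distr r_distr m_assoc grade_mult)
qed

lemma zero_part_regular:
  assumes \<iota>: "inj_on \<iota> (carrier A)"
  shows "isomorphic_objs (Mod_cat R) (zero_part (transport_gmod \<iota> (regular_gmod A \<A>)))
    (transport_rmod \<iota> (regular_rmod R))" "right_module R (transport_rmod \<iota> (regular_rmod R))"
proof -
  let ?M = "zero_part (transport_gmod \<iota> (regular_gmod A \<A>))" and ?N = "transport_rmod \<iota> (regular_rmod R)"
  interpret R: ring R by (rule ring_R)
  have reg: "carrier (regular_rmod R) = \<A> 0" "add (regular_rmod R) = add A" "\<zero>\<^bsub>regular_rmod R\<^esub> = \<zero>"
    "ract (regular_rmod R) = monoid.mult R"
    by (simp_all add: regular_rmod_def)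
  have \<iota>0: "inj_on \<iota> (\<A> 0)" using \<iota> by (rule inj_on_subset) auto
  have "abelian_group (regular_rmod R) \<longleftrightarrow> abelian_group R"
    by (rule abelian_group_cong) (simp_all add: reg)
  then have "right_module R (regular_rmod R)"
    using R.abelian_group_axioms R.l_distr R.r_distr R.m_assoc R.l_one R.r_one R.m_closed
    unfolding right_module_def reg by (auto simp: ring_R)
  then show N: "right_module R ?N" by (rule right_module_transport) (simp add: reg \<iota>0)
  have M: "right_module R ?M"
    by (intro zero_part_right_module graded_module_transport regular_gmod_graded) (simp add: \<iota>)
  have i: "inv_into (carrier A) \<iota> (\<iota> x) = x" "inv_into (\<A> 0) \<iota> (\<iota> x) = x" if "x \<in> \<A> 0" for x
    using that \<iota> \<iota>0 by simp_all
  have carr: "carrier ?M = \<iota> ` \<A> 0" "carrier ?N = \<iota> ` \<A> 0"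
    by (simp_all add: transport_gmod_simps transport_rmod_simps reg)
  have "restrict (\<lambda>x. x) (\<iota> ` \<A> 0) \<in> rmod_hom R ?M ?N"
    by (auto simp: rmod_hom_def carr transport_gmod_simps transport_rmod_simps reg i R_mult A.D_add)
  then have "iso_arrow (Mod_cat R) ?M ?N (restrict (\<lambda>x. x) (\<iota> ` \<A> 0))"
    by (rule iso_arrow_Mod_cat[OF M]) (unfold carr, auto simp: bij_betw_def inj_on_def)
  then show "isomorphic_objs (Mod_cat R) ?M ?N" unfolding isomorphic_objs_def by blast
qed

text \<open>
  Only isomorphisms are inverted in the quotient category, so \<open>proj A\<close> amounts to the graded modules
  with the shift, which the component of degree zero identifies with the modules over \<open>A\<^sub>0\<close>.
\<close>

theorem proj_equivalence:
  assumes \<iota>: "inj_on (\<iota> :: 'a \<Rightarrow> 'm) (carrier A)"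
  shows "proj \<iota> A \<A> \<simeq>\<^sub>t Mod_triple \<iota> R \<gamma>"
proof -
  interpret L: iso_localization "Gr A \<A> :: (('a, 'm) gmod, 'm \<Rightarrow> 'm) cat" "torsion_isos A \<A>"
    by (rule iso_localization_torsion)
  have "graded_module A \<A> (transport_gmod \<iota> (regular_gmod A \<A>))"
    by (intro graded_module_transport regular_gmod_graded) (simp add: \<iota>)
  then have "(localization (Gr A \<A>) (torsion_isos A \<A>), transport_gmod \<iota> (regular_gmod A \<A>),
      induced_functor (Gr A \<A>) (torsion_isos A \<A>) shift_functor) \<simeq>\<^sub>t
      (Mod_cat R, transport_rmod \<iota> (regular_rmod R), pullback_functor \<gamma>)"
    using zero_part_regular[OF \<iota>]
    by (intro L.triple_equiv_localization[OF shift_equivalence zero_part_equivalence[OF \<iota>]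
          pullback_equivalence[OF ring_R \<gamma>_ring_iso] _ _ _ zero_part_shift]) simp_all
  then show ?thesis
    by (simp add: proj_def QGr_def Mod_triple_def localization_functor_def)
qed

end

section \<open>Zhang twists\<close>

locale zhang = graded_alg K A \<A>
  for K :: "'k ring" and A :: "('k, 'a) module" (structure) and \<A> :: "int \<Rightarrow> 'a set" +
  fixes \<sigma> :: "'a \<Rightarrow> 'a"
  assumes graded_automorphism: "graded_algebra_iso K A \<A> A \<A> \<sigma>"
begin

text \<open>
  The properties that \<open>\<sigma>\<close> and its inverse share and that pass to composites, hence to all powers of
  \<open>\<sigma>\<close>.
\<close>

definition graded_endo :: "('a \<Rightarrow> 'a) \<Rightarrow> bool" where
  "graded_endo f \<longleftrightarrow> f \<in> ring_hom A A \<and> (\<forall>k\<in>carrier K. \<forall>x\<in>carrier A. f (k \<odot>\<^bsub>A\<^esub> x) = k \<odot>\<^bsub>A\<^esub> f x) \<and>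
     (\<forall>n. f ` \<A> n \<subseteq> \<A> n)"

lemma graded_algebra_iso_graded_endo: "graded_algebra_iso K A \<A> A \<A> f \<Longrightarrow> graded_endo f"
  by (auto simp: graded_algebra_iso_def algebra_iso_def ring_iso_def graded_endo_def)

lemma graded_endo_\<sigma>: "graded_endo \<sigma>"
  by (rule graded_algebra_iso_graded_endo[OF graded_automorphism])

lemma graded_endo_inv: "graded_endo (inv_into (carrier A) \<sigma>)"
proof (rule graded_algebra_iso_graded_endo[OF graded_algebra_iso_inverse[OF graded_automorphism]])
  show "k \<odot>\<^bsub>A\<^esub> x \<in> carrier A" if "k \<in> carrier K" "x \<in> carrier A" for k x
    using additive_on_closed[OF additive_smult] that by blast
  show "\<A> n \<subseteq> carrier A" for n using A.D_carrier by blast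
qed simp_all

lemma graded_endo_funpow: "graded_endo f \<Longrightarrow> graded_endo (f ^^ k)"
proof (induction k)
  case 0
  show ?case by (auto simp: graded_endo_def ring_hom_def)
next
  case (Suc k)
  then have f: "graded_endo f" "graded_endo (f ^^ k)" by simp_all
  have "f ^^ Suc k = f \<circ> (f ^^ k)" by simp
  moreover have "f \<circ> (f ^^ k) \<in> ring_hom A A"
    using f by (intro ring_hom_trans[of _ A A]) (simp_all add: graded_endo_def)
  moreover have "(f ^^ k) x \<in> carrier A" if "x \<in> carrier A" for x
    using f(2) ring_hom_closed that by (fastforce simp: graded_endo_def)
  ultimately show ?case using f by (auto simp: graded_endo_def image_subset_iff comp_def)
qed

definition \<sigma>_power :: "int \<Rightarrow> 'a \<Rightarrow> 'a" where "\<sigma>_power n = aut_power (carrier A) \<sigma> n"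

lemma graded_endo_\<sigma>_power: "graded_endo (\<sigma>_power n)"
  using graded_endo_funpow[OF graded_endo_\<sigma>] graded_endo_funpow[OF graded_endo_inv] by (simp add: \<sigma>_power_def aut_power_def)

lemma \<sigma>_power_closed [simp]: "x \<in> carrier A \<Longrightarrow> \<sigma>_power n x \<in> carrier A"
  and \<sigma>_power_mult: "\<lbrakk>x \<in> carrier A; y \<in> carrier A\<rbrakk> \<Longrightarrow> \<sigma>_power n (x \<otimes> y) = \<sigma>_power n x \<otimes> \<sigma>_power n y"
  and \<sigma>_power_add: "\<lbrakk>x \<in> carrier A; y \<in> carrier A\<rbrakk> \<Longrightarrow> \<sigma>_power n (x \<oplus> y) = \<sigma>_power n x \<oplus> \<sigma>_power n y"
  and \<sigma>_power_one: "\<sigma>_power n \<one> = \<one>"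
  using graded_endo_\<sigma>_power[of n] ring_hom_closed[of "\<sigma>_power n" A A x] ring_hom_mult[of "\<sigma>_power n" A A x y]
    ring_hom_add[of "\<sigma>_power n" A A x y] ring_hom_one[of "\<sigma>_power n" A A]
  by (auto simp: graded_endo_def)

lemma \<sigma>_power_smult: "\<lbrakk>k \<in> carrier K; x \<in> carrier A\<rbrakk> \<Longrightarrow> \<sigma>_power n (k \<odot>\<^bsub>A\<^esub> x) = k \<odot>\<^bsub>A\<^esub> \<sigma>_power n x"
  and \<sigma>_power_degree: "x \<in> \<A> m \<Longrightarrow> \<sigma>_power n x \<in> \<A> m"
  using graded_endo_\<sigma>_power[of n] by (auto simp: graded_endo_def image_subset_iff)

lemma \<sigma>_power_0 [simp]: "\<sigma>_power 0 x = x" and \<sigma>_power_1: "\<sigma>_power 1 x = \<sigma> x"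
  by (simp_all add: \<sigma>_power_def aut_power_def)

lemma \<sigma>_bij: "bij_betw \<sigma> (carrier A) (carrier A)"
  using graded_automorphism by (simp add: graded_algebra_iso_def algebra_iso_def ring_iso_def)

lemma \<sigma>_power_Suc:
  assumes "x \<in> carrier A"
  shows "\<sigma>_power (n + 1) x = \<sigma> (\<sigma>_power n x)"
proof (cases "0 \<le> n")
  case True
  then have "nat (n + 1) = Suc (nat n)" by simp
  with True show ?thesis by (simp add: \<sigma>_power_def aut_power_def)
next
  case False
  \<comment> \<open>For negative \<open>n\<close> the power \<open>\<sigma>\<^sup>n\<close> is the \<open>(k + 1)\<close>-st iterate of \<open>\<sigma>\<^sup>-\<^sup>1\<close>; one factor cancels against \<open>\<sigma>\<close>.\<close>
  define k where "k = nat (- (n + 1))"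
  have k: "nat (- n) = Suc k" and n: "n + 1 = - int k" using False by (auto simp: k_def)
  let ?i = "inv_into (carrier A) \<sigma>"
  have "\<sigma>_power (n + 1) x = (?i ^^ k) x"
    unfolding n by (cases k) (simp_all add: \<sigma>_power_def aut_power_def del: of_nat_Suc)
  moreover have "\<sigma>_power n x = ?i ((?i ^^ k) x)" using False k by (simp add: \<sigma>_power_def aut_power_def)
  moreover have "(?i ^^ k) x \<in> carrier A"
    using \<sigma>_power_closed[OF assms, of "n + 1"] calculation(1) by simp
  ultimately show ?thesis
    using \<sigma>_bij by (simp add: bij_betw_def f_inv_into_f)
qed

lemma \<sigma>_power_plus:
  assumes x: "x \<in> carrier A"
  shows "\<sigma>_power (n + m) x = \<sigma>_power n (\<sigma>_power m x)"
proof (induction n rule: int_induct[where k = 0])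
  case (step1 i)
  have "\<sigma>_power (i + 1 + m) x = \<sigma> (\<sigma>_power (i + m) x)" using \<sigma>_power_Suc[OF x, of "i + m"] by (simp add: algebra_simps)
  then show ?case using step1 \<sigma>_power_Suc[of "\<sigma>_power m x" i] x by simp
next
  case (step2 i)
  have "\<sigma> (\<sigma>_power (i - 1 + m) x) = \<sigma> (\<sigma>_power (i - 1) (\<sigma>_power m x))"
    using step2 \<sigma>_power_Suc[OF x, of "i - 1 + m"] \<sigma>_power_Suc[of "\<sigma>_power m x" "i - 1"] x by (simp add: algebra_simps)
  then show ?case
    using \<sigma>_bij x by (metis bij_betw_imp_inj_on inj_onD \<sigma>_power_closed)
qed simp

abbreviation Z :: "('k, 'a) module" where "Z \<equiv> zhang_twist A \<A> \<sigma>"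

lemma Z_simps [simp]:
  "carrier Z = carrier A" "add Z = add A" "\<zero>\<^bsub>Z\<^esub> = \<zero>" "\<one>\<^bsub>Z\<^esub> = \<one>" "smult Z = smult A"
  by (simp_all add: zhang_twist_def)

lemma star_additive_summand:
  "y \<in> carrier A \<Longrightarrow> additive_on (\<A> n) A A (\<lambda>x. x \<otimes> \<sigma>_power n y)"
  by (rule additive_onI) (simp_all add: A.D_carrier l_distr)

text \<open>
  The product of the twist is glued from the maps \<open>x \<mapsto> x \<otimes> \<sigma>\<^sup>n y\<close> on the components \<open>\<A> n\<close>; its
  additivity in \<open>x\<close> is thus an instance of the universal property.
\<close>

lemma star_glue: "x \<otimes>\<^bsub>Z\<^esub> y = A.glue A (\<lambda>n x. x \<otimes> \<sigma>_power n y) x"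
  by (simp add: zhang_twist_def A.glue_def \<sigma>_power_def)

lemma star_homogeneous:
  assumes "x \<in> \<A> n" "y \<in> carrier A"
  shows "x \<otimes>\<^bsub>Z\<^esub> y = x \<otimes> \<sigma>_power n y"
  unfolding star_glue
  by (rule A.glue_homogeneous[OF abelian_group_axioms star_additive_summand[OF assms(2)] assms(1)])

lemma star_additive_left: "y \<in> carrier A \<Longrightarrow> additive_on (carrier A) A A (\<lambda>x. x \<otimes>\<^bsub>Z\<^esub> y)"
  unfolding star_glue by (rule A.glue_additive[OF abelian_group_axioms star_additive_summand])

lemma star_closed [simp]: "x \<in> carrier A \<Longrightarrow> y \<in> carrier A \<Longrightarrow> x \<otimes>\<^bsub>Z\<^esub> y \<in> carrier A"
  using additive_on_closed[OF star_additive_left] by blast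

lemma star_add_left:
  "\<lbrakk>x \<in> carrier A; y \<in> carrier A; z \<in> carrier A\<rbrakk> \<Longrightarrow> (x \<oplus> y) \<otimes>\<^bsub>Z\<^esub> z = x \<otimes>\<^bsub>Z\<^esub> z \<oplus> y \<otimes>\<^bsub>Z\<^esub> z"
  using additive_on_add[OF star_additive_left] by blast

text \<open>
  The laws of the twist are reduced to homogeneous arguments by this lemma, one argument at a time.
\<close>

lemma additive_identity:
  assumes "\<And>x y. \<lbrakk>x \<in> carrier A; y \<in> carrier A\<rbrakk> \<Longrightarrow> f (x \<oplus> y) = f x \<oplus> f y"
    and "\<And>x y. \<lbrakk>x \<in> carrier A; y \<in> carrier A\<rbrakk> \<Longrightarrow> g (x \<oplus> y) = g x \<oplus> g y"
    and "\<And>x. x \<in> carrier A \<Longrightarrow> f x \<in> carrier A" "\<And>x. x \<in> carrier A \<Longrightarrow> g x \<in> carrier A"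
    and "\<And>n x. x \<in> \<A> n \<Longrightarrow> f x = g x" and "x \<in> carrier A"
  shows "f x = g x"
  by (rule A.additive_eqI[OF abelian_group_axioms _ _ assms(5) assms(6)])
    (rule additive_onI; simp add: assms(1-4))+

lemma star_add_right:
  assumes "x \<in> carrier A" "y \<in> carrier A" "z \<in> carrier A"
  shows "x \<otimes>\<^bsub>Z\<^esub> (y \<oplus> z) = x \<otimes>\<^bsub>Z\<^esub> y \<oplus> x \<otimes>\<^bsub>Z\<^esub> z"
proof (rule additive_identity[where f = "\<lambda>x. x \<otimes>\<^bsub>Z\<^esub> (y \<oplus> z)" and g = "\<lambda>x. x \<otimes>\<^bsub>Z\<^esub> y \<oplus> x \<otimes>\<^bsub>Z\<^esub> z", OF _ _ _ _ _ assms(1)])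
  show "x \<otimes>\<^bsub>Z\<^esub> (y \<oplus> z) = x \<otimes>\<^bsub>Z\<^esub> y \<oplus> x \<otimes>\<^bsub>Z\<^esub> z" if "x \<in> \<A> n" for x n
    using that assms A.D_carrier[OF that] by (simp add: star_homogeneous \<sigma>_power_add r_distr)
qed (use assms in \<open>simp_all add: star_add_left a_ac\<close>)

text \<open>
  For \<open>x \<in> \<A> n\<close> and \<open>y \<in> \<A> m\<close> both sides are \<open>x \<otimes> \<sigma>\<^sup>n y \<otimes> \<sigma>\<^sup>n\<^sup>+\<^sup>m z\<close>, since \<open>x \<otimes> \<sigma>\<^sup>n y\<close> has degree \<open>n + m\<close>.
\<close>

lemma star_assoc:
  assumes "x \<in> carrier A" "y \<in> carrier A" "z \<in> carrier A"
  shows "x \<otimes>\<^bsub>Z\<^esub> y \<otimes>\<^bsub>Z\<^esub> z = x \<otimes>\<^bsub>Z\<^esub> (y \<otimes>\<^bsub>Z\<^esub> z)"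
proof (rule additive_identity[where f = "\<lambda>x. x \<otimes>\<^bsub>Z\<^esub> y \<otimes>\<^bsub>Z\<^esub> z" and g = "\<lambda>x. x \<otimes>\<^bsub>Z\<^esub> (y \<otimes>\<^bsub>Z\<^esub> z)", OF _ _ _ _ _ assms(1)])
  fix n x assume x: "x \<in> \<A> n"
  have xc: "x \<in> carrier A" using x A.D_carrier by blast
  show "x \<otimes>\<^bsub>Z\<^esub> y \<otimes>\<^bsub>Z\<^esub> z = x \<otimes>\<^bsub>Z\<^esub> (y \<otimes>\<^bsub>Z\<^esub> z)"
  proof (rule additive_identity[where f = "\<lambda>y. x \<otimes>\<^bsub>Z\<^esub> y \<otimes>\<^bsub>Z\<^esub> z" and g = "\<lambda>y. x \<otimes>\<^bsub>Z\<^esub> (y \<otimes>\<^bsub>Z\<^esub> z)", OF _ _ _ _ _ assms(2)])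
    fix m y assume y: "y \<in> \<A> m"
    have yc: "y \<in> carrier A" using y A.D_carrier by blast
    have "x \<otimes>\<^bsub>Z\<^esub> y \<otimes>\<^bsub>Z\<^esub> z = x \<otimes> \<sigma>_power n y \<otimes> \<sigma>_power (n + m) z"
      using star_homogeneous[OF grade_mult[OF x \<sigma>_power_degree[OF y]] assms(3)] star_homogeneous[OF x yc] by simp
    also have "\<dots> = x \<otimes>\<^bsub>Z\<^esub> (y \<otimes>\<^bsub>Z\<^esub> z)"
      using xc yc assms(3) by (simp add: star_homogeneous[OF x] star_homogeneous[OF y] \<sigma>_power_mult \<sigma>_power_plus m_assoc)
    finally show "x \<otimes>\<^bsub>Z\<^esub> y \<otimes>\<^bsub>Z\<^esub> z = x \<otimes>\<^bsub>Z\<^esub> (y \<otimes>\<^bsub>Z\<^esub> z)" .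
  qed (use xc assms in \<open>simp_all add: star_add_left star_add_right\<close>)
qed (use assms in \<open>simp_all add: star_add_left\<close>)

lemma star_one:
  assumes "x \<in> carrier A"
  shows "\<one> \<otimes>\<^bsub>Z\<^esub> x = x" "x \<otimes>\<^bsub>Z\<^esub> \<one> = x"
proof -
  show "\<one> \<otimes>\<^bsub>Z\<^esub> x = x" using assms by (simp add: star_homogeneous[OF one_degree_zero])
  show "x \<otimes>\<^bsub>Z\<^esub> \<one> = x"
  proof (rule additive_identity[where f = "\<lambda>x. x \<otimes>\<^bsub>Z\<^esub> \<one>" and g = "\<lambda>x. x", OF _ _ _ _ _ assms])
    show "x \<otimes>\<^bsub>Z\<^esub> \<one> = x" if "x \<in> \<A> n" for x n
      using A.D_carrier[OF that] by (simp add: star_homogeneous[OF that] \<sigma>_power_one)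
  qed (simp_all add: star_add_left)
qed

lemma star_smult:
  assumes k: "k \<in> carrier K" and x: "x \<in> carrier A" and y: "y \<in> carrier A"
  shows "(k \<odot>\<^bsub>A\<^esub> x) \<otimes>\<^bsub>Z\<^esub> y = k \<odot>\<^bsub>A\<^esub> (x \<otimes>\<^bsub>Z\<^esub> y)" "x \<otimes>\<^bsub>Z\<^esub> (k \<odot>\<^bsub>A\<^esub> y) = k \<odot>\<^bsub>A\<^esub> (x \<otimes>\<^bsub>Z\<^esub> y)"
proof -
  note sm = additive_on_closed[OF additive_smult[OF k]] additive_on_add[OF additive_smult[OF k]]
  show "(k \<odot>\<^bsub>A\<^esub> x) \<otimes>\<^bsub>Z\<^esub> y = k \<odot>\<^bsub>A\<^esub> (x \<otimes>\<^bsub>Z\<^esub> y)"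
  proof (rule additive_identity[where f = "\<lambda>x. (k \<odot>\<^bsub>A\<^esub> x) \<otimes>\<^bsub>Z\<^esub> y" and g = "\<lambda>x. k \<odot>\<^bsub>A\<^esub> (x \<otimes>\<^bsub>Z\<^esub> y)", OF _ _ _ _ _ x])
    show "(k \<odot>\<^bsub>A\<^esub> x) \<otimes>\<^bsub>Z\<^esub> y = k \<odot>\<^bsub>A\<^esub> (x \<otimes>\<^bsub>Z\<^esub> y)" if "x \<in> \<A> n" for x n
      using k y A.D_carrier[OF that]
      by (simp add: star_homogeneous[OF that] star_homogeneous[OF grade_smult[OF k that]] smult_mult)
  qed (use y in \<open>simp_all add: sm star_add_left\<close>)
  show "x \<otimes>\<^bsub>Z\<^esub> (k \<odot>\<^bsub>A\<^esub> y) = k \<odot>\<^bsub>A\<^esub> (x \<otimes>\<^bsub>Z\<^esub> y)"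
  proof (rule additive_identity[where f = "\<lambda>x. x \<otimes>\<^bsub>Z\<^esub> (k \<odot>\<^bsub>A\<^esub> y)" and g = "\<lambda>x. k \<odot>\<^bsub>A\<^esub> (x \<otimes>\<^bsub>Z\<^esub> y)", OF _ _ _ _ _ x])
    show "x \<otimes>\<^bsub>Z\<^esub> (k \<odot>\<^bsub>A\<^esub> y) = k \<odot>\<^bsub>A\<^esub> (x \<otimes>\<^bsub>Z\<^esub> y)" if "x \<in> \<A> n" for x n
      using k y A.D_carrier[OF that] by (simp add: star_homogeneous[OF that] sm \<sigma>_power_smult smult_mult)
  qed (use y in \<open>simp_all add: sm star_add_left\<close>)
qed

theorem zhang_twist_graded_algebra: "graded_algebra K Z \<A>"
proof -
  have ab: "abelian_group Z \<longleftrightarrow> abelian_group A" by (rule abelian_group_cong) simp_all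
  have ring: "ring Z"
  proof (rule ringI)
    show "abelian_group Z" using ab abelian_group_axioms by simp
    show "monoid Z" by (rule monoidI) (simp_all add: star_assoc star_one)
  qed (simp_all add: star_add_left star_add_right)
  have "module K Z"
    using smult_module ab by (simp add: module_def module_axioms_def)
  moreover have "internal_direct_sum Z UNIV \<A>"
    using A.direct_sum direct_sum_cong[of Z A UNIV \<A>] by simp
  moreover have "x \<otimes>\<^bsub>Z\<^esub> y \<in> \<A> (n + m)" if "x \<in> \<A> n" "y \<in> \<A> m" for x y n m
    using grade_mult[OF that(1) \<sigma>_power_degree[OF that(2)]] star_homogeneous[OF that(1) A.D_carrier[OF that(2)]] by simp
  ultimately show ?thesis
    using ring graded_algebra grade_smult
    by (simp add: graded_algebra_def assoc_algebra_def star_smult)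
qed

text \<open>
  The inverse of \<open>t\<close> in the twist is \<open>\<sigma>\<^sup>-\<^sup>1 (t\<^sup>-\<^sup>1)\<close>, which has degree \<open>- 1\<close>.
\<close>

lemma zhang_twist_unit:
  assumes t: "t \<in> Units A" "t \<in> \<A> 1"
  shows "t \<in> Units Z"
proof -
  have tc: "t \<in> carrier A" "inv t \<in> carrier A" using t by auto
  have u: "\<sigma>_power (- 1) (inv t) \<in> \<A> (- 1)" using \<sigma>_power_degree homogeneous_inverse[OF t] by blast
  have uc: "\<sigma>_power (- 1) (inv t) \<in> carrier A" using tc by simp
  have "t \<otimes>\<^bsub>Z\<^esub> \<sigma>_power (- 1) (inv t) = \<one>"
    using t tc \<sigma>_power_plus[of "inv t" 1 "- 1"] by (simp add: star_homogeneous[OF t(2)])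
  moreover have "\<sigma>_power (- 1) (inv t) \<otimes>\<^bsub>Z\<^esub> t = \<one>"
    using t tc \<sigma>_power_mult[of "inv t" t "- 1"] by (simp add: star_homogeneous[OF u] \<sigma>_power_one)
  ultimately show ?thesis using tc uc by (auto simp: Units_def)
qed

end

lemma degree_zero_simps [simp]:
  "carrier (degree_zero A \<A>) = \<A> 0" "add (degree_zero A \<A>) = add A" "\<zero>\<^bsub>degree_zero A \<A>\<^esub> = \<zero>\<^bsub>A\<^esub>"
  "\<one>\<^bsub>degree_zero A \<A>\<^esub> = \<one>\<^bsub>A\<^esub>" "smult (degree_zero A \<A>) = smult A"
  "monoid.mult (degree_zero A \<A>) = monoid.mult A"
  by (simp_all add: degree_zero_def)

lemma (in graded_alg) unit_degree_one_degree_zero: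
  assumes t: "t \<in> Units A" "t \<in> \<A> 1"
    and \<alpha>: "\<And>a. a \<in> \<A> 0 \<Longrightarrow> \<alpha> a = t \<otimes> a \<otimes> inv t"
  shows "unit_degree_one K A \<A> t (degree_zero A \<A>) \<alpha>"
proof unfold_locales
  fix a assume a: "a \<in> \<A> 0"
  have c: "a \<in> carrier A" "t \<in> carrier A" "inv t \<in> carrier A" using a t A.D_carrier by auto
  show "\<alpha> a \<in> \<A> 0"
    using grade_mult[OF grade_mult[OF t(2) a] homogeneous_inverse[OF t]] by (simp add: \<alpha>[OF a])
  show "\<alpha> a \<otimes> t = t \<otimes> a" using c t by (simp add: \<alpha>[OF a] m_assoc)
qed (use t in simp_all)

text \<open>
  In the twist \<open>t \<star> a = t \<sigma>(a) = \<alpha>(\<sigma>(a)) t = \<alpha>(\<sigma>(a)) \<star> t\<close>, so conjugation by \<open>t\<close> becomes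
  \<open>\<alpha> \<circ> \<sigma>\<^sub>0\<close>, while the ring in degree zero is unchanged.
\<close>

lemma (in zhang) unit_degree_one_twist:
  assumes U: "unit_degree_one K A \<A> t (degree_zero A \<A>) \<alpha>"
  shows "unit_degree_one K Z \<A> t (degree_zero A \<A>) (\<alpha> \<circ> restrict \<sigma> (\<A> 0))"
proof -
  interpret U: unit_degree_one K A \<A> t "degree_zero A \<A>" \<alpha> by (rule U)
  interpret Z: graded_alg K Z \<A> using zhang_twist_graded_algebra by (simp add: graded_alg_iff)
  show ?thesis
  proof unfold_locales
    show "t \<in> Units Z" by (rule zhang_twist_unit[OF U.t_unit U.t_degree])
    show "t \<in> \<A> 1" by (rule U.t_degree)
    show "a \<otimes>\<^bsub>degree_zero A \<A>\<^esub> b = a \<otimes>\<^bsub>Z\<^esub> b" if "a \<in> \<A> 0" "b \<in> \<A> 0" for a b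
      using that by (simp add: star_homogeneous)
    fix a assume a: "a \<in> \<A> 0"
    have \<sigma>a: "\<sigma> a \<in> \<A> 0" using \<sigma>_power_degree[OF a, of 1] by (simp add: \<sigma>_power_1)
    show "(\<alpha> \<circ> restrict \<sigma> (\<A> 0)) a \<in> \<A> 0" using a \<sigma>a by simp
    show "(\<alpha> \<circ> restrict \<sigma> (\<A> 0)) a \<otimes>\<^bsub>Z\<^esub> t = t \<otimes>\<^bsub>Z\<^esub> a"
      using a \<sigma>a U.\<gamma>_comm[OF \<sigma>a] star_homogeneous[OF U.\<gamma>_closed[OF \<sigma>a] U.t_closed]
        star_homogeneous[OF U.t_degree] by (simp add: \<sigma>_power_1)
  qed simp_all
qed

theorem proposition3p6:
  fixes K :: "'k ring" and A :: "('k, 'a) module" and \<A> :: "int \<Rightarrow> 'a set"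
    and t :: 'a and \<alpha> :: "'a \<Rightarrow> 'a" and \<iota> :: "'a \<Rightarrow> 'm"
  assumes "field K"
    and "graded_algebra K A \<A>"
    and "t \<in> Units A" and "t \<in> \<A> 1"
    and "\<And>a. a \<in> \<A> 0 \<Longrightarrow> \<alpha> a = t \<otimes>\<^bsub>A\<^esub> a \<otimes>\<^bsub>A\<^esub> inv\<^bsub>A\<^esub> t"
    and universe: "inj_on \<iota> (carrier A)"
  shows
    "(algebra_iso K (degree_zero A \<A>) (degree_zero A \<A>) \<alpha> \<and>
      graded_algebra_iso K
        (skew_laurent (degree_zero A \<A>) \<alpha>) (skew_laurent_grading (degree_zero A \<A>))
        A \<A> (laurent_eval A t) \<and>
      strongly_graded A \<A>) \<and>
     (naturally_isomorphic
        (Mod_cat (degree_zero A \<A>) :: (('a, 'm) rmod, 'm \<Rightarrow> 'm) cat)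
        (Mod_cat (degree_zero A \<A>))
        (tensor_functor (degree_zero A \<A>) (component_bimod A \<A> 1))
        (pullback_functor \<alpha>) \<and>
      proj \<iota> A \<A> \<simeq>\<^sub>t Mod_triple \<iota> (degree_zero A \<A>) \<alpha>) \<and>
     (\<forall>\<sigma> \<sigma>\<^sub>0. graded_algebra_iso K A \<A> A \<A> \<sigma> \<longrightarrow> \<sigma>\<^sub>0 = restrict \<sigma> (\<A> 0) \<longrightarrow>
        t \<in> Units (zhang_twist A \<A> \<sigma>) \<and>
        algebra_iso K (degree_zero A \<A>) (degree_zero A \<A>) (\<alpha> \<circ> \<sigma>\<^sub>0) \<and>
        (\<exists>\<phi>. graded_algebra_iso K (zhang_twist A \<A> \<sigma>) \<A>
           (skew_laurent (degree_zero A \<A>) (\<alpha> \<circ> \<sigma>\<^sub>0))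
           (skew_laurent_grading (degree_zero A \<A>)) \<phi>) \<and>
        proj \<iota> (zhang_twist A \<A> \<sigma>) \<A> \<simeq>\<^sub>t Mod_triple \<iota> (degree_zero A \<A>) (\<alpha> \<circ> \<sigma>\<^sub>0))"
proof -
  interpret graded_alg K A \<A> using assms(2) by (simp add: graded_alg_iff)
  have U: "unit_degree_one K A \<A> t (degree_zero A \<A>) \<alpha>"
    by (rule unit_degree_one_degree_zero[OF assms(3,4,5)])
  interpret U: unit_degree_one K A \<A> t "degree_zero A \<A>" \<alpha> by (rule U)
  have twist: "t \<in> Units (zhang_twist A \<A> \<sigma>) \<and>
      algebra_iso K (degree_zero A \<A>) (degree_zero A \<A>) (\<alpha> \<circ> restrict \<sigma> (\<A> 0)) \<and>
      (\<exists>\<phi>. graded_algebra_iso K (zhang_twist A \<A> \<sigma>) \<A>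
         (skew_laurent (degree_zero A \<A>) (\<alpha> \<circ> restrict \<sigma> (\<A> 0)))
         (skew_laurent_grading (degree_zero A \<A>)) \<phi>) \<and>
      proj \<iota> (zhang_twist A \<A> \<sigma>) \<A> \<simeq>\<^sub>t Mod_triple \<iota> (degree_zero A \<A>) (\<alpha> \<circ> restrict \<sigma> (\<A> 0))"
    if \<sigma>: "graded_algebra_iso K A \<A> A \<A> \<sigma>" for \<sigma>
  proof -
    interpret S: zhang K A \<A> \<sigma> by unfold_locales (rule \<sigma>)
    interpret Z: unit_degree_one K "zhang_twist A \<A> \<sigma>" \<A> t "degree_zero A \<A>" "\<alpha> \<circ> restrict \<sigma> (\<A> 0)"
      by (rule S.unit_degree_one_twist[OF U])
    show ?thesis
      using Z.t_unit Z.\<gamma>_algebra_iso Z.laurent_iso_inverse Z.proj_equivalence[of \<iota>] universe by auto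
  qed
  show ?thesis
    using U.\<gamma>_algebra_iso U.laurent_iso U.strongly_graded U.tensor_functor_iso
      U.proj_equivalence[OF universe] twist by blast
qed

end
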